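(* Let $h$ be a $C^2$ function on $\mathbb{R}^+=(0,\infty)$ such that (A-1) $\lim_{t\to0^+}e^{h(t)}t^{k}=a<+\infty$, and (A-2) $\inf_{t\in(0,+\infty)}t\,h'(t)=b>2-k$. Let $f(x)=e^{h(|x|)}$. Let $\Sigma$ be a closed minimal $(k-1)$-dimensional submanifold of the unit sphere $S^{n-1}(1)\subset\mathbb{R}^n$ with globally flat normal bundle. If the squared norm of the second fundamental form of $\Sigma$ in $S^{n-1}(1)$ satisfies $$|\mathbf{A}_\Sigma|^2\le\frac{(k-2+b)^2}{4}+b$$ on $\Sigma$, then the cone $C(\Sigma)$ over $\Sigma$ is $f$-stable.
   Context: $C(\Sigma)=\{tx: t\ge0,\ x\in\Sigma\}\subset\mathbb{R}^n$, a $k$-dimensional cone. The normal bundle of $\Sigma$ in $S^{n-1}(1)$ is globally flat if it admits a global frame of normal fields that are parallel for the normal connection. Stability is for the functional $\mathcal{E}_f(M)=\int_M f\,d\mathcal{H}_k$ ($\mathcal{H}_k$ is $k$-dimensional Hausdorff measure). Let $D$ be the flat connection of $\mathbb{R}^n$, let $(\cdot)^\perp$ be the normal projection, let $\mathbf{B}(X,Y)=(D_XY)^\perp$, let $e_1,\dots,e_k$ be a local orthonormal tangent frame, and let $\mathbf{H}=\sum_i\mathbf{B}(e_i,e_i)$. A $C^2$ submanifold $M$ is $f$-stationary in $U=\mathbb{R}^n\setminus\{0\}$ if the first variation of $\mathcal{E}_f$ vanishes for deformations compactly supported in $U$ (equivalently $f\mathbf{H}=(Df)^\perp$ on $M\cap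 U$; minimal cones satisfy this for radial $f$). It is then $f$-stable if for every $C^1$ normal vector field $X$ along $M$ with compact support in $M\cap U$, $$\int_M f\Big[\sum_{i,j=1}^k\langle\mathbf{B}(e_i,e_j),X\rangle^2+\langle\mathbf{H},X\rangle^2\Big]d\mathcal{H}_k\le\int_M \Big(f\sum_{i=1}^k|(D_{e_i}X)^\perp|^2+\mathrm{Hess} f(X,X)\Big)d\mathcal{H}_k .$$ For the cone $C(\Sigma)$ this is applied to its regular part $M=C(\Sigma)\setminus\{0\}$, i.e. with normal fields compactly supported away from the origin. *)

theory Defs
  imports "HOL-Analysis.Analysis"
begin

section \<open>Hausdorff measure\<close>

text \<open>
  Normalised so that in dimension \<open>d\<close> it agrees with Lebesgue measure. The empty set is given
  weight \<open>0\<close> separately because of \<open>0 ^ 0 = 1\<close> when \<open>d = 0\<close>; covering sets are required to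
  be bounded because \<^const>\<open>diameter\<close> is unspecified otherwise. The outer measure is a metric
  outer measure, hence countably additive on Borel sets.
\<close>

definition hausdorff_pre :: "nat \<Rightarrow> real \<Rightarrow> 'a::metric_space set \<Rightarrow> ennreal" where
  "hausdorff_pre d \<delta> A =
     (INF C\<in>{C :: nat \<Rightarrow> 'a set. A \<subseteq> (\<Union>i. C i) \<and> (\<forall>i. bounded (C i) \<and> diameter (C i) \<le> \<delta>)}.
        \<Sum>i. if C i = {} then 0 else ennreal (unit_ball_vol (real d) * (diameter (C i) / 2) ^ d))"

definition hausdorff_outer :: "nat \<Rightarrow> 'a::metric_space set \<Rightarrow> ennreal" where
  "hausdorff_outer d A = (SUP \<delta>\<in>{0<..}. hausdorff_pre d \<delta> A)"

definition hausdorff_measure :: "nat \<Rightarrow> 'a::metric_space measure" where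
  "hausdorff_measure d = measure_of UNIV (sets borel) (hausdorff_outer d)"


section \<open>Differentiability classes and derivatives\<close>

text \<open>The two predicates are meant for open \<open>U\<close>.\<close>

definition C1_on :: "'a::real_normed_vector set \<Rightarrow> ('a \<Rightarrow> 'b::real_normed_vector) \<Rightarrow> bool" where
  "C1_on U f \<longleftrightarrow>
     (\<exists>f'. (\<forall>x\<in>U. (f has_derivative blinfun_apply (f' x)) (at x)) \<and> continuous_on U f')"

definition C2_on :: "'a::real_normed_vector set \<Rightarrow> ('a \<Rightarrow> 'b::real_normed_vector) \<Rightarrow> bool" where
  "C2_on U f \<longleftrightarrow>
     (\<exists>f'. (\<forall>x\<in>U. (f has_derivative blinfun_apply (f' x)) (at x)) \<and> C1_on U f')"

definition grad :: "('a::real_inner \<Rightarrow> real) \<Rightarrow> 'a \<Rightarrow> 'a" where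
  "grad f x = (THE D. GDERIV f x :> D)"

definition hess :: "('a::real_normed_vector \<Rightarrow> real) \<Rightarrow> 'a \<Rightarrow> 'a \<Rightarrow> 'a \<Rightarrow> real" where
  "hess f x u v = frechet_derivative (\<lambda>y. frechet_derivative f (at y) v) (at x) u"


section \<open>Linear algebra\<close>

text \<open>Orthogonal projection onto a linear subspace \<open>W\<close>.\<close>

definition oproj :: "'a::euclidean_space set \<Rightarrow> 'a \<Rightarrow> 'a" where
  "oproj W x = (THE y. y \<in> W \<and> (\<forall>w\<in>W. (x - y) \<bullet> w = 0))"

text \<open>
  Some orthonormal basis of a linear subspace \<open>W\<close>. It is only used to form traces and squared
  norms of bilinear maps on \<open>W\<close>, which do not depend on the basis.
\<close>

definition onb :: "'a::euclidean_space set \<Rightarrow> 'a set" where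
  "onb W = (SOME E. E \<subseteq> W \<and> span E = W \<and> pairwise orthogonal E \<and> (\<forall>e\<in>E. norm e = 1))"


section \<open>Submanifolds of Euclidean space\<close>

text \<open>
  Embedded \<open>C\<^sup>2\<close> submanifolds of dimension \<open>m\<close> without boundary: near each of its points \<open>M\<close> is
  straightened to an \<open>m\<close>-dimensional linear subspace by a \<open>C\<^sup>2\<close> diffeomorphism \<open>\<Phi>\<close> between
  open subsets of the ambient space.
\<close>

definition C2_submanifold :: "nat \<Rightarrow> 'a::euclidean_space set \<Rightarrow> bool" where
  "C2_submanifold m M \<longleftrightarrow>
     (\<forall>p\<in>M. \<exists>U \<Phi> \<Psi> V. open U \<and> p \<in> U \<and> open (\<Phi> ` U) \<and>
        C2_on U (\<Phi> :: 'a \<Rightarrow> 'a) \<and> C2_on (\<Phi> ` U) \<Psi> \<and> (\<forall>x\<in>U. \<Psi> (\<Phi> x) = x) \<and>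
        subspace V \<and> dim V = m \<and> \<Phi> ` (M \<inter> U) = V \<inter> \<Phi> ` U)"

text \<open>Velocities of curves in \<open>M\<close> through \<open>p\<close>.\<close>

definition tangent_space :: "'a::euclidean_space set \<Rightarrow> 'a \<Rightarrow> 'a set" where
  "tangent_space M p =
     {v. \<exists>\<gamma> :: real \<Rightarrow> 'a. range \<gamma> \<subseteq> M \<and> \<gamma> 0 = p \<and> (\<gamma> has_vector_derivative v) (at 0)}"

text \<open>
  In what follows \<open>M\<close> is a submanifold of a submanifold \<open>N\<close> of Euclidean space; \<open>N\<close> is either
  \<^term>\<open>UNIV\<close> or the unit sphere.
\<close>

definition normal_space :: "'a::euclidean_space set \<Rightarrow> 'a set \<Rightarrow> 'a \<Rightarrow> 'a set" where
  "normal_space N M p = {w \<in> tangent_space N p. \<forall>v\<in>tangent_space M p. w \<bullet> v = 0}"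

definition C1_field :: "'a::euclidean_space set \<Rightarrow> ('a \<Rightarrow> 'a) \<Rightarrow> bool" where
  "C1_field M X \<longleftrightarrow>
     (\<forall>p\<in>M. \<exists>U Y. open U \<and> p \<in> U \<and> C1_on U Y \<and> (\<forall>x\<in>M \<inter> U. Y x = X x))"

definition tangent_field :: "'a::euclidean_space set \<Rightarrow> ('a \<Rightarrow> 'a) \<Rightarrow> bool" where
  "tangent_field M X \<longleftrightarrow> C1_field M X \<and> (\<forall>p\<in>M. X p \<in> tangent_space M p)"

definition normal_field :: "'a::euclidean_space set \<Rightarrow> 'a set \<Rightarrow> ('a \<Rightarrow> 'a) \<Rightarrow> bool" where
  "normal_field N M X \<longleftrightarrow> C1_field M X \<and> (\<forall>p\<in>M. X p \<in> normal_space N M p)"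

text \<open>
  The flat derivative \<open>D\<^sub>u X\<close> of a field \<open>X\<close> defined along \<open>M\<close>, for \<open>u\<close> tangent to \<open>M\<close> at \<open>p\<close>.
  A derivative within \<open>M\<close> is not unique as a linear map on the ambient space, but all of
  them agree on \<^term>\<open>tangent_space M p\<close>.
\<close>

definition flat_deriv :: "'a::euclidean_space set \<Rightarrow> ('a \<Rightarrow> 'a) \<Rightarrow> 'a \<Rightarrow> 'a \<Rightarrow> 'a" where
  "flat_deriv M X p u = frechet_derivative X (at p within M) u"

text \<open>The Levi-Civita connection of \<open>N\<close> applied to a field along \<open>M\<close> that is tangent to \<open>N\<close>.\<close>

definition cov_deriv :: "'a::euclidean_space set \<Rightarrow> 'a set \<Rightarrow> ('a \<Rightarrow> 'a) \<Rightarrow> 'a \<Rightarrow> 'a \<Rightarrow> 'a" where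
  "cov_deriv N M X p u = oproj (tangent_space N p) (flat_deriv M X p u)"

definition normal_conn :: "'a::euclidean_space set \<Rightarrow> 'a set \<Rightarrow> ('a \<Rightarrow> 'a) \<Rightarrow> 'a \<Rightarrow> 'a \<Rightarrow> 'a" where
  "normal_conn N M X p u = oproj (normal_space N M p) (cov_deriv N M X p u)"

definition tangent_extension ::
    "'a::euclidean_space set \<Rightarrow> 'a \<Rightarrow> 'a \<Rightarrow> ('a \<Rightarrow> 'a) \<Rightarrow> bool" where
  "tangent_extension M p v X \<longleftrightarrow> (\<exists>U. open U \<and> p \<in> U \<and> tangent_field (M \<inter> U) X) \<and> X p = v"

text \<open>
  Second fundamental form of \<open>M\<close> in \<open>N\<close>: the normal component of the derivative in direction
  \<open>u\<close> of a local tangent field extending \<open>v\<close>. By tensoriality the choice of the extension is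
  irrelevant. For \<^term>\<open>N = UNIV\<close> this is \<open>\<^bold>B\<close>, for \<open>N\<close> the sphere it is \<open>\<^bold>A\<close>.
\<close>

definition second_ff :: "'a::euclidean_space set \<Rightarrow> 'a set \<Rightarrow> 'a \<Rightarrow> 'a \<Rightarrow> 'a \<Rightarrow> 'a" where
  "second_ff N M p u v =
     oproj (normal_space N M p) (cov_deriv N M (SOME V. tangent_extension M p v V) p u)"

definition second_ff_normsq :: "'a::euclidean_space set \<Rightarrow> 'a set \<Rightarrow> 'a \<Rightarrow> real" where
  "second_ff_normsq N M p =
     (\<Sum>u\<in>onb (tangent_space M p). \<Sum>v\<in>onb (tangent_space M p). (norm (second_ff N M p u v))\<^sup>2)"

definition mean_curv :: "'a::euclidean_space set \<Rightarrow> 'a set \<Rightarrow> 'a \<Rightarrow> 'a" where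
  "mean_curv N M p = (\<Sum>u\<in>onb (tangent_space M p). second_ff N M p u u)"

definition minimal_in :: "'a::euclidean_space set \<Rightarrow> 'a set \<Rightarrow> bool" where
  "minimal_in N M \<longleftrightarrow> (\<forall>p\<in>M. mean_curv N M p = 0)"

definition globally_flat_normal_bundle :: "'a::euclidean_space set \<Rightarrow> 'a set \<Rightarrow> bool" where
  "globally_flat_normal_bundle N M \<longleftrightarrow>
     (\<exists>(r::nat) \<nu>.
        (\<forall>i<r. normal_field N M (\<nu> i) \<and>
               (\<forall>p\<in>M. \<forall>u\<in>tangent_space M p. normal_conn N M (\<nu> i) p u = 0)) \<and>
        (\<forall>p\<in>M. inj_on (\<lambda>i. \<nu> i p) {..<r} \<and> independent ((\<lambda>i. \<nu> i p) ` {..<r}) \<and>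
               span ((\<lambda>i. \<nu> i p) ` {..<r}) = normal_space N M p))"


section \<open>Stability for the weighted area functional\<close>

definition cone_over :: "'a::real_vector set \<Rightarrow> 'a set" where
  "cone_over S = {t *\<^sub>R x | t x. 0 \<le> t \<and> x \<in> S}"

text \<open>
  Stationarity for \<open>M \<mapsto> \<integral>\<^sub>M f\<close>, expressed by the Euler--Lagrange equation
  \<open>f \<^bold>H = (D f)\<^sup>\<bottom>\<close> of the functional.
\<close>

definition f_stationary :: "nat \<Rightarrow> ('a::euclidean_space \<Rightarrow> real) \<Rightarrow> 'a set \<Rightarrow> bool" where
  "f_stationary k f M \<longleftrightarrow> C2_submanifold k M \<and>
     (\<forall>p\<in>M. f p *\<^sub>R mean_curv UNIV M p = oproj (normal_space UNIV M p) (grad f p))"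

text \<open>
  For \<open>f\<close> of class \<open>C\<^sup>2\<close> near \<open>M\<close> both integrands are continuous with compact support in \<open>M\<close>,
  hence integrable.
\<close>

definition f_stable :: "nat \<Rightarrow> ('a::euclidean_space \<Rightarrow> real) \<Rightarrow> 'a set \<Rightarrow> bool" where
  "f_stable k f M \<longleftrightarrow> f_stationary k f M \<and>
     (\<forall>X. normal_field UNIV M X \<and> (\<exists>K. compact K \<and> K \<subseteq> M \<and> (\<forall>x\<in>M - K. X x = 0)) \<longrightarrow>
        (LINT x:M|hausdorff_measure k.
           f x * ((\<Sum>u\<in>onb (tangent_space M x). \<Sum>v\<in>onb (tangent_space M x).
                     (second_ff UNIV M x u v \<bullet> X x)\<^sup>2) + (mean_curv UNIV M x \<bullet> X x)\<^sup>2))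
        \<le> (LINT x:M|hausdorff_measure k.
             f x * (\<Sum>u\<in>onb (tangent_space M x). (norm (normal_conn UNIV M X x u))\<^sup>2)
             + hess f x (X x) (X x)))"

end

theory Submission
  imports Defs
begin

text \<open>
  Write \<open>r = |x|\<close> and \<open>\<alpha> = (k - 2 + b) / 2 > 0\<close>. On the cone the second fundamental form is
  \<open>r\<^sup>-\<^sup>1\<close> times that of \<open>\<Sigma>\<close> and vanishes in the radial direction, so the left-hand integrand is at most
  \<open>f (\<alpha>\<^sup>2 + b) |X|\<^sup>2 / r\<^sup>2\<close>. On the right-hand side \<open>Hess f(X, X) = f h'(r) |X|\<^sup>2 / r \<ge> f b |X|\<^sup>2 / r\<^sup>2\<close>,
  and of the covariant derivative it suffices to keep the radial part. What remains is the Hardy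
  inequality \<open>\<integral> f |\<partial>\<^sub>r X|\<^sup>2 \<ge> \<alpha>\<^sup>2 \<integral> f |X|\<^sup>2 / r\<^sup>2\<close>, which follows from
  \<open>\<integral> f |\<partial>\<^sub>r X + \<alpha> X / r|\<^sup>2 \<ge> 0\<close> and an integration by parts along rays; the latter only needs the
  homogeneity of Hausdorff measure under dilations.
\<close>


section \<open>Orthogonal projections and orthonormal bases\<close>

text \<open>Origin of \<alpha>: by parts, the cross term of \<open>|D + \<alpha> X|^2\<close> (with
  D the derivative of X along the position vector) becomes
  \<open>- \<alpha> (k - 2 + r h') |X|^2\<close>. Hence the square bounds the radial energy below
  with density \<open>\<alpha> (k - 2 + r h') - \<alpha>^2\<close>. Positivity of \<alpha>, that is
  b > 2 - k, permits replacing r h' by b, and the stated \<alpha> maximises the result. X is treated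
  as a vector field, without splitting into components: the normal space of the cone is constant
  along each ray, so D is already normal and the normal projection costs nothing. Two obstacles
  shape the rest. First, \<open>onb\<close> and \<open>second_ff\<close> choose bases and extensions
  point by point with no continuity, so traces are rewritten without a basis before they are
  compared or shown continuous. Second, integration by parts and the Hardy estimate need integrable
  functions, hence finite Hausdorff measure of compact subsets of the cone; this comes from
  Lipschitz charts, after the cone without apex has been shown to be a
  \<open>C2_submanifold\<close>.\<close>

definition orthonormal_basis_of :: "'a::euclidean_space set \<Rightarrow> 'a set \<Rightarrow> bool" where
  "orthonormal_basis_of W E \<longleftrightarrow>
     E \<subseteq> W \<and> span E = W \<and> pairwise orthogonal E \<and> (\<forall>e\<in>E. norm e = 1)"

lemma orthonormal_basis_of_onb:
  assumes "subspace W"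
  shows "orthonormal_basis_of W (onb W)"
proof -
  obtain B where "B \<subseteq> W" "pairwise orthogonal B" "\<And>x. x \<in> B \<Longrightarrow> norm x = 1" "span B = W"
    using orthonormal_basis_subspace[OF assms] by metis
  then have "\<exists>E. E \<subseteq> W \<and> span E = W \<and> pairwise orthogonal E \<and> (\<forall>e\<in>E. norm e = 1)"
    by blast
  then show ?thesis
    unfolding orthonormal_basis_of_def onb_def by (rule someI_ex)
qed

context
  fixes W E :: "'a::euclidean_space set"
  assumes E: "orthonormal_basis_of W E"
begin

lemma orthonormal_basis_of_finite: "finite E"
proof -
  have "0 \<notin> E"
    using E by (auto simp: orthonormal_basis_of_def)
  then have "independent E"
    using E pairwise_orthogonal_independent by (auto simp: orthonormal_basis_of_def)
  then show ?thesis
    by (rule independent_imp_finite)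
qed

lemma orthonormal_basis_of_subspace: "subspace W"
  using E subspace_span by (metis orthonormal_basis_of_def)

lemma orthonormal_basis_of_inner:
  "u \<in> E \<Longrightarrow> v \<in> E \<Longrightarrow> u \<bullet> v = (if u = v then 1 else 0)"
  using E by (auto simp: orthonormal_basis_of_def pairwise_def orthogonal_def norm_eq_1)

lemma orthonormal_basis_of_expand:
  assumes "x \<in> W" shows "(\<Sum>u\<in>E. (x \<bullet> u) *\<^sub>R u) = x"
  using E assms orthonormal_basis_of_finite
  by (intro orthonormal_basis_expand) (auto simp: orthonormal_basis_of_def)

end

lemma oproj_eqI:
  assumes "subspace W" "y \<in> W" "\<And>w. w \<in> W \<Longrightarrow> (x - y) \<bullet> w = 0"
  shows "oproj W x = y"
  unfolding oproj_def
proof (rule the_equality)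
  show "y \<in> W \<and> (\<forall>w\<in>W. (x - y) \<bullet> w = 0)"
    using assms by auto
next
  fix z assume z: "z \<in> W \<and> (\<forall>w\<in>W. (x - z) \<bullet> w = 0)"
  then have "z - y \<in> W"
    using assms subspace_diff by blast
  then have "(x - y) \<bullet> (z - y) = 0" "(x - z) \<bullet> (z - y) = 0"
    using z assms by auto
  then have "(z - y) \<bullet> (z - y) = 0"
    by (simp add: inner_diff)
  then show "z = y"
    by simp
qed

lemma oproj_orthonormal_basis:
  assumes E: "orthonormal_basis_of W E"
  shows "oproj W x = (\<Sum>u\<in>E. (x \<bullet> u) *\<^sub>R u)"
proof (rule oproj_eqI)
  have sub: "E \<subseteq> W" and fin: "finite E" and W: "subspace W" and sp: "span E = W"
    using E orthonormal_basis_of_finite orthonormal_basis_of_subspace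
    by (auto simp: orthonormal_basis_of_def)
  show "subspace W" by fact
  show "(\<Sum>u\<in>E. (x \<bullet> u) *\<^sub>R u) \<in> W"
    using sub W by (intro subspace_sum) (auto intro: subspace_scale)
  let ?d = "x - (\<Sum>u\<in>E. (x \<bullet> u) *\<^sub>R u)"
  have "?d \<bullet> v = 0" if "v \<in> E" for v
  proof -
    have "(\<Sum>u\<in>E. (x \<bullet> u) * (u \<bullet> v)) = (\<Sum>u\<in>E. if u = v then x \<bullet> u else 0)"
      using orthonormal_basis_of_inner[OF E _ that] by (intro sum.cong refl) auto
    then show ?thesis
      using that fin by (simp add: inner_diff_left inner_sum_left)
  qed
  then have "E \<subseteq> {w. ?d \<bullet> w = 0}"
    by auto
  then have "span E \<subseteq> {w. ?d \<bullet> w = 0}"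
    by (rule span_minimal) (auto simp: subspace_hyperplane)
  then show "?d \<bullet> w = 0" if "w \<in> W" for w
    using that sp by blast
qed

context
  fixes W :: "'a::euclidean_space set"
  assumes W: "subspace W"
begin

lemma oproj_in: "oproj W x \<in> W"
  unfolding oproj_orthonormal_basis[OF orthonormal_basis_of_onb[OF W]]
  using orthonormal_basis_of_onb[OF W] W
  by (intro subspace_sum) (auto simp: orthonormal_basis_of_def intro: subspace_scale)

lemma oproj_ident: "x \<in> W \<Longrightarrow> oproj W x = x"
  by (rule oproj_eqI[OF W]) auto

lemma oproj_eq_0: "(\<And>w. w \<in> W \<Longrightarrow> x \<bullet> w = 0) \<Longrightarrow> oproj W x = 0"
  by (rule oproj_eqI[OF W]) (auto intro: subspace_0 W)

lemma linear_oproj: "linear (oproj W)"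
  unfolding oproj_orthonormal_basis[OF orthonormal_basis_of_onb[OF W], abs_def]
  by (intro linear_compose_sum ballI linearI) (auto simp: inner_add_left algebra_simps)

lemma oproj_orthogonal: "w \<in> W \<Longrightarrow> (x - oproj W x) \<bullet> w = 0"
proof -
  assume w: "w \<in> W"
  obtain y z where "y \<in> span W" "\<And>w. w \<in> span W \<Longrightarrow> orthogonal z w" "x = y + z"
    using orthogonal_subspace_decomp_exists[of W x] by blast
  moreover from this have "oproj W x = y"
    using W by (intro oproj_eqI) (auto simp: span_eq_iff[THEN iffD2] orthogonal_def)
  ultimately show ?thesis
    using w W by (auto simp: orthogonal_def span_base)
qed

lemma inner_oproj: "w \<in> W \<Longrightarrow> oproj W x \<bullet> w = x \<bullet> w"
  using oproj_orthogonal[of w x] by (simp add: inner_diff_left)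

end

text \<open>Expanding the projected coordinate vectors in \<open>E\<close> and summing over
  \<open>Basis\<close> leaves the Gram matrix of \<open>E\<close>, which is the identity. Since the
  right-hand side mentions only \<open>W\<close>, a trace over \<open>onb W\<close> may be moved to
  an adapted basis.\<close>

lemma trace_orthonormal_basis:
  fixes \<beta> :: "'a::euclidean_space \<Rightarrow> 'a \<Rightarrow> 'b::real_vector"
  assumes E: "orthonormal_basis_of W E" and \<beta>: "bilinear \<beta>"
  shows "(\<Sum>u\<in>E. \<beta> u u) = (\<Sum>i\<in>Basis. \<beta> (oproj W i) (oproj W i))"
proof -
  note fin = orthonormal_basis_of_finite[OF E]
  have "\<beta> (oproj W i) (oproj W i) = (\<Sum>u\<in>E. \<Sum>v\<in>E. ((i \<bullet> v) * (i \<bullet> u)) *\<^sub>R \<beta> u v)" for i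
    unfolding oproj_orthonormal_basis[OF E]
    by (simp only: bilinear_sum[OF \<beta>] bilinear_lmul[OF \<beta>] bilinear_rmul[OF \<beta>]
        sum.cartesian_product scaleR_scaleR)
  then have "(\<Sum>i\<in>Basis. \<beta> (oproj W i) (oproj W i)) =
      (\<Sum>i\<in>Basis. \<Sum>u\<in>E. \<Sum>v\<in>E. ((i \<bullet> v) * (i \<bullet> u)) *\<^sub>R \<beta> u v)"
    by simp
  also have "\<dots> = (\<Sum>u\<in>E. \<Sum>v\<in>E. \<Sum>i\<in>Basis. ((i \<bullet> v) * (i \<bullet> u)) *\<^sub>R \<beta> u v)"
    by (subst sum.swap) (intro sum.cong refl sum.swap)
  also have "\<dots> = (\<Sum>u\<in>E. \<Sum>v\<in>E. (v \<bullet> u) *\<^sub>R \<beta> u v)"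
  proof (intro sum.cong refl)
    fix u v :: 'a
    have "v \<bullet> u = (\<Sum>i\<in>Basis. (i \<bullet> v) * (i \<bullet> u))"
      by (subst euclidean_inner) (simp add: inner_commute)
    then show "(\<Sum>i\<in>Basis. ((i \<bullet> v) * (i \<bullet> u)) *\<^sub>R \<beta> u v) = (v \<bullet> u) *\<^sub>R \<beta> u v"
      by (simp add: scaleR_sum_left)
  qed
  also have "\<dots> = (\<Sum>u\<in>E. \<Sum>v\<in>E. if u = v then \<beta> u v else 0)"
    using orthonormal_basis_of_inner[OF E] by (intro sum.cong refl) auto
  also have "\<dots> = (\<Sum>u\<in>E. \<beta> u u)"
    using fin by (intro sum.cong refl) simp
  finally show ?thesis by simp
qed

lemma sum_norm_orthonormal_basis:
  fixes l :: "'a::euclidean_space \<Rightarrow> 'b::real_inner"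
  assumes E: "orthonormal_basis_of W E" and l: "linear l"
  shows "(\<Sum>u\<in>E. (norm (l u))\<^sup>2) = (\<Sum>i\<in>Basis. (norm (l (oproj W i)))\<^sup>2)"
proof -
  have "bilinear (\<lambda>u v. l u \<bullet> l v)"
    using l by (auto simp: bilinear_def linear_iff inner_add_left inner_add_right)
  from trace_orthonormal_basis[OF E this] show ?thesis
    by (simp add: power2_norm_eq_inner)
qed

text \<open>The basis is exchanged in one slot at a time: with the other argument fixed,
  \<open>\<beta>\<close> is linear.\<close>

lemma sum_norm_bilinear_orthonormal_basis:
  fixes \<beta> :: "'a::euclidean_space \<Rightarrow> 'a \<Rightarrow> 'b::real_inner"
  assumes E: "orthonormal_basis_of W E" and F: "orthonormal_basis_of W F" and \<beta>: "bilinear \<beta>"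
  shows "(\<Sum>u\<in>E. \<Sum>v\<in>E. (norm (\<beta> u v))\<^sup>2) = (\<Sum>u\<in>F. \<Sum>v\<in>F. (norm (\<beta> u v))\<^sup>2)"
proof -
  have "(\<Sum>u\<in>E. \<Sum>v\<in>E. (norm (\<beta> u v))\<^sup>2) = (\<Sum>u\<in>E. \<Sum>v\<in>F. (norm (\<beta> u v))\<^sup>2)"
  proof (rule sum.cong[OF refl])
    fix u
    have "linear (\<beta> u)"
      using \<beta> by (simp add: bilinear_def)
    then show "(\<Sum>v\<in>E. (norm (\<beta> u v))\<^sup>2) = (\<Sum>v\<in>F. (norm (\<beta> u v))\<^sup>2)"
      by (simp only: sum_norm_orthonormal_basis[OF E] sum_norm_orthonormal_basis[OF F])
  qed
  also have "\<dots> = (\<Sum>v\<in>F. \<Sum>u\<in>E. (norm (\<beta> u v))\<^sup>2)"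
    by (rule sum.swap)
  also have "\<dots> = (\<Sum>v\<in>F. \<Sum>u\<in>F. (norm (\<beta> u v))\<^sup>2)"
  proof (rule sum.cong[OF refl])
    fix v
    have "linear (\<lambda>u. \<beta> u v)"
      using \<beta> by (simp add: bilinear_def)
    then show "(\<Sum>u\<in>E. (norm (\<beta> u v))\<^sup>2) = (\<Sum>u\<in>F. (norm (\<beta> u v))\<^sup>2)"
      by (simp only: sum_norm_orthonormal_basis[OF E] sum_norm_orthonormal_basis[OF F])
  qed
  also have "\<dots> = (\<Sum>u\<in>F. \<Sum>v\<in>F. (norm (\<beta> u v))\<^sup>2)"
    by (rule sum.swap)
  finally show ?thesis .
qed

text \<open>Cauchy-Schwarz for the coordinates of \<open>x\<close>, whose squares sum to 1. It lets
  a single direction, later the radial one, be kept from a full trace.\<close>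

lemma norm_linear_le_sum_orthonormal_basis:
  fixes l :: "'a::euclidean_space \<Rightarrow> 'b::real_inner"
  assumes E: "orthonormal_basis_of W E" and l: "linear l" and x: "x \<in> W" "norm x = 1"
  shows "(norm (l x))\<^sup>2 \<le> (\<Sum>u\<in>E. (norm (l u))\<^sup>2)"
proof -
  note fin = orthonormal_basis_of_finite[OF E]
  have x_eq: "x = (\<Sum>u\<in>E. (x \<bullet> u) *\<^sub>R u)"
    using orthonormal_basis_of_expand[OF E x(1)] by simp
  have "x \<bullet> x = (\<Sum>u\<in>E. (x \<bullet> u)\<^sup>2)"
    by (subst (2) x_eq) (simp add: inner_sum_right power2_eq_square)
  then have 1: "(\<Sum>u\<in>E. (x \<bullet> u)\<^sup>2) = 1"
    using x by (simp add: norm_eq_1)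
  have "norm (l x) = norm (\<Sum>u\<in>E. (x \<bullet> u) *\<^sub>R l u)"
    by (subst x_eq) (simp add: linear_sum[OF l] linear_cmul[OF l])
  also have "\<dots> \<le> (\<Sum>u\<in>E. \<bar>x \<bullet> u\<bar> * norm (l u))"
    by (rule order.trans[OF norm_sum]) simp
  finally have "(norm (l x))\<^sup>2 \<le> (\<Sum>u\<in>E. \<bar>x \<bullet> u\<bar> * norm (l u))\<^sup>2"
    by (rule power_mono) simp
  also have "\<dots> \<le> (\<Sum>u\<in>E. \<bar>x \<bullet> u\<bar>\<^sup>2) * (\<Sum>u\<in>E. (norm (l u))\<^sup>2)"
    by (rule Cauchy_Schwarz_ineq_sum)
  finally show ?thesis using 1 by simp
qed

text \<open>Gram-Schmidt by induction on \<open>B\<close>: enlarging the span adds the component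
  along \<open>?q\<close>, the part of the new vector orthogonal to the old span. Independence keeps
  \<open>?q\<close> nonzero, so the coefficient stays continuous.\<close>

lemma continuous_on_oproj_span:
  fixes v :: "'b \<Rightarrow> 'c::topological_space \<Rightarrow> 'a::euclidean_space"
  assumes "finite B"
    and "\<And>b. b \<in> B \<Longrightarrow> continuous_on S (v b)"
    and "\<And>x. x \<in> S \<Longrightarrow> inj_on (\<lambda>b. v b x) B \<and> independent ((\<lambda>b. v b x) ` B)"
    and "continuous_on S w"
  shows "continuous_on S (\<lambda>x. oproj (span ((\<lambda>b. v b x) ` B)) (w x))"
  using assms
proof (induction B arbitrary: w rule: finite_induct)
  case empty
  have "oproj {0} y = 0" for y :: 'a
    by (rule oproj_eq_0) auto
  then show ?case by simp
next
  case (insert b B)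
  let ?W = "\<lambda>x. span ((\<lambda>b. v b x) ` B)"
  let ?q = "\<lambda>x. v b x - oproj (?W x) (v b x)"
  \<comment> \<open>The induction leaves \<open>w\<close> arbitrary because the step projects both
    \<open>w\<close> and the new spanning vector \<open>v b\<close>.\<close>
  have IH: "continuous_on S (\<lambda>x. oproj (?W x) (w x))" if "continuous_on S w" for w
  proof (rule insert.IH)
    show "inj_on (\<lambda>b. v b x) B \<and> independent ((\<lambda>b. v b x) ` B)" if "x \<in> S" for x
      using insert.prems(2)[OF that] independent_mono[of "(\<lambda>b. v b x) ` insert b B" "(\<lambda>b. v b x) ` B"]
      by auto
  qed (use insert.prems(1) that in auto)
  have q: "?q x \<noteq> 0" if "x \<in> S" for x
  proof
    assume "?q x = 0"
    then have "v b x \<in> ?W x"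
      using oproj_in[of "?W x" "v b x"] by simp
    moreover have "v b x \<notin> (\<lambda>b. v b x) ` B"
      using insert.prems(2)[OF that] insert.hyps by auto
    ultimately show False
      using insert.prems(2)[OF that] by (simp add: independent_insert)
  qed
  have eq: "oproj (span ((\<lambda>b. v b x) ` insert b B)) (w x) =
      oproj (?W x) (w x) + ((w x \<bullet> ?q x) / (?q x \<bullet> ?q x)) *\<^sub>R ?q x" if "x \<in> S" for x
  proof (rule oproj_eqI)
    let ?W' = "span ((\<lambda>b. v b x) ` insert b B)"
    have sub: "?W x \<subseteq> ?W'"
      by (rule span_mono) auto
    have b: "v b x \<in> ?W'"
      by (rule span_base) auto
    have q': "?q x \<in> ?W'"
      using sub b oproj_in[of "?W x" "v b x"] by (auto intro: span_diff)
    show "oproj (?W x) (w x) + ((w x \<bullet> ?q x) / (?q x \<bullet> ?q x)) *\<^sub>R ?q x \<in> ?W'"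
      using sub q' oproj_in[of "?W x" "w x"] by (auto intro!: span_add span_scale)
    let ?d = "w x - (oproj (?W x) (w x) + ((w x \<bullet> ?q x) / (?q x \<bullet> ?q x)) *\<^sub>R ?q x)"
    have d: "?d \<bullet> z = 0" if "z \<in> ?W x" for z
      using oproj_orthogonal[of "?W x" z "w x"] oproj_orthogonal[of "?W x" z "v b x"] that
      by (simp add: inner_diff_left inner_add_left)
    have "?q x \<bullet> oproj (?W x) (w x) = 0"
      using oproj_orthogonal[of "?W x"] oproj_in[of "?W x" "w x"] by simp
    moreover have "(y - (z + ((y \<bullet> q) / (q \<bullet> q)) *\<^sub>R q)) \<bullet> q = 0"
      if "q \<bullet> z = 0" "q \<noteq> 0" for q y z :: 'a
      using that by (simp add: inner_diff_left inner_add_left inner_commute[of z q])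
    ultimately have "?d \<bullet> ?q x = 0"
      using q[OF \<open>x \<in> S\<close>] by blast
    moreover have "?d \<bullet> oproj (?W x) (v b x) = 0"
      using d oproj_in[of "?W x" "v b x"] by simp
    ultimately have "?d \<bullet> v b x = 0"
      by (simp add: inner_diff_right)
    then have "(\<lambda>b. v b x) ` insert b B \<subseteq> {z. ?d \<bullet> z = 0}"
      using d by (auto intro: span_base)
    then have "?W' \<subseteq> {z. ?d \<bullet> z = 0}"
      by (rule span_minimal) (auto simp: subspace_hyperplane)
    then show "?d \<bullet> z = 0" if "z \<in> ?W'" for z
      using that by blast
  qed simp
  have "continuous_on S (\<lambda>x. oproj (?W x) (w x) + ((w x \<bullet> ?q x) / (?q x \<bullet> ?q x)) *\<^sub>R ?q x)"
    using insert.prems q by (intro continuous_intros IH) auto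
  then show ?case
    by (rule continuous_on_eq) (simp only: eq)
qed


section \<open>Maps of class \<open>C\<^sup>1\<close> and \<open>C\<^sup>2\<close>\<close>

text \<open>In finite dimension, continuity of \<open>f' x v\<close> for each fixed vector
  \<open>v\<close> already gives continuity in operator norm.\<close>

lemma C1_onI:
  fixes f :: "'a::euclidean_space \<Rightarrow> 'b::real_normed_vector"
  assumes f: "\<And>x. x \<in> U \<Longrightarrow> (f has_derivative f' x) (at x)"
    and f': "\<And>v. continuous_on U (\<lambda>x. f' x v)"
  shows "C1_on U f"
  unfolding C1_on_def
proof (intro exI[of _ "\<lambda>x. Blinfun (f' x)"] conjI ballI)
  have apply_f': "blinfun_apply (Blinfun (f' x)) = f' x" if "x \<in> U" for x
    using f[OF that] by (simp add: bounded_linear_Blinfun_apply has_derivative_bounded_linear)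
  show "(f has_derivative blinfun_apply (Blinfun (f' x))) (at x)" if "x \<in> U" for x
    using f[OF that] apply_f'[OF that] by simp
  show "continuous_on U (\<lambda>x. Blinfun (f' x))"
  proof (rule continuous_on_blinfun_componentwise)
    show "continuous_on U (\<lambda>x. blinfun_apply (Blinfun (f' x)) i)" for i
      using f'[of i] by (rule continuous_on_eq) (simp add: apply_f')
  qed
qed

lemma C1_onE:
  assumes "C1_on U f"
  obtains f' where "\<And>x. x \<in> U \<Longrightarrow> (f has_derivative blinfun_apply (f' x)) (at x)"
    "continuous_on U f'"
  using assms unfolding C1_on_def by blast

lemma C1_on_differentiable: "C1_on U f \<Longrightarrow> x \<in> U \<Longrightarrow> f differentiable (at x)"
  by (auto simp: C1_on_def differentiable_def)

lemma C1_on_continuous_on: "C1_on U f \<Longrightarrow> continuous_on U f"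
  by (metis C1_on_def continuous_at_imp_continuous_on has_derivative_continuous)

lemma C1_on_subset: "C1_on U f \<Longrightarrow> V \<subseteq> U \<Longrightarrow> C1_on V f"
  unfolding C1_on_def by (meson continuous_on_subset subset_iff)

lemma C1_on_linear: "bounded_linear f \<Longrightarrow> C1_on U f"
  unfolding C1_on_def
  by (intro exI[of _ "\<lambda>_. Blinfun f"])
     (auto simp: bounded_linear_Blinfun_apply bounded_linear_imp_has_derivative)

lemma C1_on_const: "C1_on U (\<lambda>_. c)"
  unfolding C1_on_def
  by (intro exI[of _ "\<lambda>_. 0"]) (auto simp: zero_blinfun.rep_eq)

lemma C1_on_compose:
  assumes f: "C1_on U f" and g: "C1_on V g" and "f ` U \<subseteq> V"
  shows "C1_on U (\<lambda>x. g (f x))"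
proof -
  obtain f' where f': "\<And>x. x \<in> U \<Longrightarrow> (f has_derivative blinfun_apply (f' x)) (at x)"
    "continuous_on U f'"
    using f by (rule C1_onE) blast
  obtain g' where g': "\<And>x. x \<in> V \<Longrightarrow> (g has_derivative blinfun_apply (g' x)) (at x)"
    "continuous_on V g'"
    using g by (rule C1_onE) blast
  show ?thesis
    unfolding C1_on_def
  proof (intro exI[of _ "\<lambda>x. g' (f x) o\<^sub>L f' x"] conjI ballI)
    show "((\<lambda>x. g (f x)) has_derivative blinfun_apply (g' (f x) o\<^sub>L f' x)) (at x)" if "x \<in> U" for x
      using has_derivative_compose[OF f'(1)[OF that] g'(1)] that assms(3)
      by (auto simp: blinfun_compose.rep_eq o_def)
    show "continuous_on U (\<lambda>x. g' (f x) o\<^sub>L f' x)"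
      using f'(2) continuous_on_compose2[OF g'(2) C1_on_continuous_on[OF f] assms(3)]
      by (intro continuous_intros)
  qed
qed

lemma (in bounded_bilinear) C1_on:
  assumes f: "C1_on U f" and g: "C1_on U g"
  shows "C1_on U (\<lambda>x. prod (f x) (g x))"
proof -
  obtain f' where f': "\<And>x. x \<in> U \<Longrightarrow> (f has_derivative blinfun_apply (f' x)) (at x)"
    "continuous_on U f'"
    using f by (rule C1_onE) blast
  obtain g' where g': "\<And>x. x \<in> U \<Longrightarrow> (g has_derivative blinfun_apply (g' x)) (at x)"
    "continuous_on U g'"
    using g by (rule C1_onE) blast
  let ?D = "\<lambda>x. (prod_right (f x) o\<^sub>L g' x) + (prod_left (g x) o\<^sub>L f' x)"
  show ?thesis
    unfolding C1_on_def
  proof (intro exI[of _ ?D] conjI ballI)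
    show "((\<lambda>x. prod (f x) (g x)) has_derivative blinfun_apply (?D x)) (at x)" if "x \<in> U" for x
      using FDERIV[OF f'(1)[OF that] g'(1)[OF that]]
      by (simp add: plus_blinfun.rep_eq blinfun_compose.rep_eq o_def prod_left.rep_eq prod_right.rep_eq)
    show "continuous_on U ?D"
      using f'(2) g'(2) C1_on_continuous_on[OF f] C1_on_continuous_on[OF g]
      by (intro continuous_intros bounded_linear.continuous_on[OF bounded_linear_prod_left]
            bounded_linear.continuous_on[OF bounded_linear_prod_right])
  qed
qed

lemma C1_on_add: "C1_on U f \<Longrightarrow> C1_on U g \<Longrightarrow> C1_on U (\<lambda>x. f x + g x)"
  unfolding C1_on_def
  apply (elim exE conjE)
  subgoal for f' g'
    by (intro exI[of _ "\<lambda>x. f' x + g' x"])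
       (auto simp: plus_blinfun.rep_eq intro: has_derivative_add continuous_on_add)
  done

lemma C1_on_minus: "C1_on U f \<Longrightarrow> C1_on U g \<Longrightarrow> C1_on U (\<lambda>x. f x - g x)"
  unfolding C1_on_def
  apply (elim exE conjE)
  subgoal for f' g'
    by (intro exI[of _ "\<lambda>x. f' x - g' x"])
       (auto simp: minus_blinfun.rep_eq intro: has_derivative_diff continuous_on_diff)
  done

lemmas C1_on_scaleR = bounded_bilinear.C1_on[OF bounded_bilinear_scaleR]

lemma C1_on_norm:
  assumes "0 \<notin> U" shows "C1_on U (norm :: 'a::euclidean_space \<Rightarrow> real)"
proof (rule C1_onI)
  show "(norm has_derivative (\<lambda>v. v \<bullet> sgn x)) (at x)" if "x \<in> U" for x :: 'a
    using that assms by (intro has_derivative_norm) auto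
  show "continuous_on U (\<lambda>x. v \<bullet> sgn x)" for v :: 'a
    using assms unfolding sgn_div_norm by (intro continuous_intros) auto
qed

lemma C1_on_sgn:
  assumes "0 \<notin> U" shows "C1_on U (sgn :: 'a::euclidean_space \<Rightarrow> 'a)"
proof -
  have "C1_on {0<..} (inverse :: real \<Rightarrow> real)"
    by (rule C1_onI[where f' = "\<lambda>x h. - (inverse x * h * inverse x)"])
       (auto intro!: has_derivative_inverse' continuous_intros)
  from C1_on_compose[OF C1_on_norm[OF assms] this]
  have "C1_on U (\<lambda>x::'a. inverse (norm x))"
    using assms by (metis (no_types, lifting) greaterThan_iff image_subsetI zero_less_norm_iff)
  from C1_on_scaleR[OF this C1_on_linear[OF bounded_linear_ident]]
  show ?thesis
    by (simp add: sgn_div_norm[abs_def])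
qed

lemma C2_onE:
  assumes "C2_on U f"
  obtains f' where "\<And>x. x \<in> U \<Longrightarrow> (f has_derivative blinfun_apply (f' x)) (at x)" "C1_on U f'"
  using assms unfolding C2_on_def by blast

lemma C2_on_imp_C1_on: "C2_on U f \<Longrightarrow> C1_on U f"
  unfolding C2_on_def C1_on_def[of U f] using C1_on_continuous_on by blast

lemma C2_on_subset: "C2_on U f \<Longrightarrow> V \<subseteq> U \<Longrightarrow> C2_on V f"
  unfolding C2_on_def by (meson C1_on_subset subset_iff)

section \<open>Inversion of operator-valued maps and the inverse function theorem in class
  C2\<close>

lemma blinfun_inverse_diff:
  assumes "B y o\<^sub>L A y = id_blinfun" "A z o\<^sub>L B z = id_blinfun"
  shows "B y - B z = B y o\<^sub>L (A z - A y) o\<^sub>L B z"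
proof (rule blinfun_eqI)
  fix v
  have "blinfun_apply (B y) (blinfun_apply (A y) w) = w" for w
    using assms(1) by (metis blinfun_apply_blinfun_compose blinfun_apply_id_blinfun)
  moreover have "blinfun_apply (A z) (blinfun_apply (B z) w) = w" for w
    using assms(2) by (metis blinfun_apply_blinfun_compose blinfun_apply_id_blinfun)
  ultimately show "blinfun_apply (B y - B z) v = blinfun_apply (B y o\<^sub>L (A z - A y) o\<^sub>L B z) v"
    by (simp add: blinfun.diff_left blinfun.diff_right)
qed

text \<open>The resolvent identity bounds the increment of \<open>B\<close> by
  \<open>norm (B y)\<close> times \<open>norm (A z - A y) * norm (B z)\<close>. Once the latter is
  below 1/2, half of \<open>norm (B y)\<close> is absorbed, so \<open>norm (B y)\<close> is at most
  \<open>2 * norm (B z)\<close> and the increment tends to 0.\<close>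

lemma continuous_on_blinfun_inverse:
  fixes A B :: "'a::metric_space \<Rightarrow> 'b::euclidean_space \<Rightarrow>\<^sub>L 'b"
  assumes A: "continuous_on V A"
    and inv: "\<And>y. y \<in> V \<Longrightarrow> B y o\<^sub>L A y = id_blinfun" "\<And>y. y \<in> V \<Longrightarrow> A y o\<^sub>L B y = id_blinfun"
  shows "continuous_on V B"
proof -
  note diff = blinfun_inverse_diff[of B _ A, OF inv]
  show ?thesis
    unfolding continuous_on_def
  proof
    fix z assume z: "z \<in> V"
    have lim: "((\<lambda>y. norm (A z - A y) * norm (B z)) \<longlongrightarrow> 0) (at z within V)"
      using A z unfolding continuous_on_def by (auto intro!: tendsto_eq_intros)
    then have ev: "eventually (\<lambda>y. norm (A z - A y) * norm (B z) < 1/2) (at z within V)"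
      by (rule order_tendstoD) simp
    have "eventually (\<lambda>y. y \<in> V) (at z within V)"
      by (simp add: eventually_at_filter)
    with ev have bound: "eventually (\<lambda>y. norm (B y - B z) \<le> 2 * norm (B z) * (norm (A z - A y) * norm (B z))) (at z within V)"
    proof eventually_elim
      fix y assume y: "norm (A z - A y) * norm (B z) < 1/2" "y \<in> V"
      have le: "norm (B y - B z) \<le> norm (B y) * (norm (A z - A y) * norm (B z))"
        unfolding diff[OF y(2) z] mult.assoc[symmetric]
        by (intro order.trans[OF norm_blinfun_compose] mult_right_mono norm_blinfun_compose norm_ge_zero)
      have "norm (B y) \<le> norm (B z) + norm (B y - B z)"
        using norm_triangle_ineq[of "B z" "B y - B z"] by simp
      also have "\<dots> \<le> norm (B z) + norm (B y) * (1/2)"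
        using le y(1) by (smt (verit) mult_left_mono norm_ge_zero)
      finally have "norm (B y) \<le> 2 * norm (B z)"
        by simp
      then show "norm (B y - B z) \<le> 2 * norm (B z) * (norm (A z - A y) * norm (B z))"
        using le by (meson dual_order.trans mult_nonneg_nonneg mult_right_mono norm_ge_zero)
    qed
    have "((\<lambda>y. B y - B z) \<longlongrightarrow> 0) (at z within V)"
      by (rule Lim_null_comparison[OF bound tendsto_mult_right_zero[OF lim]])
    then show "(B \<longlongrightarrow> B z) (at z within V)"
      by (simp add: LIM_zero_iff)
  qed
qed

text \<open>By the resolvent identity the remainder splits into two terms: one contains the
  remainder of \<open>A\<close> between bounded factors, the other contains \<open>B y - B z\<close>
  applied to a quantity of order \<open>norm (y - z)\<close>. Both are of lower order because
  \<open>B\<close> is continuous at \<open>z\<close>.\<close>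

lemma has_derivative_blinfun_inverse:
  fixes A B :: "'a::euclidean_space \<Rightarrow> 'b::euclidean_space \<Rightarrow>\<^sub>L 'b"
  assumes A: "(A has_derivative A') (at z)" and V: "open V" "z \<in> V"
    and inv: "\<And>y. y \<in> V \<Longrightarrow> B y o\<^sub>L A y = id_blinfun" "\<And>y. y \<in> V \<Longrightarrow> A y o\<^sub>L B y = id_blinfun"
    and B: "(B \<longlongrightarrow> B z) (at z)"
  shows "(B has_derivative (\<lambda>h. - (B z o\<^sub>L A' h o\<^sub>L B z))) (at z)"
proof -
  interpret compose: bounded_bilinear "(o\<^sub>L)"
    by (rule bounded_bilinear_blinfun_compose)
  have A': "bounded_linear A'"
    using A by (rule has_derivative_bounded_linear)
  note diff = blinfun_inverse_diff[of B _ A, OF inv(1) inv(2)[OF V(2)]]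
  obtain K where K: "\<And>h. norm (A' h) \<le> norm h * K"
    using bounded_linear.bounded[OF A'] by blast
  let ?e = "\<lambda>y. (1 / norm (y - z)) *\<^sub>R (A y - (A z + A' (y - z)))"
  let ?bd = "\<lambda>y. norm (B y) * norm (?e y) * norm (B z) + norm (B y - B z) * K * norm (B z)"
  have e: "(?e \<longlongrightarrow> 0) (at z)"
    using A by (simp add: has_derivative_within)
  show ?thesis
    unfolding has_derivative_within
  proof
    show "bounded_linear (\<lambda>h. - (B z o\<^sub>L A' h o\<^sub>L B z))"
    proof -
      have "bounded_linear (\<lambda>x. B z o\<^sub>L x)" "bounded_linear (\<lambda>x. x o\<^sub>L B z)"
        by (auto intro: bounded_bilinear.bounded_linear_left bounded_bilinear.bounded_linear_right
            bounded_bilinear_blinfun_compose)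
      from bounded_linear_compose[OF this(2) bounded_linear_compose[OF this(1) A']]
      show ?thesis
        by (rule bounded_linear_minus)
    qed
    have "eventually (\<lambda>y. y \<in> V - {z}) (at z)"
      using V by (auto simp: eventually_at_topological)
    then have "eventually (\<lambda>y. norm ((1 / norm (y - z)) *\<^sub>R (B y - (B z + - (B z o\<^sub>L A' (y - z) o\<^sub>L B z)))) \<le> ?bd y) (at z)"
    proof eventually_elim
      fix y assume y: "y \<in> V - {z}"
      let ?n = "norm (y - z)"
      have n: "?n > 0" using y by auto
      have "B y - (B z + - (B z o\<^sub>L A' (y - z) o\<^sub>L B z)) =
          - (B y o\<^sub>L (A y - (A z + A' (y - z))) o\<^sub>L B z) - ((B y - B z) o\<^sub>L A' (y - z) o\<^sub>L B z)"
      proof -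
        have "B y - (B z + - (B z o\<^sub>L A' (y - z) o\<^sub>L B z)) = (B y - B z) + (B z o\<^sub>L A' (y - z) o\<^sub>L B z)"
          by simp
        also have "\<dots> = (B y o\<^sub>L (A z - A y) o\<^sub>L B z) + (B z o\<^sub>L A' (y - z) o\<^sub>L B z)"
          using diff[of y] y by simp
        also have "\<dots> = - (B y o\<^sub>L (A y - (A z + A' (y - z))) o\<^sub>L B z) - ((B y - B z) o\<^sub>L A' (y - z) o\<^sub>L B z)"
          by (simp add: compose.diff_left compose.diff_right compose.add_left compose.add_right)
        finally show ?thesis .
      qed
      then have "norm (B y - (B z + - (B z o\<^sub>L A' (y - z) o\<^sub>L B z))) \<le>
          norm (B y o\<^sub>L (A y - (A z + A' (y - z))) o\<^sub>L B z) + norm ((B y - B z) o\<^sub>L A' (y - z) o\<^sub>L B z)"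
        by (metis norm_minus_cancel norm_triangle_ineq4)
      also have "\<dots> \<le> norm (B y) * norm (A y - (A z + A' (y - z))) * norm (B z)
          + norm (B y - B z) * norm (A' (y - z)) * norm (B z)"
        by (intro add_mono order.trans[OF norm_blinfun_compose] mult_right_mono norm_blinfun_compose norm_ge_zero)
      also have "\<dots> \<le> norm (B y) * norm (A y - (A z + A' (y - z))) * norm (B z)
          + norm (B y - B z) * (?n * K) * norm (B z)"
        by (intro add_left_mono mult_right_mono mult_left_mono K norm_ge_zero)
      also have "\<dots> = ?n * ?bd y"
      proof -
        have "norm (A y - (A z + A' (y - z))) = ?n * norm (?e y)"
          using n by (simp only: norm_scaleR) simp
        then show ?thesis
          by (simp only: distrib_left mult_ac)
      qed
      finally show "norm ((1 / ?n) *\<^sub>R (B y - (B z + - (B z o\<^sub>L A' (y - z) o\<^sub>L B z)))) \<le> ?bd y"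
        using n by (simp only: norm_scaleR) (simp add: pos_divide_le_eq mult.commute)
    qed
    moreover have "(?bd \<longlongrightarrow> 0) (at z)"
      by (rule tendsto_eq_intros e B refl)+ simp
    ultimately show "((\<lambda>y. (1 / norm (y - z)) *\<^sub>R (B y - (B z + - (B z o\<^sub>L A' (y - z) o\<^sub>L B z)))) \<longlongrightarrow> 0) (at z)"
      by (rule Lim_null_comparison)
  qed
qed

text \<open>The derivative \<open>B\<close> of the inverse \<open>g\<close> is the pointwise inverse
  of \<open>A\<close>, the derivative of \<open>f\<close> taken at \<open>g y\<close>.
  \<open>A\<close> is differentiable by the chain rule, hence so is its inverse, and the formula for
  the derivative of \<open>B\<close> contains only continuous ingredients.\<close>

lemma C2_local_inverse:
  fixes f :: "'a::euclidean_space \<Rightarrow> 'a"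
  assumes U: "open U" "x0 \<in> U" and f: "C2_on U f"
    and inj: "inj (frechet_derivative f (at x0))"
  obtains U' V g where "open U'" "U' \<subseteq> U" "x0 \<in> U'" "open V" "f ` U' = V" "g ` V = U'"
    "\<And>x. x \<in> U' \<Longrightarrow> g (f x) = x" "\<And>y. y \<in> V \<Longrightarrow> f (g y) = y" "C2_on V g"
proof -
  obtain f' where f': "\<And>x. x \<in> U \<Longrightarrow> (f has_derivative blinfun_apply (f' x)) (at x)" "C1_on U f'"
    using f by (rule C2_onE) blast
  have fr: "frechet_derivative f (at x0) = blinfun_apply (f' x0)"
    using frechet_derivative_at[OF f'(1)[OF U(2)]] by simp
  have lin: "linear (blinfun_apply (f' x))" for x
    by (simp add: blinfun.bounded_linear_right bounded_linear.linear)
  obtain k where k: "linear k" "k \<circ> blinfun_apply (f' x0) = id"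
    using linear_injective_left_inverse[OF lin] inj fr by metis
  have invf: "Blinfun k o\<^sub>L f' x0 = id_blinfun"
    using k by (intro blinfun_eqI)
      (simp add: bounded_linear_Blinfun_apply linear_conv_bounded_linear o_def fun_eq_iff)
  obtain U' V g g' where g: "open U'" "U' \<subseteq> U" "x0 \<in> U'" "open V" "f x0 \<in> V" "homeomorphism U' V f g"
    "\<And>y. y \<in> V \<Longrightarrow> (g has_derivative (g' y)) (at y)"
    "\<And>y. y \<in> V \<Longrightarrow> g' y = inv (blinfun_apply (f' (g y)))"
    "\<And>y. y \<in> V \<Longrightarrow> bij (blinfun_apply (f' (g y)))"
    using inverse_function_theorem[OF U(1) f'(1) C1_on_continuous_on[OF f'(2)] U(2) invf] by metis
  have hom: "f ` U' = V" "g ` V = U'" "\<And>x. x \<in> U' \<Longrightarrow> g (f x) = x" "\<And>y. y \<in> V \<Longrightarrow> f (g y) = y"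
    using g(6) by (auto simp: homeomorphism_def)
  define A where "A y = f' (g y)" for y
  define B where "B y = Blinfun (g' y)" for y
  have Bapp: "blinfun_apply (B y) = g' y" if "y \<in> V" for y
    unfolding B_def using g(7)[OF that] by (simp add: bounded_linear_Blinfun_apply has_derivative_bounded_linear)
  have inv: "B y o\<^sub>L A y = id_blinfun" "A y o\<^sub>L B y = id_blinfun" if "y \<in> V" for y
    using g(9)[OF that] by (auto intro!: blinfun_eqI simp: Bapp[OF that] g(8)[OF that] A_def
        bij_is_inj bij_is_surj surj_f_inv_f inv_f_f)
  obtain f'' where f'': "\<And>x. x \<in> U \<Longrightarrow> (f' has_derivative blinfun_apply (f'' x)) (at x)" "continuous_on U f''"
    using f'(2) by (rule C1_onE) blast
  have gU: "g y \<in> U" if "y \<in> V" for y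
    using that hom(2) g(2) by blast
  have contg: "continuous_on V g"
    using g(6) by (auto simp: homeomorphism_def)
  have contA: "continuous_on V A"
    unfolding A_def
    by (rule continuous_on_compose2[OF C1_on_continuous_on[OF f'(2)] contg]) (use gU in auto)
  have contB: "continuous_on V B"
    by (rule continuous_on_blinfun_inverse[OF contA inv])
  have derA: "(A has_derivative (\<lambda>h. blinfun_apply (f'' (g y)) (g' y h))) (at y)" if "y \<in> V" for y
    unfolding A_def by (rule has_derivative_compose[OF g(7)[OF that] f''(1)[OF gU[OF that]]])
  have derB: "(B has_derivative (\<lambda>h. - (B y o\<^sub>L blinfun_apply (f'' (g y)) (g' y h) o\<^sub>L B y))) (at y)" if "y \<in> V" for y
  proof (rule has_derivative_blinfun_inverse[OF derA[OF that] g(4) that inv])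
    show "(B \<longlongrightarrow> B y) (at y)"
      using contB that g(4) by (metis continuous_on_def at_within_open)
  qed
  have "C1_on V B"
  proof (rule C1_onI[OF derB])
    fix v
    have "continuous_on V (\<lambda>y. - (B y o\<^sub>L blinfun_apply (f'' (g y)) (blinfun_apply (B y) v) o\<^sub>L B y))"
      using contB contg continuous_on_compose2[OF f''(2) contg] gU
      by (intro continuous_intros) auto
    then show "continuous_on V (\<lambda>y. - (B y o\<^sub>L blinfun_apply (f'' (g y)) (g' y v) o\<^sub>L B y))"
      by (rule continuous_on_eq) (simp add: Bapp)
  qed
  then have "C2_on V g"
    unfolding C2_on_def using g(7) Bapp by (intro exI[of _ B]) auto
  then show thesis
    using that[of U' V g] g(1-4) hom by simp
qed


section \<open>Tangent spaces and second fundamental forms\<close>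

lemma continuous_onI_local:
  assumes "\<And>p. p \<in> M \<Longrightarrow> \<exists>U. open U \<and> p \<in> U \<and> continuous_on (M \<inter> U) f"
  shows "continuous_on M f"
  unfolding continuous_on_def
proof
  fix p assume "p \<in> M"
  then obtain U where U: "open U" "p \<in> U" "continuous_on (M \<inter> U) f"
    using assms by blast
  have "at p within M = at p within M \<inter> U"
    by (rule at_within_nhd[OF U(2) U(1)]) auto
  then show "(f \<longlongrightarrow> f p) (at p within M)"
    using U \<open>p \<in> M\<close> by (simp add: continuous_on_def)
qed

text \<open>Difference quotients of a curve in a linear subspace stay in it, and subspaces are
  closed. Through this limit derivatives are later placed in chart subspaces and in normal
  spaces.\<close>

lemma has_vector_derivative_quotient:
  assumes "(f has_vector_derivative v) (at 0)"
  shows "((\<lambda>t. (f t - f 0) /\<^sub>R t) \<longlongrightarrow> v) (at 0)"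
proof -
  have "((\<lambda>t. norm ((f t - (f 0 + t *\<^sub>R v)) /\<^sub>R norm t)) \<longlongrightarrow> 0) (at 0)"
    using assms unfolding has_vector_derivative_def has_derivative_within
    by (auto intro!: tendsto_norm_zero simp: divide_inverse simp del: norm_scaleR)
  then have "((\<lambda>t. norm ((f t - f 0) /\<^sub>R t - v)) \<longlongrightarrow> 0) (at 0)"
  proof (rule Lim_transform_eventually)
    have "norm ((f t - (f 0 + t *\<^sub>R v)) /\<^sub>R norm t) = norm ((f t - f 0) /\<^sub>R t - v)" if "t \<noteq> 0" for t
    proof -
      have "(f t - (f 0 + t *\<^sub>R v)) /\<^sub>R t = (f t - f 0) /\<^sub>R t - v"
        using that by (simp add: scaleR_diff_right scaleR_add_right)
      then show ?thesis
        by (metis norm_scaleR abs_inverse abs_norm_cancel real_norm_def abs_idempotent)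
    qed
    then show "eventually (\<lambda>t. norm ((f t - (f 0 + t *\<^sub>R v)) /\<^sub>R norm t) = norm ((f t - f 0) /\<^sub>R t - v)) (at 0)"
      by (auto simp: eventually_at_filter)
  qed
  then show ?thesis
    by (simp add: tendsto_norm_zero_iff LIM_zero_iff)
qed

text \<open>\<open>tangent_space\<close> asks for a curve on the whole line; a local curve is
  continued by the constant \<open>p\<close> outside \<open>I\<close>, which leaves its velocity at
  0 unchanged.\<close>

lemma tangent_spaceI:
  assumes "open I" "0 \<in> I" "\<And>t. t \<in> I \<Longrightarrow> \<gamma> t \<in> M" "\<gamma> 0 = p" "(\<gamma> has_vector_derivative v) (at (0::real))"
  shows "v \<in> tangent_space M p"
proof -
  let ?\<gamma> = "\<lambda>t. if t \<in> I then \<gamma> t else p"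
  have "(?\<gamma> has_vector_derivative v) (at 0)"
    by (rule has_vector_derivative_transform_within_open[OF assms(5) assms(1) assms(2)]) auto
  moreover have "range ?\<gamma> \<subseteq> M"
    using assms by auto
  ultimately show ?thesis
    using assms(2,4) unfolding tangent_space_def by (intro CollectI exI[of _ ?\<gamma>]) simp
qed

lemma tangent_spaceE:
  assumes "v \<in> tangent_space M p"
  obtains \<gamma> where "\<And>t. \<gamma> t \<in> M" "\<gamma> 0 = p" "(\<gamma> has_vector_derivative v) (at (0::real))"
proof -
  obtain \<gamma> where "range \<gamma> \<subseteq> M \<and> \<gamma> 0 = p \<and> (\<gamma> has_vector_derivative v) (at (0::real))"
    using assms unfolding tangent_space_def mem_Collect_eq ..
  with that[of \<gamma>] show thesis by (simp add: image_subset_iff)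
qed

lemma tangent_space_mono: "M \<subseteq> N \<Longrightarrow> tangent_space M p \<subseteq> tangent_space N p"
  unfolding tangent_space_def by (rule Collect_mono) (metis order_trans)

lemma has_vector_derivative_line: "((\<lambda>t. p + t *\<^sub>R v) has_vector_derivative v) (at t0)"
  unfolding has_vector_derivative_def by (auto intro!: derivative_eq_intros)

lemma tangent_space_UNIV [simp]: "tangent_space UNIV p = UNIV"
proof -
  have "v \<in> tangent_space UNIV p" for v
    by (rule tangent_spaceI[of UNIV "\<lambda>t. p + t *\<^sub>R v"]) (auto intro: has_vector_derivative_line)
  then show ?thesis by blast
qed

lemma curve_eventually_in:
  assumes "(\<gamma> has_vector_derivative v) (at (0::real))" "\<gamma> 0 \<in> U" "open U"
  shows "\<exists>I. open I \<and> 0 \<in> I \<and> (\<forall>t\<in>I. \<gamma> t \<in> U)"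
proof -
  have "isCont \<gamma> 0"
    using assms(1) has_vector_derivative_continuous by blast
  then show ?thesis
    using assms(2,3) continuous_at_open by blast
qed

lemma tangent_space_Int_open:
  assumes "open U" "p \<in> U"
  shows "tangent_space (M \<inter> U) p = tangent_space M p"
proof
  show "tangent_space M p \<subseteq> tangent_space (M \<inter> U) p"
  proof
    fix v assume "v \<in> tangent_space M p"
    then obtain \<gamma> where \<gamma>: "\<And>t. \<gamma> t \<in> M" "\<gamma> 0 = p" "(\<gamma> has_vector_derivative v) (at (0::real))"
      using tangent_spaceE by metis
    then obtain I where "open I" "0 \<in> I" "\<forall>t\<in>I. \<gamma> t \<in> U"
      using curve_eventually_in assms by metis
    with \<gamma> show "v \<in> tangent_space (M \<inter> U) p"
      by (intro tangent_spaceI[of I \<gamma>]) auto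
  qed
qed (rule tangent_space_mono, blast)

lemma tangent_field_Int_openD:
  assumes "tangent_field (M \<inter> U) X" "open U" "p \<in> M" "p \<in> U"
  shows "X p \<in> tangent_space M p"
  using assms tangent_space_Int_open[OF assms(2,4), of M] unfolding tangent_field_def by blast

lemma C1_fieldE:
  assumes "C1_field M X" "p \<in> M"
  obtains U Y where "open U" "p \<in> U" "C1_on U Y" "\<And>x. x \<in> M \<inter> U \<Longrightarrow> Y x = X x"
proof -
  have "\<exists>U Y. open U \<and> p \<in> U \<and> C1_on U Y \<and> (\<forall>x\<in>M \<inter> U. Y x = X x)"
    using assms unfolding C1_field_def by (rule bspec)
  then show thesis
    by (elim exE conjE) (rule that, assumption+, blast)
qed

lemma C1_field_differentiable:
  assumes "C1_field M X" "p \<in> M" shows "X differentiable (at p within M)"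
proof -
  obtain U Y where U: "open U" "p \<in> U" "C1_on U Y" "\<And>x. x \<in> M \<inter> U \<Longrightarrow> Y x = X x"
    using C1_fieldE[OF assms] by metis
  have "Y differentiable (at p within M)"
    using C1_on_differentiable[OF U(3,2)] by (rule differentiable_at_withinI)
  then have "Y differentiable (at p within M \<inter> U)"
    by (rule differentiable_within_subset) auto
  then obtain D where "(Y has_derivative D) (at p within M \<inter> U)"
    unfolding differentiable_def ..
  then have "(X has_derivative D) (at p within M \<inter> U)"
    by (rule has_derivative_transform[rotated 2]) (use U assms(2) in auto)
  then have "X differentiable (at p within M \<inter> U)"
    by (rule differentiableI)
  moreover have "at p within M = at p within M \<inter> U"
    by (rule at_within_nhd[OF U(2) U(1)]) auto
  ultimately show ?thesis by simp
qed

lemma C1_field_Int_open_differentiable: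
  assumes "C1_field (M \<inter> U) X" "p \<in> M" "p \<in> U" "open U"
  shows "X differentiable (at p within M)"
proof -
  have "at p within M = at p within M \<inter> U"
    by (rule at_within_nhd[OF assms(3,4)]) auto
  then show ?thesis
    using C1_field_differentiable[OF assms(1), of p] assms by simp
qed

lemma linear_flat_deriv: "X differentiable (at p within M) \<Longrightarrow> linear (flat_deriv M X p)"
  unfolding flat_deriv_def frechet_derivative_works
  using has_derivative_linear by fastforce

text \<open>\<open>frechet_derivative\<close> within \<open>M\<close> returns some derivative among
  possibly many; the chain rule along a curve in \<open>M\<close> pins down its value on the
  velocity of that curve.\<close>

lemma flat_deriv_curve:
  assumes X: "X differentiable (at p within M)"
    and \<gamma>: "\<And>t. \<gamma> t \<in> M" "\<gamma> 0 = p" "(\<gamma> has_vector_derivative u) (at (0::real))"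
  shows "((\<lambda>t. X (\<gamma> t)) has_vector_derivative flat_deriv M X p u) (at 0)"
proof -
  have X': "(X has_derivative flat_deriv M X p) (at p within M)"
    using X unfolding flat_deriv_def frechet_derivative_works .
  have "(X has_derivative flat_deriv M X p) (at (\<gamma> 0) within range \<gamma>)"
    using has_derivative_subset[OF X', of "range \<gamma>"] \<gamma>(1,2) by auto
  from has_derivative_in_compose[OF \<gamma>(3)[unfolded has_vector_derivative_def] this]
  show ?thesis
    unfolding has_vector_derivative_def
    by (simp add: linear_cmul[OF linear_flat_deriv[OF X]])
qed

lemma flat_deriv_eqI:
  assumes X: "X differentiable (at p within M)"
    and \<gamma>: "open I" "0 \<in> I" "\<And>t. t \<in> I \<Longrightarrow> \<gamma> t \<in> M" "\<gamma> 0 = p" "(\<gamma> has_vector_derivative u) (at (0::real))"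
    and w: "((\<lambda>t. X (\<gamma> t)) has_vector_derivative w) (at 0)"
  shows "flat_deriv M X p u = w"
proof -
  let ?\<gamma> = "\<lambda>t. if t \<in> I then \<gamma> t else p"
  have "(?\<gamma> has_vector_derivative u) (at 0)"
    by (rule has_vector_derivative_transform_within_open[OF \<gamma>(5) \<gamma>(1,2)]) auto
  then have 1: "((\<lambda>t. X (?\<gamma> t)) has_vector_derivative flat_deriv M X p u) (at 0)"
    using X \<gamma> by (intro flat_deriv_curve) auto
  have "((\<lambda>t. X (?\<gamma> t)) has_vector_derivative w) (at 0)"
    by (rule has_vector_derivative_transform_within_open[OF w \<gamma>(1,2)]) auto
  with 1 show ?thesis
    by (rule vector_derivative_unique_at)
qed

lemma flat_deriv_extension:
  assumes U: "open U" "p \<in> U" and p: "p \<in> M" and Y: "(Y has_derivative D) (at p)"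
    and eq: "\<And>x. x \<in> M \<inter> U \<Longrightarrow> Y x = X x" and u: "u \<in> tangent_space M p"
  shows "X differentiable (at p within M)" "flat_deriv M X p u = D u"
proof -
  have "at p within M = at p within M \<inter> U"
    by (rule at_within_nhd[OF U(2,1)]) auto
  moreover have "(X has_derivative D) (at p within M \<inter> U)"
    using has_derivative_at_withinI[OF Y]
    by (rule has_derivative_transform[rotated 2]) (use U p eq in auto)
  ultimately show X: "X differentiable (at p within M)"
    by (auto simp: differentiable_def)
  obtain \<gamma> where \<gamma>: "\<And>t. \<gamma> t \<in> M" "\<gamma> 0 = p" "(\<gamma> has_vector_derivative u) (at (0::real))"
    using tangent_spaceE[OF u] by metis
  then obtain I where I: "open I" "0 \<in> I" "\<forall>t\<in>I. \<gamma> t \<in> U"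
    using curve_eventually_in U by metis
  show "flat_deriv M X p u = D u"
  proof (rule flat_deriv_eqI[OF X I(1,2) \<gamma>])
    have "((\<lambda>t. Y (\<gamma> t)) has_vector_derivative D u) (at 0)"
      using has_derivative_compose[OF \<gamma>(3)[unfolded has_vector_derivative_def], of Y D] Y \<gamma>(2)
        has_derivative_linear[OF Y]
      by (simp add: has_vector_derivative_def linear_cmul)
    then show "((\<lambda>t. X (\<gamma> t)) has_vector_derivative D u) (at 0)"
      by (rule has_vector_derivative_transform_within_open[OF _ I(1,2)]) (use I eq \<gamma> in auto)
  qed
qed

section \<open>Charts and the tangent spaces they describe\<close>

definition C2_chart ::
    "nat \<Rightarrow> 'a::euclidean_space set \<Rightarrow> 'a set \<Rightarrow> ('a \<Rightarrow> 'a) \<Rightarrow> ('a \<Rightarrow> 'a) \<Rightarrow> 'a set \<Rightarrow> bool" where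
  "C2_chart m M U \<Phi> \<Psi> V \<longleftrightarrow> open U \<and> open (\<Phi> ` U) \<and> C2_on U \<Phi> \<and> C2_on (\<Phi> ` U) \<Psi> \<and>
     (\<forall>x\<in>U. \<Psi> (\<Phi> x) = x) \<and> subspace V \<and> dim V = m \<and> \<Phi> ` (M \<inter> U) = V \<inter> \<Phi> ` U"

lemma C2_submanifold_iff_chart:
  "C2_submanifold m M \<longleftrightarrow> (\<forall>p\<in>M. \<exists>U \<Phi> \<Psi> V. p \<in> U \<and> C2_chart m M U \<Phi> \<Psi> V)"
  unfolding C2_submanifold_def C2_chart_def by (simp only: conj_ac)

text \<open>No base point is fixed, so the facts about one chart hold at every point of
  \<open>M \<inter> U\<close> at once.\<close>

locale chart =
  fixes m :: nat and M U :: "'a::euclidean_space set" and \<Phi> \<Psi> :: "'a \<Rightarrow> 'a" and V :: "'a set"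
  assumes chart: "C2_chart m M U \<Phi> \<Psi> V"
begin

lemma open_U: "open U" and open_image: "open (\<Phi> ` U)" and C2_\<Phi>: "C2_on U \<Phi>" and C2_\<Psi>: "C2_on (\<Phi> ` U) \<Psi>"
  and \<Psi>_\<Phi>: "x \<in> U \<Longrightarrow> \<Psi> (\<Phi> x) = x" and subspace_V: "subspace V" and dim_V: "dim V = m"
  and image_M: "\<Phi> ` (M \<inter> U) = V \<inter> \<Phi> ` U"
  using chart unfolding C2_chart_def by auto

definition d\<Phi> :: "'a \<Rightarrow> 'a \<Rightarrow>\<^sub>L 'a" where
  "d\<Phi> = (SOME f'. (\<forall>x\<in>U. (\<Phi> has_derivative blinfun_apply (f' x)) (at x)) \<and> C1_on U f')"

definition d\<Psi> :: "'a \<Rightarrow> 'a \<Rightarrow>\<^sub>L 'a" where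
  "d\<Psi> = (SOME f'. (\<forall>x\<in>\<Phi> ` U. (\<Psi> has_derivative blinfun_apply (f' x)) (at x)) \<and> C1_on (\<Phi> ` U) f')"

lemma d\<Phi>: "x \<in> U \<Longrightarrow> (\<Phi> has_derivative blinfun_apply (d\<Phi> x)) (at x)" and C1_d\<Phi>: "C1_on U d\<Phi>"
  using someI_ex[OF C2_\<Phi>[unfolded C2_on_def], folded d\<Phi>_def] by auto

lemma d\<Psi>: "y \<in> \<Phi> ` U \<Longrightarrow> (\<Psi> has_derivative blinfun_apply (d\<Psi> y)) (at y)" and C1_d\<Psi>: "C1_on (\<Phi> ` U) d\<Psi>"
  using someI_ex[OF C2_\<Psi>[unfolded C2_on_def], folded d\<Psi>_def] by auto

lemma d\<Psi>_d\<Phi>: "x \<in> U \<Longrightarrow> d\<Psi> (\<Phi> x) (d\<Phi> x v) = v"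
proof -
  assume x: "x \<in> U"
  have "((\<lambda>y. \<Psi> (\<Phi> y)) has_derivative (\<lambda>v. d\<Psi> (\<Phi> x) (d\<Phi> x v))) (at x)"
    by (rule has_derivative_compose[OF d\<Phi>[OF x] d\<Psi>]) (use x in auto)
  then have "((\<lambda>y. y) has_derivative (\<lambda>v. d\<Psi> (\<Phi> x) (d\<Phi> x v))) (at x)"
    using open_U x by (rule has_derivative_transform_within_open) (auto simp: \<Psi>_\<Phi>)
  then show ?thesis
    using has_derivative_unique[OF _ has_derivative_ident] by metis
qed

lemma d\<Phi>_d\<Psi>: "x \<in> U \<Longrightarrow> d\<Phi> x (d\<Psi> (\<Phi> x) v) = v"
proof -
  assume x: "x \<in> U"
  then have y: "\<Phi> x \<in> \<Phi> ` U" by auto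
  have "((\<lambda>y. \<Phi> (\<Psi> y)) has_derivative (\<lambda>v. d\<Phi> x (d\<Psi> (\<Phi> x) v))) (at (\<Phi> x))"
    using has_derivative_compose[OF d\<Psi>[OF y], of \<Phi> "d\<Phi> x"] d\<Phi>[OF x] \<Psi>_\<Phi>[OF x] by simp
  then have "((\<lambda>y. y) has_derivative (\<lambda>v. d\<Phi> x (d\<Psi> (\<Phi> x) v))) (at (\<Phi> x))"
    using open_image y by (rule has_derivative_transform_within_open) (auto simp: \<Psi>_\<Phi>)
  then show ?thesis
    using has_derivative_unique[OF _ has_derivative_ident] by metis
qed

lemma \<Phi>_in_V: "q \<in> M \<Longrightarrow> q \<in> U \<Longrightarrow> \<Phi> q \<in> V"
  using image_M by blast

lemma \<Psi>_in_M: "y \<in> V \<Longrightarrow> y \<in> \<Phi> ` U \<Longrightarrow> \<Psi> y \<in> M"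
proof -
  assume "y \<in> V" "y \<in> \<Phi> ` U"
  then have "y \<in> \<Phi> ` (M \<inter> U)"
    using image_M by simp
  then show ?thesis
    using \<Psi>_\<Phi> by auto
qed

text \<open>Forwards, the chart image of a curve in \<open>M\<close> lies in \<open>V\<close> near 0
  and so do its difference quotients. Backwards, \<open>\<Psi>\<close> maps a straight segment in
  \<open>V\<close> to a curve in \<open>M\<close>.\<close>

lemma tangent_space_iff:
  assumes q: "q \<in> M" "q \<in> U"
  shows "v \<in> tangent_space M q \<longleftrightarrow> d\<Phi> q v \<in> V"
proof
  assume "v \<in> tangent_space M q"
  then obtain \<gamma> where \<gamma>: "\<And>t. \<gamma> t \<in> M" "\<gamma> 0 = q" "(\<gamma> has_vector_derivative v) (at (0::real))"
    using tangent_spaceE by metis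
  then obtain I where I: "open I" "0 \<in> I" "\<forall>t\<in>I. \<gamma> t \<in> U"
    using curve_eventually_in q open_U by metis
  have "((\<lambda>t. \<Phi> (\<gamma> t)) has_vector_derivative d\<Phi> q v) (at 0)"
    using has_derivative_compose[OF \<gamma>(3)[unfolded has_vector_derivative_def], of \<Phi> "d\<Phi> q"] d\<Phi>[OF q(2)] \<gamma>(2)
    by (simp add: has_vector_derivative_def blinfun.scaleR_right)
  then have lim: "((\<lambda>t. (\<Phi> (\<gamma> t) - \<Phi> (\<gamma> 0)) /\<^sub>R t) \<longlongrightarrow> d\<Phi> q v) (at 0)"
    by (rule has_vector_derivative_quotient)
  show "d\<Phi> q v \<in> V"
  proof (rule Lim_in_closed_set[OF closed_subspace[OF subspace_V] _ _ lim])
    have "eventually (\<lambda>t. t \<in> I) (at 0)"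
      using I by (auto simp: eventually_at_topological)
    then show "eventually (\<lambda>t. (\<Phi> (\<gamma> t) - \<Phi> (\<gamma> 0)) /\<^sub>R t \<in> V) (at 0)"
      by eventually_elim
        (use I \<gamma>(1) in \<open>auto intro!: subspace_scale subspace_diff subspace_V \<Phi>_in_V\<close>)
  qed simp
next
  assume v: "d\<Phi> q v \<in> V"
  let ?c = "\<lambda>t. \<Phi> q + t *\<^sub>R d\<Phi> q v"
  have c: "(?c has_vector_derivative d\<Phi> q v) (at 0)"
    by (rule has_vector_derivative_line)
  then obtain I where I: "open I" "0 \<in> I" "\<forall>t\<in>I. ?c t \<in> \<Phi> ` U"
    using curve_eventually_in[OF c, of "\<Phi> ` U"] q open_image by auto
  show "v \<in> tangent_space M q"
  proof (rule tangent_spaceI[OF I(1,2), where \<gamma> = "\<lambda>t. \<Psi> (?c t)"])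
    show "\<Psi> (?c t) \<in> M" if "t \<in> I" for t
    proof (rule \<Psi>_in_M)
      show "?c t \<in> V"
        by (intro subspace_add subspace_V subspace_scale \<Phi>_in_V v q)
    qed (use that I in auto)
    show "\<Psi> (?c 0) = q"
      using q \<Psi>_\<Phi> by simp
    have "(\<Psi> has_derivative d\<Psi> (\<Phi> q)) (at (?c 0))"
      using d\<Psi>[of "\<Phi> q"] q by simp
    from has_derivative_compose[OF c[unfolded has_vector_derivative_def] this]
    show "((\<lambda>t. \<Psi> (?c t)) has_vector_derivative v) (at 0)"
      by (simp add: has_vector_derivative_def blinfun.scaleR_right d\<Psi>_d\<Phi>[OF q(2)])
  qed
qed

lemma tangent_space_eq_image:
  assumes q: "q \<in> M" "q \<in> U"
  shows "tangent_space M q = d\<Psi> (\<Phi> q) ` V"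
  using tangent_space_iff[OF q] d\<Psi>_d\<Phi>[OF q(2)] d\<Phi>_d\<Psi>[OF q(2)] by (auto simp: image_iff) metis

lemma linear_d\<Psi>: "linear (blinfun_apply (d\<Psi> y))"
  by (simp add: blinfun.bounded_linear_right bounded_linear.linear)

lemma inj_d\<Psi>: "q \<in> U \<Longrightarrow> inj (blinfun_apply (d\<Psi> (\<Phi> q)))"
  using d\<Phi>_d\<Psi> by (metis injI)

lemma subspace_tangent_space_chart: "q \<in> M \<Longrightarrow> q \<in> U \<Longrightarrow> subspace (tangent_space M q)"
  using linear_subspace_image[OF linear_d\<Psi> subspace_V] tangent_space_eq_image by metis

lemma dim_tangent_space_chart: "q \<in> M \<Longrightarrow> q \<in> U \<Longrightarrow> dim (tangent_space M q) = m"
  using dim_image_eq[OF linear_d\<Psi> inj_on_subset[OF inj_d\<Psi>]] tangent_space_eq_image dim_V by simp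

text \<open>These are the fields with constant coefficients in the chart. They are C1 because
  \<open>\<Psi>\<close> is C2; for a basis of \<open>V\<close> they form a local tangent
  frame.\<close>

lemma tangent_field_chart: 
  assumes "v \<in> V"
  shows "C1_on U (\<lambda>x. d\<Psi> (\<Phi> x) v)" "tangent_field (M \<inter> U) (\<lambda>x. d\<Psi> (\<Phi> x) v)"
proof -
  have "C1_on U (\<lambda>x. d\<Psi> (\<Phi> x))"
    by (rule C1_on_compose[OF C2_on_imp_C1_on[OF C2_\<Phi>] C1_d\<Psi>]) auto
  then show C1: "C1_on U (\<lambda>x. d\<Psi> (\<Phi> x) v)"
    by (rule bounded_bilinear.C1_on[OF bounded_bilinear_blinfun_apply _ C1_on_const])
  show "tangent_field (M \<inter> U) (\<lambda>x. d\<Psi> (\<Phi> x) v)"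
    unfolding tangent_field_def C1_field_def
  proof (intro conjI ballI)
    show "\<exists>O' Y. open O' \<and> x \<in> O' \<and> C1_on O' Y \<and> (\<forall>x\<in>M \<inter> U \<inter> O'. Y x = d\<Psi> (\<Phi> x) v)"
      if "x \<in> M \<inter> U" for x
      using C1 open_U that by (intro exI[of _ U] exI[of _ "\<lambda>x. d\<Psi> (\<Phi> x) v"]) auto
    show "d\<Psi> (\<Phi> x) v \<in> tangent_space (M \<inter> U) x" if "x \<in> M \<inter> U" for x
      using that assms by (simp add: tangent_space_Int_open open_U tangent_space_eq_image)
  qed
qed

lemma continuous_on_oproj_tangent_space_chart:
  assumes "continuous_on (M \<inter> U) w"
  shows "continuous_on (M \<inter> U) (\<lambda>x. oproj (tangent_space M x) (w x))"
proof -
  obtain B where B: "B \<subseteq> V" "independent B" "span B = V"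
    using basis_exists[of V] subspace_V by (metis span_subspace)
  have "continuous_on (M \<inter> U) (\<lambda>x. oproj (span ((\<lambda>b. d\<Psi> (\<Phi> x) b) ` B)) (w x))"
  proof (rule continuous_on_oproj_span)
    show "finite B"
      using B(2) by (rule independent_imp_finite)
    show "continuous_on (M \<inter> U) (\<lambda>x. d\<Psi> (\<Phi> x) b)" if "b \<in> B" for b
      using C1_on_continuous_on[OF tangent_field_chart(1)] that B(1) by (meson continuous_on_subset inf_le2 subsetD)
    show "inj_on (\<lambda>b. d\<Psi> (\<Phi> x) b) B \<and> independent ((\<lambda>b. d\<Psi> (\<Phi> x) b) ` B)" if "x \<in> M \<inter> U" for x
      using that inj_d\<Psi>[of x] linear_independent_injective_image[OF linear_d\<Psi> B(2), of "\<Phi> x"]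
      by (auto intro: inj_on_subset)
  qed fact
  then show ?thesis
    by (rule continuous_on_eq)
       (auto simp: tangent_space_eq_image linear_span_image[OF linear_d\<Psi>] B(3))
qed

text \<open>This is what makes the second fundamental form independent of the chosen extension.\<close>

lemma flat_deriv_tangent_zero:
  assumes p: "p \<in> M" "p \<in> U" and O: "open O'" "p \<in> O'" and W: "tangent_field (M \<inter> O') W" "W p = 0"
    and u: "u \<in> tangent_space M p"
  shows "flat_deriv M W p u \<in> tangent_space M p"
proof -
  obtain \<gamma> where \<gamma>: "\<And>t. \<gamma> t \<in> M" "\<gamma> 0 = p" "(\<gamma> has_vector_derivative u) (at (0::real))"
    using tangent_spaceE[OF u] by metis
  then obtain I where I: "open I" "0 \<in> I" "\<forall>t\<in>I. \<gamma> t \<in> U \<inter> O'"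
    using curve_eventually_in[of \<gamma> u "U \<inter> O'"] p O open_U by auto
  have "W differentiable (at p within M)"
    using W C1_field_Int_open_differentiable[OF _ p(1) O(2,1)] by (auto simp: tangent_field_def)
  from flat_deriv_curve[OF this \<gamma>]
  have lim: "((\<lambda>t. W (\<gamma> t) /\<^sub>R t) \<longlongrightarrow> flat_deriv M W p u) (at 0)"
    using \<gamma>(2) W(2) by (auto dest: has_vector_derivative_quotient)
  have "isCont \<gamma> 0"
    using \<gamma>(3) has_vector_derivative_continuous by blast
  moreover have "isCont d\<Phi> p"
    using C1_on_continuous_on[OF C1_d\<Phi>] open_U p by (simp add: continuous_on_eq_continuous_at)
  ultimately have "((\<lambda>t. d\<Phi> (\<gamma> t)) \<longlongrightarrow> d\<Phi> p) (at 0)"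
    using \<gamma>(2) by (metis isCont_def isCont_tendsto_compose)
  \<comment> \<open>As \<open>W p = 0\<close>, the quotient is \<open>W (\<gamma> t)\<close> divided
    by t, a vector tangent at the moving point \<open>\<gamma> t\<close>. The chart derivative at
    that same point carries it into the fixed closed subspace \<open>V\<close>, so the limit stays
    in \<open>V\<close>.\<close>
  from blinfun.tendsto[OF this lim]
  have "((\<lambda>t. d\<Phi> (\<gamma> t) (W (\<gamma> t) /\<^sub>R t)) \<longlongrightarrow> d\<Phi> p (flat_deriv M W p u)) (at 0)" .
  then have "d\<Phi> p (flat_deriv M W p u) \<in> V"
  proof (rule Lim_in_closed_set[OF closed_subspace[OF subspace_V], rotated 2])
    have "eventually (\<lambda>t. t \<in> I) (at 0)"
      using I by (auto simp: eventually_at_topological)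
    then show "eventually (\<lambda>t. d\<Phi> (\<gamma> t) (W (\<gamma> t) /\<^sub>R t) \<in> V) (at 0)"
    proof eventually_elim
      fix t assume "t \<in> I"
      then have "\<gamma> t \<in> U" "\<gamma> t \<in> O'" using I by auto
      then have "W (\<gamma> t) \<in> tangent_space M (\<gamma> t)"
        using W(1) \<gamma>(1) tangent_space_Int_open[OF O(1)] by (auto simp: tangent_field_def)
      then show "d\<Phi> (\<gamma> t) (W (\<gamma> t) /\<^sub>R t) \<in> V"
        using tangent_space_iff[OF \<gamma>(1) \<open>\<gamma> t \<in> U\<close>] subspace_scale[OF subspace_V]
        by (simp add: blinfun.scaleR_right)
    qed
  qed simp
  then show ?thesis
    using tangent_space_iff[OF p] by simp
qed

end

lemma C2_submanifold_chart:
  assumes "C2_submanifold m M" "p \<in> M"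
  obtains U \<Phi> \<Psi> V where "p \<in> U" "chart m M U \<Phi> \<Psi> V"
  using assms unfolding C2_submanifold_iff_chart chart_def by blast

lemma subspace_tangent_space: "C2_submanifold m M \<Longrightarrow> p \<in> M \<Longrightarrow> subspace (tangent_space M p)"
  by (meson C2_submanifold_chart chart.subspace_tangent_space_chart)

lemma dim_tangent_space: "C2_submanifold m M \<Longrightarrow> p \<in> M \<Longrightarrow> dim (tangent_space M p) = m"
  by (meson C2_submanifold_chart chart.dim_tangent_space_chart)

lemma subspace_normal_space: "subspace (tangent_space N p) \<Longrightarrow> subspace (normal_space N M p)"
  by (auto simp: normal_space_def subspace_def inner_add_left)

lemma continuous_on_oproj_tangent_space:
  assumes "C2_submanifold m M" "continuous_on M w"
  shows "continuous_on M (\<lambda>x. oproj (tangent_space M x) (w x))"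
proof (rule continuous_onI_local)
  fix p assume "p \<in> M"
  with assms(1) obtain U \<Phi> \<Psi> V where "p \<in> U" "chart m M U \<Phi> \<Psi> V"
    by (rule C2_submanifold_chart)
  then show "\<exists>U. open U \<and> p \<in> U \<and> continuous_on (M \<inter> U) (\<lambda>x. oproj (tangent_space M x) (w x))"
    using chart.continuous_on_oproj_tangent_space_chart[of m M U \<Phi> \<Psi> V w] chart.open_U[of m M U \<Phi> \<Psi> V]
      continuous_on_subset[OF assms(2), of "M \<inter> U"]
    by (intro exI[of _ U]) simp
qed

lemma continuous_on_flat_deriv:
  assumes X: "C1_field M X" and w: "continuous_on M w" "\<And>x. x \<in> M \<Longrightarrow> w x \<in> tangent_space M x"
  shows "continuous_on M (\<lambda>x. flat_deriv M X x (w x))"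
proof (rule continuous_onI_local)
  fix p assume "p \<in> M"
  then obtain U Y where U: "open U" "p \<in> U" "C1_on U Y" "\<And>x. x \<in> M \<inter> U \<Longrightarrow> Y x = X x"
    using C1_fieldE[OF X] by metis
  obtain Y' where Y': "\<And>x. x \<in> U \<Longrightarrow> (Y has_derivative blinfun_apply (Y' x)) (at x)" "continuous_on U Y'"
    using U(3) by (rule C1_onE) blast
  have "continuous_on (M \<inter> U) (\<lambda>x. Y' x (w x))"
    using Y'(2) w(1) by (intro continuous_intros) (auto intro: continuous_on_subset)
  then have "continuous_on (M \<inter> U) (\<lambda>x. flat_deriv M X x (w x))"
    by (rule continuous_on_eq) (use flat_deriv_extension(2)[OF U(1) _ _ Y'(1) U(4)] w(2) in auto)
  with U show "\<exists>U. open U \<and> p \<in> U \<and> continuous_on (M \<inter> U) (\<lambda>x. flat_deriv M X x (w x))"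
    by blast
qed

section \<open>Normal projections and the second fundamental form\<close>

lemma oproj_oproj_subset:
  assumes "subspace N" "subspace T" "N \<subseteq> T"
  shows "oproj N (oproj T w) = oproj N w"
proof (rule oproj_eqI[OF assms(1) oproj_in[OF assms(1)]])
  fix z assume "z \<in> N"
  then show "(oproj T w - oproj N w) \<bullet> z = 0"
    using inner_oproj[OF assms(1), of z w] inner_oproj[OF assms(2), of z w] assms(3)
    by (auto simp: inner_diff_left)
qed

text \<open>The normal space lies inside the tangent space of \<open>N\<close>, so the intermediate
  projection is invisible. Both \<open>second_ff\<close> and \<open>normal_conn\<close> thus reduce
  to flat derivatives.\<close>

lemma oproj_normal_cov_deriv:
  assumes "subspace (tangent_space N p)"
  shows "oproj (normal_space N M p) (cov_deriv N M X p u) = oproj (normal_space N M p) (flat_deriv M X p u)"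
  unfolding cov_deriv_def
  by (rule oproj_oproj_subset[OF subspace_normal_space[OF assms] assms]) (auto simp: normal_space_def)

lemma normal_conn_eq:
  "subspace (tangent_space N p) \<Longrightarrow>
    normal_conn N M X p u = oproj (normal_space N M p) (flat_deriv M X p u)"
  unfolding normal_conn_def by (rule oproj_normal_cov_deriv)

text \<open>It expresses the normal projection through the tangential one, whose continuity in the
  base point follows from charts.\<close>

lemma oproj_normal_space_UNIV:
  assumes "subspace (tangent_space M p)"
  shows "oproj (normal_space UNIV M p) w = w - oproj (tangent_space M p) w"
  by (rule oproj_eqI[OF subspace_normal_space])
     (use assms in \<open>auto simp: normal_space_def oproj_orthogonal inner_commute[of "oproj _ _"]
       intro: oproj_in subst[OF inner_commute]\<close>)

text \<open>\<open>E v\<close> has constant chart coefficients, and \<open>v\<close> enters them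
  linearly through \<open>d\<Phi> p v\<close>. The same construction therefore supplies an extension
  for every tangent vector and the bilinearity of its derivative.\<close>

lemma tangent_extension_exists:
  assumes "C2_submanifold m M" "p \<in> M"
  obtains \<beta> E where "bilinear \<beta>"
    "\<And>u v. u \<in> tangent_space M p \<Longrightarrow> v \<in> tangent_space M p \<Longrightarrow>
      tangent_extension M p v (E v) \<and> flat_deriv M (E v) p u = \<beta> u v"
proof -
  obtain U \<Phi> \<Psi> V where U: "p \<in> U" "chart m M U \<Phi> \<Psi> V"
    using assms by (rule C2_submanifold_chart)
  interpret chart m M U \<Phi> \<Psi> V by fact
  define E where "E v x = blinfun_apply (d\<Psi> (\<Phi> x)) (d\<Phi> p v)" for v x
  obtain D where D: "((\<lambda>x. d\<Psi> (\<Phi> x)) has_derivative D) (at p)"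
    using C1_on_differentiable[OF C1_on_compose[OF C2_on_imp_C1_on[OF C2_\<Phi>] C1_d\<Psi>]] U(1)
    by (auto simp: differentiable_def)
  have dE: "(E v has_derivative (\<lambda>u. blinfun_apply (D u) (d\<Phi> p v))) (at p)" for v
    unfolding E_def
    by (rule bounded_linear.has_derivative[OF _ D, of "\<lambda>A. blinfun_apply A _"])
       (rule bounded_bilinear.bounded_linear_left[OF bounded_bilinear_blinfun_apply])
  have "bilinear (\<lambda>u v. blinfun_apply (D u) (d\<Phi> p v))"
    using has_derivative_linear[OF D]
    by (auto simp: bilinear_def linear_iff blinfun.add_left blinfun.add_right blinfun.scaleR_left blinfun.scaleR_right)
  moreover have "tangent_extension M p v (E v) \<and> flat_deriv M (E v) p u = blinfun_apply (D u) (d\<Phi> p v)"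
    if u: "u \<in> tangent_space M p" and v: "v \<in> tangent_space M p" for u v
  proof
    have "d\<Phi> p v \<in> V"
      using tangent_space_iff[OF assms(2) U(1)] v by simp
    then have "tangent_field (M \<inter> U) (E v)"
      unfolding E_def by (rule tangent_field_chart)
    then show "tangent_extension M p v (E v)"
      unfolding tangent_extension_def using U open_U d\<Psi>_d\<Phi> by (auto simp: E_def)
    show "flat_deriv M (E v) p u = blinfun_apply (D u) (d\<Phi> p v)"
      by (rule flat_deriv_extension(2)[OF open_U U(1) assms(2) dE _ u]) simp
  qed
  ultimately show thesis by (rule that)
qed

text \<open>The given extension and the one picked by \<open>SOME\<close> differ by a tangent field
  vanishing at \<open>p\<close>. Its derivative is tangent by \<open>flat_deriv_tangent_zero\<close>
  and is annihilated by the normal projection.\<close>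

lemma second_ff_eq:
  assumes M: "C2_submanifold m M" "p \<in> M" and N: "M \<subseteq> N" "subspace (tangent_space N p)"
    and V: "tangent_extension M p v V" and u: "u \<in> tangent_space M p"
  shows "second_ff N M p u v = oproj (normal_space N M p) (flat_deriv M V p u)"
proof -
  define V' where "V' = (SOME V. tangent_extension M p v V)"
  have V': "tangent_extension M p v V'"
    unfolding V'_def using V by (rule someI[of "tangent_extension M p v"])
  obtain O1 where O1: "open O1" "p \<in> O1" "tangent_field (M \<inter> O1) V" "V p = v"
    using V unfolding tangent_extension_def by blast
  obtain O2 where O2: "open O2" "p \<in> O2" "tangent_field (M \<inter> O2) V'" "V' p = v"
    using V' unfolding tangent_extension_def by blast
  let ?W = "\<lambda>x. V' x - V x"
  have W: "tangent_field (M \<inter> (O1 \<inter> O2)) ?W"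
    unfolding tangent_field_def
  proof
    show "C1_field (M \<inter> (O1 \<inter> O2)) ?W"
      unfolding C1_field_def
    proof
      fix q assume q: "q \<in> M \<inter> (O1 \<inter> O2)"
      obtain U1 Y1 where 1: "open U1" "q \<in> U1" "C1_on U1 Y1" "\<And>x. x \<in> M \<inter> O1 \<inter> U1 \<Longrightarrow> Y1 x = V x"
        using C1_fieldE[of "M \<inter> O1" V q] O1(3) q unfolding tangent_field_def by (metis Int_iff)
      obtain U2 Y2 where 2: "open U2" "q \<in> U2" "C1_on U2 Y2" "\<And>x. x \<in> M \<inter> O2 \<inter> U2 \<Longrightarrow> Y2 x = V' x"
        using C1_fieldE[of "M \<inter> O2" V' q] O2(3) q unfolding tangent_field_def by (metis Int_iff)
      have "C1_on (U1 \<inter> U2) (\<lambda>x. Y2 x - Y1 x)"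
        using 1(3) 2(3) by (intro C1_on_minus) (auto intro: C1_on_subset)
      then show "\<exists>U Y. open U \<and> q \<in> U \<and> C1_on U Y \<and> (\<forall>x\<in>M \<inter> (O1 \<inter> O2) \<inter> U. Y x = ?W x)"
        using 1 2 by (intro exI[of _ "U1 \<inter> U2"] exI[of _ "\<lambda>x. Y2 x - Y1 x"]) auto
    qed
    show "\<forall>q\<in>M \<inter> (O1 \<inter> O2). ?W q \<in> tangent_space (M \<inter> (O1 \<inter> O2)) q"
    proof
      fix q assume q: "q \<in> M \<inter> (O1 \<inter> O2)"
      then have "V q \<in> tangent_space M q" "V' q \<in> tangent_space M q"
        using O1 O2 tangent_field_Int_openD by auto
      then have "?W q \<in> tangent_space M q"
        using subspace_tangent_space[OF M(1)] q by (auto intro: subspace_diff)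
      then show "?W q \<in> tangent_space (M \<inter> (O1 \<inter> O2)) q"
        using q O1(1) O2(1) by (simp add: tangent_space_Int_open open_Int)
    qed
  qed
  have diff: "V differentiable (at p within M)" "V' differentiable (at p within M)"
    using O1 O2 M(2) C1_field_Int_open_differentiable by (auto simp: tangent_field_def)
  obtain \<gamma> where \<gamma>: "\<And>t. \<gamma> t \<in> M" "\<gamma> 0 = p" "(\<gamma> has_vector_derivative u) (at (0::real))"
    using tangent_spaceE[OF u] by metis
  have "flat_deriv M ?W p u = flat_deriv M V' p u - flat_deriv M V p u"
    by (rule flat_deriv_eqI[where I=UNIV and \<gamma> = \<gamma>])
       (use diff \<gamma> in \<open>auto intro!: has_vector_derivative_diff flat_deriv_curve differentiable_diff\<close>)
  moreover obtain U \<Phi> \<Psi> Vc where U: "p \<in> U" "chart m M U \<Phi> \<Psi> Vc"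
    using M by (rule C2_submanifold_chart)
  ultimately have "flat_deriv M V' p u - flat_deriv M V p u \<in> tangent_space M p"
    using chart.flat_deriv_tangent_zero[OF U(2) M(2) U(1) _ _ W _ u] O1 O2 by auto
  then have 0: "oproj (normal_space N M p) (flat_deriv M V' p u - flat_deriv M V p u) = 0"
    by (intro oproj_eq_0 subspace_normal_space N(2)) (auto simp: normal_space_def inner_commute)
  then have "oproj (normal_space N M p) (flat_deriv M V' p u) = oproj (normal_space N M p) (flat_deriv M V p u)"
    using linear_diff[OF linear_oproj[OF subspace_normal_space[OF N(2)]]] by simp
  then show ?thesis
    unfolding second_ff_def V'_def[symmetric] oproj_normal_cov_deriv[OF N(2)] .
qed

lemma second_ff_bilinear:
  assumes M: "C2_submanifold m M" "p \<in> M" and N: "M \<subseteq> N" "subspace (tangent_space N p)"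
  obtains \<beta> where "bilinear \<beta>"
    "\<And>u v. u \<in> tangent_space M p \<Longrightarrow> v \<in> tangent_space M p \<Longrightarrow> second_ff N M p u v = \<beta> u v"
proof -
  obtain \<beta> E where \<beta>: "bilinear \<beta>"
    "\<And>u v. u \<in> tangent_space M p \<Longrightarrow> v \<in> tangent_space M p \<Longrightarrow>
      tangent_extension M p v (E v) \<and> flat_deriv M (E v) p u = \<beta> u v"
    using tangent_extension_exists[OF M] by metis
  show thesis
  proof
    show "bilinear (\<lambda>u v. oproj (normal_space N M p) (\<beta> u v))"
      using \<beta>(1) linear_compose[OF _ linear_oproj[OF subspace_normal_space[OF N(2)]]]
      by (fastforce simp: bilinear_def o_def)
    show "second_ff N M p u v = oproj (normal_space N M p) (\<beta> u v)"
      if "u \<in> tangent_space M p" "v \<in> tangent_space M p" for u v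
      using second_ff_eq[OF M N] \<beta>(2)[OF that] that by metis
  qed
qed


section \<open>Cones over submanifolds of the sphere\<close>

lemma sgn_scaleR_sphere:
  fixes x :: "'a::real_normed_vector"
  assumes "0 < t" "norm x = 1" shows "sgn (t *\<^sub>R x) = x"
  using assms by (simp add: sgn_div_norm)

lemma norm_scaleR_sgn: "norm y *\<^sub>R sgn y = (y::'a::real_normed_vector)"
  by (cases "y = 0") (simp_all add: sgn_div_norm)

lemma cone_over_iff:
  fixes S :: "'a::real_normed_vector set"
  assumes "S \<subseteq> sphere 0 1"
  shows "y \<in> cone_over S - {0} \<longleftrightarrow> y \<noteq> 0 \<and> sgn y \<in> S"
proof
  assume "y \<in> cone_over S - {0}"
  then obtain t x where t: "y = t *\<^sub>R x" "0 \<le> t" "x \<in> S" "y \<noteq> 0"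
    unfolding cone_over_def by auto
  then have "0 < t" "norm x = 1"
    using assms by (auto simp: less_le)
  with t show "y \<noteq> 0 \<and> sgn y \<in> S"
    using sgn_scaleR_sphere by metis
next
  assume y: "y \<noteq> 0 \<and> sgn y \<in> S"
  have "\<exists>t x. y = t *\<^sub>R x \<and> 0 \<le> t \<and> x \<in> S"
    using y norm_scaleR_sgn[of y] by (intro exI[of _ "norm y"] exI[of _ "sgn y"]) auto
  then show "y \<in> cone_over S - {0}"
    using y unfolding cone_over_def by simp
qed

lemma tangent_space_sphere:
  fixes x :: "'a::euclidean_space"
  assumes x: "norm x = 1"
  shows "tangent_space (sphere 0 1) x = {w. x \<bullet> w = 0}"
proof (intro equalityI subsetI)
  fix w assume "w \<in> tangent_space (sphere 0 1) x"
  then obtain \<gamma> where \<gamma>: "\<And>t. \<gamma> t \<in> sphere 0 1" "\<gamma> 0 = x" "(\<gamma> has_vector_derivative w) (at (0::real))"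
    using tangent_spaceE by metis
  have "((\<lambda>t. \<gamma> t \<bullet> \<gamma> t) has_vector_derivative (x \<bullet> w + w \<bullet> x)) (at 0)"
    using bounded_bilinear.has_vector_derivative[OF bounded_bilinear_inner \<gamma>(3) \<gamma>(3)] \<gamma>(2) by simp
  moreover have "(\<lambda>t. \<gamma> t \<bullet> \<gamma> t) = (\<lambda>t. 1)"
    using \<gamma>(1) by (simp add: dot_square_norm)
  ultimately have "x \<bullet> w + w \<bullet> x = 0"
    using vector_derivative_unique_at[OF _ has_vector_derivative_const] by metis
  then show "w \<in> {w. x \<bullet> w = 0}"
    by (simp add: inner_commute)
next
  fix w assume "w \<in> {w. x \<bullet> w = 0}"
  then have w: "x \<bullet> w = 0" by simp
  show "w \<in> tangent_space (sphere 0 1) x"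
  proof (cases "w = 0")
    case True
    then show ?thesis
      by (intro tangent_spaceI[of UNIV "\<lambda>_. x"]) (auto simp: x has_vector_derivative_const)
  next
    case False
    \<comment> \<open>The witness is the great circle through \<open>x\<close> with velocity
      \<open>w\<close>; dividing by \<open>norm w\<close> is why \<open>w = 0\<close> is a separate
      case.\<close>
    let ?n = "norm w"
    let ?\<gamma> = "\<lambda>t. cos (t * ?n) *\<^sub>R x + (sin (t * ?n) / ?n) *\<^sub>R w"
    show ?thesis
    proof (rule tangent_spaceI[of UNIV ?\<gamma>])
      have "?\<gamma> t \<bullet> ?\<gamma> t = 1" for t
      proof -
        have "?\<gamma> t \<bullet> ?\<gamma> t = (cos (t * ?n))\<^sup>2 * (x \<bullet> x) + (sin (t * ?n) / ?n)\<^sup>2 * (w \<bullet> w)"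
          using w by (simp add: inner_add_left inner_add_right inner_commute[of w x] power2_eq_square)
        also have "\<dots> = (cos (t * ?n))\<^sup>2 + (sin (t * ?n))\<^sup>2"
          using x False by (simp add: dot_square_norm power_divide)
        finally show ?thesis by simp
      qed
      then show "?\<gamma> t \<in> sphere 0 1" for t
        by (simp add: norm_eq_1)
      show "(?\<gamma> has_vector_derivative w) (at 0)"
      proof -
        have "((\<lambda>t. cos (t * ?n)) has_real_derivative 0) (at 0)"
          "((\<lambda>t. sin (t * ?n) / ?n) has_real_derivative 1) (at 0)"
          using False by (auto intro!: derivative_eq_intros)
        then have "(?\<gamma> has_vector_derivative
            (cos (0 * ?n) *\<^sub>R 0 + 0 *\<^sub>R x) + ((sin (0 * ?n) / ?n) *\<^sub>R 0 + 1 *\<^sub>R w)) (at 0)"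
          by (intro has_vector_derivative_add has_vector_derivative_scaleR has_vector_derivative_const)
        then show ?thesis by simp
      qed
    qed auto
  qed
qed

locale spherical_submanifold =
  fixes m :: nat and S :: "'a::euclidean_space set"
  assumes S: "C2_submanifold m S" and S_sphere: "S \<subseteq> sphere 0 1"
begin

abbreviation M :: "'a set" where "M \<equiv> cone_over S - {0}"

lemmas M_iff = cone_over_iff[OF S_sphere]

lemma norm_S: "x \<in> S \<Longrightarrow> norm x = 1"
  using S_sphere by auto

lemma scaleR_S_in_M: "x \<in> S \<Longrightarrow> 0 < r \<Longrightarrow> r *\<^sub>R x \<in> M"
  using M_iff norm_S sgn_scaleR_sphere by (metis less_irrefl norm_zero scaleR_eq_0_iff zero_neq_one)

lemma scaleR_M_in_M: "y \<in> M \<Longrightarrow> 0 < r \<Longrightarrow> r *\<^sub>R y \<in> M"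
  unfolding M_iff by (simp add: sgn_scaleR)

lemma tangent_space_S_sphere: "x \<in> S \<Longrightarrow> tangent_space S x \<subseteq> {w. x \<bullet> w = 0}"
  using tangent_space_mono[OF S_sphere] tangent_space_sphere norm_S by metis

lemma subspace_tangent_space_sphere: "x \<in> S \<Longrightarrow> subspace (tangent_space (sphere 0 1) x)"
  using tangent_space_sphere norm_S subspace_hyperplane by metis

text \<open>A chart of \<open>S\<close> already uses all coordinates of the ambient space, so the
  radial variable has to replace one of them. The direction \<open>e\<close> plays that role:
  \<open>P\<close> restricts \<open>\<Psi>\<close> to the hyperplane where \<open>\<tau>\<close>
  vanishes, which contains \<open>V\<close>, and the freed coordinate \<open>\<tau>\<close> becomes
  the distance to the apex.\<close>

lemma cone_C2_submanifold: "C2_submanifold (Suc m) M"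
  unfolding C2_submanifold_iff_chart
proof
  fix p assume p: "p \<in> M"
  define x0 t0 where "x0 = sgn p" and "t0 = norm p"
  have x0: "x0 \<in> S" and t0: "0 < t0" and p_eq: "p = t0 *\<^sub>R x0"
    using p M_iff norm_scaleR_sgn[of p] by (auto simp: x0_def t0_def)
  obtain U \<Phi> \<Psi> V where U: "x0 \<in> U" "chart m S U \<Phi> \<Psi> V"
    using C2_submanifold_chart[OF S x0] by metis
  interpret chart m S U \<Phi> \<Psi> V by fact
  \<comment> \<open>The chart image of the radial direction. It lies outside \<open>V\<close>
    because \<open>x0\<close> is orthogonal to the tangent space of \<open>S\<close> at
    \<open>x0\<close>.\<close>
  define e where "e = blinfun_apply (d\<Phi> x0) x0"
  have "x0 \<notin> tangent_space S x0"
    using tangent_space_S_sphere[OF x0] norm_S[OF x0] by (auto simp: norm_eq_1)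
  then have e: "e \<notin> V"
    using tangent_space_iff[OF x0 U(1)] by (simp add: e_def)
  \<comment> \<open>The inner product with \<open>q\<close> kills \<open>V\<close> but not
    \<open>e\<close>; normalised, it gives the functional \<open>\<tau>\<close> with value 1 on
    \<open>e\<close>.\<close>
  define q where "q = e - oproj V e"
  have q_V: "v \<bullet> q = 0" if "v \<in> V" for v
    using oproj_orthogonal[OF subspace_V that, of e] by (simp add: q_def inner_commute)
  have q0: "q \<bullet> q \<noteq> 0"
    using e oproj_in[OF subspace_V, of e] by (auto simp: q_def)
  have eq: "e \<bullet> q = q \<bullet> q"
    using q_V[OF oproj_in[OF subspace_V, of e]] by (simp add: q_def inner_diff_left)
  define \<tau> where "\<tau> w = (w \<bullet> q) / (q \<bullet> q)" for w
  define P where "P w = w - \<tau> w *\<^sub>R e" for w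
  have \<tau>_V: "\<tau> v = 0" if "v \<in> V" for v
    using q_V[OF that] by (simp add: \<tau>_def)
  have \<tau>_e: "\<tau> e = 1"
    using q0 eq by (auto simp: \<tau>_def)
  have \<tau>: "bounded_linear \<tau>"
    unfolding \<tau>_def[abs_def]
    by (rule bounded_linear_compose[OF bounded_linear_divide bounded_linear_inner_left])
  have P: "bounded_linear P"
    unfolding P_def[abs_def]
    by (intro bounded_linear_sub bounded_linear_ident bounded_linear_compose[OF bounded_linear_scaleR_left \<tau>])
  have \<tau>_P: "\<tau> (P w) = 0" for w
    using bounded_linear.linear[OF \<tau>] \<tau>_e by (simp add: P_def linear_diff linear_cmul)
  have \<tau>_ve: "\<tau> (v + r *\<^sub>R e) = r" and P_ve: "P (v + r *\<^sub>R e) = v" if "v \<in> V" for v r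
    using bounded_linear.linear[OF \<tau>] \<tau>_e \<tau>_V[OF that] by (simp_all add: P_def linear_add linear_cmul)
  txt \<open>
    \<open>G\<close> maps \<open>v + t e\<close> to \<open>t \<Psi>(v)\<close>, so it parametrises the cone over \<open>V + \<real> e\<close>; its local inverse
    is the desired chart.
  \<close>
  define G where "G w = \<tau> w *\<^sub>R \<Psi> (P w)" for w
  define D where "D = {w. 0 < \<tau> w \<and> P w \<in> \<Phi> ` U}"
  have cont: "continuous_on UNIV \<tau>" "continuous_on UNIV P"
    using \<tau> P linear_continuous_on by blast+
  have open_D: "open D"
  proof -
    have "D = (\<tau> -` {0<..}) \<inter> (P -` (\<Phi> ` U))"
      by (auto simp: D_def)
    then show ?thesis
      using open_vimage[OF _ cont(1)] open_vimage[OF open_image cont(2)] by auto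
  qed
  define w0 where "w0 = \<Phi> x0 + t0 *\<^sub>R e"
  have w0: "\<tau> w0 = t0" "P w0 = \<Phi> x0"
    using \<tau>_ve P_ve \<Phi>_in_V[OF x0 U(1)] by (auto simp: w0_def)
  then have w0_D: "w0 \<in> D"
    using t0 U(1) by (auto simp: D_def)
  have G_w0: "G w0 = p"
    using w0 \<Psi>_\<Phi>[OF U(1)] p_eq by (simp add: G_def)
  define dG where "dG w = (blinfun_scaleR_left (\<Psi> (P w)) o\<^sub>L Blinfun \<tau>) + \<tau> w *\<^sub>R (d\<Psi> (P w) o\<^sub>L Blinfun P)" for w
  have dG_apply: "blinfun_apply (dG w) h = \<tau> h *\<^sub>R \<Psi> (P w) + \<tau> w *\<^sub>R blinfun_apply (d\<Psi> (P w)) (P h)" for w h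
    using \<tau> P by (simp add: dG_def blinfun.add_left blinfun.scaleR_left bounded_linear_Blinfun_apply)
  have dG: "(G has_derivative blinfun_apply (dG w)) (at w)" if "w \<in> D" for w
  proof -
    have "((\<lambda>w. \<Psi> (P w)) has_derivative (\<lambda>h. blinfun_apply (d\<Psi> (P w)) (P h))) (at w)"
      using that by (intro has_derivative_compose[OF bounded_linear_imp_has_derivative[OF P]] d\<Psi>) (auto simp: D_def)
    from has_derivative_scaleR[OF bounded_linear_imp_has_derivative[OF \<tau>] this]
    show ?thesis
      unfolding G_def[abs_def] by (rule has_derivative_eq_rhs) (simp add: fun_eq_iff dG_apply add.commute)
  qed
  have C1_P: "C1_on D P" and C1_\<tau>: "C1_on D \<tau>"
    by (rule C1_on_linear, fact)+
  have "C1_on D (\<lambda>w. \<Psi> (P w))" "C1_on D (\<lambda>w. d\<Psi> (P w))"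
    using C1_on_compose[OF C1_P C2_on_imp_C1_on[OF C2_\<Psi>]] C1_on_compose[OF C1_P C1_d\<Psi>] by (auto simp: D_def)
  note C1_\<Psi>_P = this
  have "C1_on D (\<lambda>w. blinfun_scaleR_left (\<Psi> (P w)))"
    by (rule C1_on_compose[OF C1_\<Psi>_P(1) C1_on_linear[OF bounded_linear_blinfun_scaleR_left, of UNIV]]) simp
  then have "C1_on D dG"
    unfolding dG_def[abs_def]
    by (intro C1_on_add C1_on_scaleR C1_\<tau> bounded_bilinear.C1_on[OF bounded_bilinear_blinfun_compose]
        C1_on_const C1_\<Psi>_P)
  then have C2_G: "C2_on D G"
    unfolding C2_on_def using dG by blast
  have "inj (blinfun_apply (dG w0))"
  proof -
    have "h = 0" if "blinfun_apply (dG w0) h = 0" for h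
    proof -
      have "\<tau> h *\<^sub>R x0 + t0 *\<^sub>R blinfun_apply (d\<Psi> (\<Phi> x0)) (P h) = 0"
        using that w0 \<Psi>_\<Phi>[OF U(1)] by (simp add: dG_apply)
      \<comment> \<open>\<open>d\<Phi> x0\<close> turns \<open>x0\<close> into \<open>e\<close> and
        undoes \<open>d\<Psi>\<close>; then \<open>\<tau>\<close> separates the two summands,
        because it is 1 on \<open>e\<close> and 0 on the range of \<open>P\<close>.\<close>
      then have "blinfun_apply (d\<Phi> x0) (\<tau> h *\<^sub>R x0 + t0 *\<^sub>R blinfun_apply (d\<Psi> (\<Phi> x0)) (P h)) = 0"
        by simp
      then have 0: "\<tau> h *\<^sub>R e + t0 *\<^sub>R P h = 0"
        using d\<Phi>_d\<Psi>[OF U(1)] by (simp add: blinfun.add_right blinfun.scaleR_right e_def)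
      have "\<tau> (\<tau> h *\<^sub>R e + t0 *\<^sub>R P h) = \<tau> h"
        using bounded_linear.linear[OF \<tau>] \<tau>_e \<tau>_P by (simp add: linear_add linear_cmul)
      then have "\<tau> h = 0"
        using 0 bounded_linear.linear[OF \<tau>] by (simp add: linear_0)
      then show "h = 0"
        using 0 t0 by (simp add: P_def)
    qed
    then show ?thesis
      using linear_injective_0[of "blinfun_apply (dG w0)"] by (simp add: blinfun.bounded_linear_right bounded_linear.linear)
  qed
  then have "inj (frechet_derivative G (at w0))"
    using frechet_derivative_at[OF dG[OF w0_D]] by simp
  from C2_local_inverse[OF open_D w0_D C2_G this]
  obtain U' V' g where g: "open U'" "U' \<subseteq> D" "w0 \<in> U'" "open V'" "G ` U' = V'" "g ` V' = U'"
    "\<And>x. x \<in> U' \<Longrightarrow> g (G x) = x" "\<And>y. y \<in> V' \<Longrightarrow> G (g y) = y" "C2_on V' g"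
    by metis
  define E where "E = {y. y \<noteq> 0 \<and> sgn y \<in> U}"
  define F where "F y = \<Phi> (sgn y) + norm y *\<^sub>R e" for y
  \<comment> \<open>On the cone \<open>F\<close> is an explicit right inverse of \<open>G\<close>.
    Requiring \<open>F y\<close> to lie in \<open>U'\<close>, where \<open>g\<close> inverts
    \<open>G\<close>, forces \<open>g y = F y\<close> at points of the cone; otherwise
    \<open>g y\<close> might lie on another preimage, outside \<open>V2\<close>.\<close>
  define U2 where "U2 = V' \<inter> (E \<inter> F -` U')"
  have contsgn: "continuous_on (- {0}) (sgn :: 'a \<Rightarrow> 'a)"
    by (rule C1_on_continuous_on[OF C1_on_sgn]) simp
  have open_E: "open E"
  proof -
    have "E = (- {0}) \<inter> sgn -` U"
      by (auto simp: E_def)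
    then show ?thesis
      using continuous_open_preimage[OF contsgn _ open_U] by auto
  qed
  have "continuous_on E F"
    unfolding F_def[abs_def]
    by (intro continuous_intros continuous_on_compose2[OF C1_on_continuous_on[OF C2_on_imp_C1_on[OF C2_\<Phi>]]]
        continuous_on_subset[OF contsgn]) (auto simp: E_def)
  then have open_U2: "open U2"
    unfolding U2_def using continuous_open_preimage[OF _ open_E g(1)] g(4) by blast
  have p_U2: "p \<in> U2"
  proof -
    have "p \<in> V'"
      using g(3,5) G_w0 by auto
    moreover have "p \<noteq> 0" "sgn p = x0" "norm p = t0"
      using p by (auto simp: x0_def t0_def)
    ultimately show ?thesis
      using U(1) g(3) by (auto simp: U2_def E_def F_def w0_def)
  qed
  have g_U2: "g ` U2 = U' \<inter> G -` U2"
  proof (intro equalityI subsetI)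
    fix w assume "w \<in> g ` U2"
    then obtain y where "y \<in> U2" "w = g y" by blast
    moreover from this have "y \<in> V'" by (simp add: U2_def)
    ultimately show "w \<in> U' \<inter> G -` U2"
      using g(6,8) by auto
  next
    fix w assume "w \<in> U' \<inter> G -` U2"
    then show "w \<in> g ` U2"
      using g(7)[of w] by (auto intro: image_eqI[of _ _ "G w"])
  qed
  have open_gU2: "open (g ` U2)"
    unfolding g_U2
    by (intro continuous_open_preimage continuous_on_subset[OF C1_on_continuous_on[OF C2_on_imp_C1_on[OF C2_G]]] g open_U2)
  define V2 where "V2 = span (insert e V)"
  have V2_iff: "w \<in> V2 \<longleftrightarrow> P w \<in> V" for w
  proof
    assume "w \<in> V2"
    then obtain c where c: "w - c *\<^sub>R e \<in> V"
      using span_breakdown_eq[of w e V] span_eq_iff[THEN iffD2, OF subspace_V] by (auto simp: V2_def)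
    then have "P w = w - c *\<^sub>R e"
      using P_ve[OF c, of c] by simp
    then show "P w \<in> V" using c by simp
  next
    assume "P w \<in> V"
    then show "w \<in> V2"
      using span_breakdown_eq[of w e V] span_eq_iff[THEN iffD2, OF subspace_V] by (auto simp: V2_def P_def)
  qed
  have dim_V2: "dim V2 = Suc m"
    using e dim_insert[of e V] dim_V span_eq_iff[THEN iffD2, OF subspace_V] by (simp add: V2_def)
  have image: "g ` (M \<inter> U2) = V2 \<inter> g ` U2"
  proof (intro equalityI subsetI)
    fix w assume "w \<in> g ` (M \<inter> U2)"
    then obtain y where y: "y \<in> M" "y \<in> U2" "w = g y" by blast
    then have x: "sgn y \<in> S" "sgn y \<in> U" and r: "0 < norm y" and F: "F y \<in> U'"
      using M_iff by (auto simp: U2_def E_def)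
    have PF: "P (F y) = \<Phi> (sgn y)" "\<tau> (F y) = norm y"
      using \<tau>_ve P_ve \<Phi>_in_V[OF x] by (auto simp: F_def)
    then have "G (F y) = y"
      using \<Psi>_\<Phi>[OF x(2)] norm_scaleR_sgn[of y] by (simp add: G_def)
    then have "w = F y"
      using g(7)[OF F] y(3) by simp
    then have "w \<in> V2"
      using V2_iff PF \<Phi>_in_V[OF x] by simp
    then show "w \<in> V2 \<inter> g ` U2"
      using y by blast
  next
    fix w assume w: "w \<in> V2 \<inter> g ` U2"
    then have "w \<in> U'" "G w \<in> U2" "P w \<in> V"
      using g_U2 V2_iff by auto
    moreover have "0 < \<tau> w" "P w \<in> \<Phi> ` U"
      using \<open>w \<in> U'\<close> g(2) by (auto simp: D_def)
    ultimately have "G w \<in> M"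
      unfolding G_def using \<Psi>_in_M scaleR_S_in_M by blast
    then show "w \<in> g ` (M \<inter> U2)"
      using \<open>w \<in> U'\<close> \<open>G w \<in> U2\<close> g(7) by (metis IntI image_eqI)
  qed
  have "C2_chart (Suc m) M U2 g G V2"
    unfolding C2_chart_def
  proof (intro conjI ballI)
    show "C2_on U2 g"
      by (rule C2_on_subset[OF g(9)]) (auto simp: U2_def)
    show "C2_on (g ` U2) G"
      by (rule C2_on_subset[OF C2_G]) (use g_U2 g(2) in auto)
    show "G (g y) = y" if "y \<in> U2" for y
      using that g(8) by (simp add: U2_def)
    show "subspace V2"
      by (simp add: V2_def)
  qed fact+
  then show "\<exists>U \<Phi> \<Psi> V. p \<in> U \<and> C2_chart (Suc m) M U \<Phi> \<Psi> V"
    using p_U2 by blast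
qed

section \<open>Tangent and normal spaces of the cone\<close>

definition tpart :: "'a \<Rightarrow> 'a \<Rightarrow> 'a" where "tpart x w = w - (x \<bullet> w) *\<^sub>R x"

lemma linear_tpart: "linear (tpart x)"
  by (auto simp: tpart_def linear_iff inner_add_right algebra_simps)

lemma radial_curve:
  assumes "y \<in> M"
  shows "open {- norm y<..}" "0 \<in> {- norm y<..}" "t \<in> {- norm y<..} \<Longrightarrow> y + t *\<^sub>R sgn y \<in> M"
    "t \<in> {- norm y<..} \<Longrightarrow> sgn (y + t *\<^sub>R sgn y) = sgn y"
proof -
  show "open {- norm y<..}" "0 \<in> {- norm y<..}"
    using assms by auto
  assume t: "t \<in> {- norm y<..}"
  have y: "y \<noteq> 0" "sgn y \<in> S"
    using assms M_iff by auto
  have eq: "y + t *\<^sub>R sgn y = (norm y + t) *\<^sub>R sgn y"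
    by (simp add: scaleR_add_left norm_scaleR_sgn)
  show "y + t *\<^sub>R sgn y \<in> M"
    unfolding eq by (rule scaleR_S_in_M) (use t y in auto)
  show "sgn (y + t *\<^sub>R sgn y) = sgn y"
    unfolding eq by (rule sgn_scaleR_sphere) (use t y norm_S in auto)
qed

lemma radial_in_tangent_space: "y \<in> M \<Longrightarrow> sgn y \<in> tangent_space M y"
  by (rule tangent_spaceI[OF radial_curve(1-3)]) (auto intro: has_vector_derivative_line)

text \<open>Dividing the time by \<open>norm y\<close> compensates for the dilation, so the velocity
  is still \<open>u\<close>. The angular curve is slowed down by the same factor, which is where the
  factor 1/r of the second fundamental form comes from.\<close>

lemma scaled_curve:
  assumes y: "y \<in> M" and \<gamma>: "\<And>t. \<gamma> t \<in> S" "\<gamma> 0 = sgn y" "(\<gamma> has_vector_derivative u) (at (0::real))"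
  shows "norm y *\<^sub>R \<gamma> (t / norm y) \<in> M" "sgn (norm y *\<^sub>R \<gamma> (t / norm y)) = \<gamma> (t / norm y)"
    "((\<lambda>t. norm y *\<^sub>R \<gamma> (t / norm y)) has_vector_derivative u) (at 0)"
proof -
  have r: "0 < norm y" using y by auto
  show "norm y *\<^sub>R \<gamma> (t / norm y) \<in> M" "sgn (norm y *\<^sub>R \<gamma> (t / norm y)) = \<gamma> (t / norm y)"
    using scaleR_S_in_M[OF \<gamma>(1) r] sgn_scaleR_sphere[OF r norm_S[OF \<gamma>(1)]] by auto
  have "((\<lambda>t. t / norm y) has_vector_derivative 1 / norm y) (at 0)"
    using r by (auto simp: has_real_derivative_iff_has_vector_derivative[symmetric] intro!: derivative_eq_intros)
  from vector_diff_chain_at[OF this, of \<gamma> u] \<gamma>(3)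
  have "((\<lambda>t. \<gamma> (t / norm y)) has_vector_derivative (1 / norm y) *\<^sub>R u) (at 0)"
    by (simp add: o_def)
  from has_vector_derivative_scaleR[OF DERIV_const[of "norm y"] this] r
  show "((\<lambda>t. norm y *\<^sub>R \<gamma> (t / norm y)) has_vector_derivative u) (at 0)"
    by simp
qed

lemma tangent_space_S_subset: "y \<in> M \<Longrightarrow> tangent_space S (sgn y) \<subseteq> tangent_space M y"
proof
  fix u assume y: "y \<in> M" and "u \<in> tangent_space S (sgn y)"
  then obtain \<gamma> where \<gamma>: "\<And>t. \<gamma> t \<in> S" "\<gamma> 0 = sgn y" "(\<gamma> has_vector_derivative u) (at (0::real))"
    using tangent_spaceE by metis
  show "u \<in> tangent_space M y"
    by (rule tangent_spaceI[of UNIV "\<lambda>t. norm y *\<^sub>R \<gamma> (t / norm y)"])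
       (use scaled_curve[OF y \<gamma>] \<gamma>(2) norm_scaleR_sgn[of y] in auto)
qed

text \<open>A dimension count: the radial direction and the tangent space of \<open>S\<close> span
  \<open>Suc m\<close> dimensions inside the tangent space of the cone, which has dimension
  \<open>Suc m\<close> by \<open>cone_C2_submanifold\<close>.\<close>

lemma tangent_space_cone:
  assumes y: "y \<in> M"
  shows "w \<in> tangent_space M y \<longleftrightarrow> tpart (sgn y) w \<in> tangent_space S (sgn y)"
proof -
  let ?x = "sgn y" and ?T = "tangent_space S (sgn y)"
  have x: "?x \<in> S" using y M_iff by auto
  have T: "subspace ?T" "dim ?T = m"
    using subspace_tangent_space[OF S x] dim_tangent_space[OF S x] by auto
  have TM: "subspace (tangent_space M y)" "dim (tangent_space M y) = Suc m"
    using subspace_tangent_space[OF cone_C2_submanifold y] dim_tangent_space[OF cone_C2_submanifold y] by auto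
  have "?x \<notin> ?T"
    using tangent_space_S_sphere[OF x] norm_S[OF x] by (auto simp: norm_eq_1)
  then have "dim (span (insert ?x ?T)) = Suc m"
    using dim_insert[of ?x ?T] T span_eq_iff[THEN iffD2, OF T(1)] by simp
  moreover have "span (insert ?x ?T) \<subseteq> tangent_space M y"
    using radial_in_tangent_space[OF y] tangent_space_S_subset[OF y] TM(1) by (intro span_minimal) auto
  ultimately have eq: "span (insert ?x ?T) = tangent_space M y"
    using TM by (intro subspace_dim_equal) auto
  have ortho: "?x \<bullet> v = 0" if "v \<in> ?T" for v
    using tangent_space_S_sphere[OF x] that by auto
  show ?thesis
  proof
    assume "w \<in> tangent_space M y"
    then obtain c where c: "w - c *\<^sub>R ?x \<in> ?T"
      using span_breakdown_eq[of w ?x ?T] eq span_eq_iff[THEN iffD2, OF T(1)] by auto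
    then have "?x \<bullet> w = c"
      using ortho[OF c] norm_S[OF x] by (simp add: inner_diff_right norm_eq_1)
    then show "tpart ?x w \<in> ?T"
      using c by (simp add: tpart_def)
  next
    assume "tpart ?x w \<in> ?T"
    then show "w \<in> tangent_space M y"
      using span_breakdown_eq[of w ?x ?T] eq span_eq_iff[THEN iffD2, OF T(1)] by (auto simp: tpart_def)
  qed
qed

text \<open>Both sides consist of the vectors orthogonal to \<open>sgn y\<close> and to the tangent
  space of \<open>S\<close>. In particular the normal space depends on \<open>y\<close> only through
  \<open>sgn y\<close>, hence is constant along rays.\<close>

lemma normal_space_cone:
  assumes y: "y \<in> M"
  shows "normal_space UNIV M y = normal_space (sphere 0 1) S (sgn y)"
proof -
  let ?x = "sgn y" and ?T = "tangent_space S (sgn y)"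
  have x: "?x \<in> S" using y M_iff by auto
  have "(\<forall>v\<in>tangent_space M y. w \<bullet> v = 0) \<longleftrightarrow> ?x \<bullet> w = 0 \<and> (\<forall>v\<in>?T. w \<bullet> v = 0)" for w
  proof (intro iffI conjI ballI)
    assume *: "\<forall>v\<in>tangent_space M y. w \<bullet> v = 0"
    show "w \<bullet> v = 0" if "v \<in> ?T" for v
      using * tangent_space_S_subset[OF y] that by auto
    show "?x \<bullet> w = 0"
      using * radial_in_tangent_space[OF y] by (auto simp: inner_commute)
  next
    fix v assume *: "?x \<bullet> w = 0 \<and> (\<forall>v\<in>?T. w \<bullet> v = 0)" and "v \<in> tangent_space M y"
    then have "w \<bullet> tpart ?x v = 0"
      using tangent_space_cone[OF y] by auto
    then show "w \<bullet> v = 0"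
      using * by (simp add: tpart_def inner_diff_right inner_commute)
  qed
  then show ?thesis
    unfolding normal_space_def tangent_space_sphere[OF norm_S[OF x]] by auto
qed

text \<open>\<open>v\<close> is extended by a field that is constant along rays: its radial
  derivative vanishes, and along a curve in \<open>S\<close> scaled to radius r the chain rule
  yields 1/r. The additional term \<open>(x \<bullet> v) *\<^sub>R ?u\<close> is tangent and
  disappears under the normal projection.\<close>

lemma second_ff_cone:
  assumes y: "y \<in> M" and u: "u \<in> tangent_space M y" and v: "v \<in> tangent_space M y"
  shows "second_ff UNIV M y u v =
    (1 / norm y) *\<^sub>R second_ff (sphere 0 1) S (sgn y) (tpart (sgn y) u) (tpart (sgn y) v)"
proof -
  define x where "x = sgn y"
  let ?u = "tpart x u" and ?v = "tpart x v" and ?N = "normal_space (sphere 0 1) S x"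
  have x: "x \<in> S" and y0: "y \<noteq> 0" using y M_iff by (auto simp: x_def)
  have r: "0 < norm y" using y0 by simp
  have u': "?u \<in> tangent_space S x" and v': "?v \<in> tangent_space S x"
    using tangent_space_cone[OF y] u v by (auto simp: x_def)
  obtain W where W: "tangent_extension S x ?v W"
    using tangent_extension_exists[OF S x] u' v' by metis
  then obtain O1 where O1: "open O1" "x \<in> O1" "tangent_field (S \<inter> O1) W" "W x = ?v"
    unfolding tangent_extension_def by blast
  let ?E = "\<lambda>O'. {z. z \<noteq> 0 \<and> sgn z \<in> O'}"
  have open_E: "open (?E O')" if "open O'" for O' :: "'a set"
  proof -
    have "?E O' = (- {0}) \<inter> sgn -` O'" by auto
    moreover have "continuous_on (- {0}) (sgn :: 'a \<Rightarrow> 'a)"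
      by (rule C1_on_continuous_on[OF C1_on_sgn]) simp
    ultimately show ?thesis
      using continuous_open_preimage[OF _ _ that, of "- {0}" sgn] open_Compl[OF closed_singleton, of 0] by simp
  qed
  \<comment> \<open>The first summand extends the part of \<open>v\<close> tangent to
    \<open>S\<close>, the second its radial part; both depend on \<open>z\<close> only through
    \<open>sgn z\<close>.\<close>
  define Z where "Z z = W (sgn z) + (x \<bullet> v) *\<^sub>R sgn z" for z
  have Z_field: "tangent_field (M \<inter> ?E O1) Z"
    unfolding tangent_field_def
  proof
    show "C1_field (M \<inter> ?E O1) Z"
      unfolding C1_field_def
    proof
      fix z assume z: "z \<in> M \<inter> ?E O1"
      then have "sgn z \<in> S \<inter> O1" "z \<noteq> 0" using M_iff by auto
      with O1(3) obtain U Y where U: "open U" "sgn z \<in> U" "C1_on U Y" "\<And>q. q \<in> S \<inter> O1 \<inter> U \<Longrightarrow> Y q = W q"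
        using C1_fieldE[of "S \<inter> O1" W "sgn z"] unfolding tangent_field_def by metis
      have sg: "C1_on (?E U) (sgn :: 'a \<Rightarrow> 'a)"
        by (rule C1_on_sgn) simp
      have "C1_on (?E U) (\<lambda>q. Y (sgn q) + (x \<bullet> v) *\<^sub>R sgn q)"
        by (intro C1_on_add C1_on_scaleR C1_on_const sg C1_on_compose[OF sg U(3)]) auto
      moreover have "\<forall>q\<in>M \<inter> ?E O1 \<inter> ?E U. Y (sgn q) + (x \<bullet> v) *\<^sub>R sgn q = Z q"
        using U(4) M_iff by (auto simp: Z_def)
      ultimately show "\<exists>U' Y. open U' \<and> z \<in> U' \<and> C1_on U' Y \<and> (\<forall>q\<in>M \<inter> ?E O1 \<inter> U'. Y q = Z q)"
        using open_E[OF U(1)] U(2) \<open>z \<noteq> 0\<close>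
        by (intro exI[of _ "?E U"] exI[of _ "\<lambda>q. Y (sgn q) + (x \<bullet> v) *\<^sub>R sgn q"]) auto
    qed
    show "\<forall>z\<in>M \<inter> ?E O1. Z z \<in> tangent_space (M \<inter> ?E O1) z"
    proof
      fix z assume z: "z \<in> M \<inter> ?E O1"
      then have "W (sgn z) \<in> tangent_space S (sgn z)"
        using tangent_field_Int_openD[OF O1(3,1)] M_iff by auto
      then have "Z z \<in> tangent_space M z"
        unfolding Z_def using z tangent_space_S_subset radial_in_tangent_space subspace_tangent_space[OF cone_C2_submanifold]
        by (intro subspace_add subspace_scale) auto
      then show "Z z \<in> tangent_space (M \<inter> ?E O1) z"
        using tangent_space_Int_open[OF open_E[OF O1(1)]] z by auto
    qed
  qed
  have "Z y = v"
    using O1(4) by (simp add: Z_def x_def[symmetric] tpart_def)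
  then have Z_ext: "tangent_extension M y v Z"
    unfolding tangent_extension_def using Z_field open_E[OF O1(1)] O1(2) y0 
    by (auto simp: x_def)
  have Z_diff: "Z differentiable (at y within M)"
    by (rule C1_field_Int_open_differentiable[OF _ y _ open_E[OF O1(1)]])
       (use Z_field O1(2) y0 in \<open>auto simp: tangent_field_def x_def\<close>)
  have W_diff: "W differentiable (at x within S)"
    by (rule C1_field_Int_open_differentiable[OF _ x O1(2,1)]) (use O1(3) in \<open>auto simp: tangent_field_def\<close>)
  have radial: "flat_deriv M Z y x = 0"
  proof (rule flat_deriv_eqI[OF Z_diff radial_curve(1-3)[OF y]])
    show "((\<lambda>t. y + t *\<^sub>R sgn y) has_vector_derivative x) (at 0)"
      by (simp add: x_def has_vector_derivative_line)
    show "((\<lambda>t. Z (y + t *\<^sub>R sgn y)) has_vector_derivative 0) (at 0)"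
      by (rule has_vector_derivative_transform_within_open[OF has_vector_derivative_const[of "Z y"] radial_curve(1,2)[OF y]])
         (simp add: Z_def radial_curve(4)[OF y])
  qed auto
  obtain \<gamma> where \<gamma>: "\<And>t. \<gamma> t \<in> S" "\<gamma> 0 = x" "(\<gamma> has_vector_derivative ?u) (at (0::real))"
    using tangent_spaceE[OF u'] by metis
  have tangential: "flat_deriv M Z y ?u = (1 / norm y) *\<^sub>R (flat_deriv S W x ?u + (x \<bullet> v) *\<^sub>R ?u)"
  proof (rule flat_deriv_eqI[OF Z_diff open_UNIV UNIV_I])
    note sc = scaled_curve[OF y \<gamma>(1) \<gamma>(2)[unfolded x_def] \<gamma>(3)]
    show "norm y *\<^sub>R \<gamma> (t / norm y) \<in> M" for t
      by (rule sc(1))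
    show "((\<lambda>t. norm y *\<^sub>R \<gamma> (t / norm y)) has_vector_derivative ?u) (at 0)"
      by (rule sc(3))
    show "norm y *\<^sub>R \<gamma> (0 / norm y) = y"
      using \<gamma>(2) norm_scaleR_sgn[of y] by (simp add: x_def)
    have "((\<lambda>t. W (\<gamma> t) + (x \<bullet> v) *\<^sub>R \<gamma> t) has_vector_derivative flat_deriv S W x ?u + (x \<bullet> v) *\<^sub>R ?u) (at 0)"
      using has_vector_derivative_add[OF flat_deriv_curve[OF W_diff \<gamma>]
          has_vector_derivative_scaleR[OF DERIV_const[of "x \<bullet> v"] \<gamma>(3)]] by simp
    moreover have "((\<lambda>t. t / norm y) has_vector_derivative 1 / norm y) (at 0)"
      using r by (auto simp: has_real_derivative_iff_has_vector_derivative[symmetric] intro!: derivative_eq_intros)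
    ultimately have "((\<lambda>t. W (\<gamma> (t / norm y)) + (x \<bullet> v) *\<^sub>R \<gamma> (t / norm y)) has_vector_derivative
        (1 / norm y) *\<^sub>R (flat_deriv S W x ?u + (x \<bullet> v) *\<^sub>R ?u)) (at 0)"
      using vector_diff_chain_at[of "\<lambda>t. t / norm y" "1 / norm y" 0 "\<lambda>t. W (\<gamma> t) + (x \<bullet> v) *\<^sub>R \<gamma> t"]
      by (simp add: o_def)
    then show "((\<lambda>t. Z (norm y *\<^sub>R \<gamma> (t / norm y))) has_vector_derivative
        (1 / norm y) *\<^sub>R (flat_deriv S W x ?u + (x \<bullet> v) *\<^sub>R ?u)) (at 0)"
      by (simp add: Z_def sc(2))
  qed
  have subT: "subspace (tangent_space (sphere 0 1) x)"
    by (rule subspace_tangent_space_sphere[OF x])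
  have subN: "subspace ?N"
    by (rule subspace_normal_space[OF subT])
  have "flat_deriv M Z y u = flat_deriv M Z y (?u + (x \<bullet> u) *\<^sub>R x)"
    by (simp add: tpart_def)
  also have "\<dots> = (1 / norm y) *\<^sub>R (flat_deriv S W x ?u + (x \<bullet> v) *\<^sub>R ?u)"
    using linear_flat_deriv[OF Z_diff] radial tangential by (simp add: linear_add linear_cmul)
  finally have "oproj ?N (flat_deriv M Z y u) =
      (1 / norm y) *\<^sub>R (oproj ?N (flat_deriv S W x ?u) + (x \<bullet> v) *\<^sub>R oproj ?N ?u)"
    using linear_oproj[OF subN] by (simp add: linear_add linear_cmul scaleR_add_right)
  moreover have "oproj ?N ?u = 0"
    using u' by (intro oproj_eq_0[OF subN]) (auto simp: normal_space_def inner_commute)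
  moreover have "second_ff UNIV M y u v = oproj (normal_space UNIV M y) (flat_deriv M Z y u)"
    by (rule second_ff_eq[OF cone_C2_submanifold y _ _ Z_ext u]) auto
  moreover have "second_ff (sphere 0 1) S x ?u ?v = oproj ?N (flat_deriv S W x ?u)"
    by (rule second_ff_eq[OF S x S_sphere subT W u'])
  ultimately show ?thesis
    using normal_space_cone[OF y] by (simp add: x_def)
qed

text \<open>An adapted replacement for the uncontrolled choice
  \<open>onb (tangent_space M y)\<close>: it isolates the direction in which the second fundamental
  form vanishes.\<close>

lemma orthonormal_basis_of_tangent_space_cone:
  assumes y: "y \<in> M"
  shows "orthonormal_basis_of (tangent_space M y) (insert (sgn y) (onb (tangent_space S (sgn y))))"
    "sgn y \<notin> onb (tangent_space S (sgn y))"
proof -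
  let ?x = "sgn y" and ?T = "tangent_space S (sgn y)"
  have x: "?x \<in> S" using y M_iff by auto
  have E: "orthonormal_basis_of ?T (onb ?T)"
    by (rule orthonormal_basis_of_onb[OF subspace_tangent_space[OF S x]])
  have ortho: "?x \<bullet> v = 0" if "v \<in> onb ?T" for v
    using tangent_space_S_sphere[OF x] that E by (auto simp: orthonormal_basis_of_def)
  show "?x \<notin> onb ?T"
    using ortho norm_S[OF x] by (auto simp: norm_eq_1)
  have "span (insert ?x (onb ?T)) = tangent_space M y"
  proof (intro equalityI subsetI)
    fix w
    show "w \<in> tangent_space M y" if "w \<in> span (insert ?x (onb ?T))"
      using that radial_in_tangent_space[OF y] tangent_space_S_subset[OF y] E
        span_minimal[OF _ subspace_tangent_space[OF cone_C2_submanifold y], of "insert ?x (onb ?T)"]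
      by (auto simp: orthonormal_basis_of_def)
    show "w \<in> span (insert ?x (onb ?T))" if "w \<in> tangent_space M y"
      using that tangent_space_cone[OF y, of w] span_breakdown_eq[of w ?x "onb ?T"] E
      by (auto simp: orthonormal_basis_of_def tpart_def)
  qed
  then show "orthonormal_basis_of (tangent_space M y) (insert ?x (onb ?T))"
    using E radial_in_tangent_space[OF y] tangent_space_S_subset[OF y] norm_S[OF x] ortho
    by (auto simp: orthonormal_basis_of_def pairwise_insert orthogonal_def inner_commute)
qed

text \<open>The basis-change lemmas want a map that is bilinear on the whole ambient space, while
  \<open>second_ff\<close> is controlled only on tangent vectors. Composing a bilinear
  representative on \<open>S\<close> with \<open>tpart\<close> provides one that annihilates the
  radial direction.\<close>

lemma second_ff_cone_bilinear:
  assumes y: "y \<in> M"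
  obtains \<beta> where "bilinear \<beta>"
    "\<And>u v. u \<in> tangent_space M y \<Longrightarrow> v \<in> tangent_space M y \<Longrightarrow> second_ff UNIV M y u v = \<beta> u v"
    "\<And>u. \<beta> (sgn y) u = 0" "\<And>u. \<beta> u (sgn y) = 0"
    "\<And>u v. u \<in> tangent_space S (sgn y) \<Longrightarrow> v \<in> tangent_space S (sgn y) \<Longrightarrow>
      \<beta> u v = (1 / norm y) *\<^sub>R second_ff (sphere 0 1) S (sgn y) u v"
proof -
  let ?x = "sgn y" and ?T = "tangent_space S (sgn y)"
  have x: "?x \<in> S" using y M_iff by auto
  obtain \<alpha> where \<alpha>: "bilinear \<alpha>"
    "\<And>u v. u \<in> ?T \<Longrightarrow> v \<in> ?T \<Longrightarrow> second_ff (sphere 0 1) S ?x u v = \<alpha> u v"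
    using second_ff_bilinear[OF S x S_sphere subspace_tangent_space_sphere[OF x]] by metis
  have tx: "tpart ?x ?x = 0"
    using norm_S[OF x] by (simp add: tpart_def norm_eq_1)
  have tT: "tpart ?x u = u" if "u \<in> ?T" for u
    using tangent_space_S_sphere[OF x] that by (auto simp: tpart_def)
  show thesis
  proof
    have "linear (\<lambda>v. (1 / norm y) *\<^sub>R \<alpha> u (tpart ?x v))" "linear (\<lambda>v. (1 / norm y) *\<^sub>R \<alpha> (tpart ?x v) u)" for u
      using \<alpha>(1) linear_tpart[of ?x] by (auto simp: bilinear_def linear_iff scaleR_add_right)
    then show "bilinear (\<lambda>u v. (1 / norm y) *\<^sub>R \<alpha> (tpart ?x u) (tpart ?x v))"
      by (simp add: bilinear_def)
    show "second_ff UNIV M y u v = (1 / norm y) *\<^sub>R \<alpha> (tpart ?x u) (tpart ?x v)"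
      if "u \<in> tangent_space M y" "v \<in> tangent_space M y" for u v
      using second_ff_cone[OF y that] \<alpha>(2) tangent_space_cone[OF y] that by simp
    show "(1 / norm y) *\<^sub>R \<alpha> (tpart ?x ?x) (tpart ?x u) = 0" "(1 / norm y) *\<^sub>R \<alpha> (tpart ?x u) (tpart ?x ?x) = 0" for u
      using \<alpha>(1) tx by (simp_all add: bilinear_lzero bilinear_rzero)
    show "(1 / norm y) *\<^sub>R \<alpha> (tpart ?x u) (tpart ?x v) = (1 / norm y) *\<^sub>R second_ff (sphere 0 1) S ?x u v"
      if "u \<in> ?T" "v \<in> ?T" for u v
      using that tT \<alpha>(2) by simp
  qed
qed

lemma mean_curv_cone:
  assumes y: "y \<in> M"
  shows "mean_curv UNIV M y = (1 / norm y) *\<^sub>R mean_curv (sphere 0 1) S (sgn y)"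
proof -
  let ?x = "sgn y" and ?T = "tangent_space S (sgn y)" and ?TM = "tangent_space M y"
  have x: "?x \<in> S" using y M_iff by auto
  obtain \<beta> where \<beta>: "bilinear \<beta>"
    "\<And>u v. u \<in> ?TM \<Longrightarrow> v \<in> ?TM \<Longrightarrow> second_ff UNIV M y u v = \<beta> u v"
    "\<And>u. \<beta> ?x u = 0" "\<And>u. \<beta> u ?x = 0"
    "\<And>u v. u \<in> ?T \<Longrightarrow> v \<in> ?T \<Longrightarrow> \<beta> u v = (1 / norm y) *\<^sub>R second_ff (sphere 0 1) S ?x u v"
    using second_ff_cone_bilinear[OF y] by metis
  have E: "orthonormal_basis_of ?T (onb ?T)" and EM: "orthonormal_basis_of ?TM (onb ?TM)"
    using orthonormal_basis_of_onb subspace_tangent_space[OF S x] subspace_tangent_space[OF cone_C2_submanifold y] by blast+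
  have "mean_curv UNIV M y = (\<Sum>u\<in>onb ?TM. \<beta> u u)"
    unfolding mean_curv_def using \<beta>(2) EM by (intro sum.cong) (auto simp: orthonormal_basis_of_def)
  also have "\<dots> = (\<Sum>u\<in>insert ?x (onb ?T). \<beta> u u)"
    using trace_orthonormal_basis[OF EM \<beta>(1)]
      trace_orthonormal_basis[OF orthonormal_basis_of_tangent_space_cone(1)[OF y] \<beta>(1)] by simp
  also have "\<dots> = (\<Sum>u\<in>onb ?T. \<beta> u u)"
    using orthonormal_basis_of_tangent_space_cone(2)[OF y] orthonormal_basis_of_finite[OF E] \<beta>(3) by simp
  also have "\<dots> = (\<Sum>u\<in>onb ?T. (1 / norm y) *\<^sub>R second_ff (sphere 0 1) S ?x u u)"
    using \<beta>(5) E by (intro sum.cong) (auto simp: orthonormal_basis_of_def)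
  finally show ?thesis
    by (simp add: mean_curv_def scaleR_sum_right)
qed

text \<open>Cauchy-Schwarz in each summand forgets the direction of \<open>X\<close>; in the adapted
  basis only directions of \<open>S\<close> survive, each squared entry carrying a factor
  \<open>1 / (norm y)\<^sup>2\<close>.\<close>

lemma sum_second_ff_cone_le:
  assumes y: "y \<in> M"
  shows "(\<Sum>u\<in>onb (tangent_space M y). \<Sum>v\<in>onb (tangent_space M y). (second_ff UNIV M y u v \<bullet> X)\<^sup>2)
    \<le> second_ff_normsq (sphere 0 1) S (sgn y) * (norm X)\<^sup>2 / (norm y)\<^sup>2"
proof -
  let ?x = "sgn y" and ?T = "tangent_space S (sgn y)" and ?TM = "tangent_space M y"
  have x: "?x \<in> S" using y M_iff by auto
  obtain \<beta> where \<beta>: "bilinear \<beta>"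
    "\<And>u v. u \<in> ?TM \<Longrightarrow> v \<in> ?TM \<Longrightarrow> second_ff UNIV M y u v = \<beta> u v"
    "\<And>u. \<beta> ?x u = 0" "\<And>u. \<beta> u ?x = 0"
    "\<And>u v. u \<in> ?T \<Longrightarrow> v \<in> ?T \<Longrightarrow> \<beta> u v = (1 / norm y) *\<^sub>R second_ff (sphere 0 1) S ?x u v"
    using second_ff_cone_bilinear[OF y] by metis
  have E: "orthonormal_basis_of ?T (onb ?T)" and EM: "orthonormal_basis_of ?TM (onb ?TM)"
    using orthonormal_basis_of_onb subspace_tangent_space[OF S x] subspace_tangent_space[OF cone_C2_submanifold y] by blast+
  have "(second_ff UNIV M y u v \<bullet> X)\<^sup>2 \<le> (norm (\<beta> u v))\<^sup>2 * (norm X)\<^sup>2" if "u \<in> onb ?TM" "v \<in> onb ?TM" for u v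
  proof -
    have "second_ff UNIV M y u v = \<beta> u v"
      using \<beta>(2) EM that by (auto simp: orthonormal_basis_of_def)
    moreover have "\<bar>\<beta> u v \<bullet> X\<bar>\<^sup>2 \<le> (norm (\<beta> u v) * norm X)\<^sup>2"
      by (intro power_mono Cauchy_Schwarz_ineq2 abs_ge_zero)
    ultimately show ?thesis
      by (simp add: power_mult_distrib)
  qed
  then have "(\<Sum>u\<in>onb ?TM. \<Sum>v\<in>onb ?TM. (second_ff UNIV M y u v \<bullet> X)\<^sup>2)
      \<le> (\<Sum>u\<in>onb ?TM. \<Sum>v\<in>onb ?TM. (norm (\<beta> u v))\<^sup>2 * (norm X)\<^sup>2)"
    by (intro sum_mono) auto
  also have "\<dots> = (\<Sum>u\<in>onb ?TM. \<Sum>v\<in>onb ?TM. (norm (\<beta> u v))\<^sup>2) * (norm X)\<^sup>2"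
    by (simp add: sum_distrib_right)
  also have "(\<Sum>u\<in>onb ?TM. \<Sum>v\<in>onb ?TM. (norm (\<beta> u v))\<^sup>2) =
      (\<Sum>u\<in>insert ?x (onb ?T). \<Sum>v\<in>insert ?x (onb ?T). (norm (\<beta> u v))\<^sup>2)"
    by (rule sum_norm_bilinear_orthonormal_basis[OF EM orthonormal_basis_of_tangent_space_cone(1)[OF y] \<beta>(1)])
  also have "\<dots> = (\<Sum>u\<in>onb ?T. \<Sum>v\<in>onb ?T. (norm (\<beta> u v))\<^sup>2)"
    using orthonormal_basis_of_tangent_space_cone(2)[OF y] orthonormal_basis_of_finite[OF E] \<beta>(3,4) by simp
  also have "\<dots> = (\<Sum>u\<in>onb ?T. \<Sum>v\<in>onb ?T. (norm (second_ff (sphere 0 1) S ?x u v))\<^sup>2 / (norm y)\<^sup>2)"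
    using \<beta>(5) E by (intro sum.cong refl) (auto simp: orthonormal_basis_of_def subset_iff power_divide)
  also have "\<dots> = second_ff_normsq (sphere 0 1) S ?x / (norm y)\<^sup>2"
    by (simp add: second_ff_normsq_def sum_divide_distrib)
  finally show ?thesis
    by simp
qed

end


section \<open>Hausdorff measure\<close>

lemma hausdorff_pre_mono: "A \<subseteq> B \<Longrightarrow> hausdorff_pre d \<delta> A \<le> hausdorff_pre d \<delta> B"
  unfolding hausdorff_pre_def by (rule INF_superset_mono) auto

lemma hausdorff_outer_mono: "A \<subseteq> B \<Longrightarrow> hausdorff_outer d A \<le> hausdorff_outer d B"
  unfolding hausdorff_outer_def by (rule SUP_mono) (use hausdorff_pre_mono in blast)

section \<open>Hausdorff measure under dilations\<close>

lemma bounded_diameter_scaleR: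
  fixes C :: "'a::real_normed_vector set"
  assumes "0 \<le> c" "bounded C"
  shows "bounded ((*\<^sub>R) c ` C)" "diameter ((*\<^sub>R) c ` C) \<le> c * diameter C"
proof -
  show "bounded ((*\<^sub>R) c ` C)"
    using assms(2) by (rule bounded_scaling)
  show "diameter ((*\<^sub>R) c ` C) \<le> c * diameter C"
  proof (rule diameter_le)
    show "(*\<^sub>R) c ` C \<noteq> {} \<or> 0 \<le> c * diameter C"
      using diameter_ge_0[OF assms(2)] assms(1) by simp
    fix x y assume "x \<in> (*\<^sub>R) c ` C" "y \<in> (*\<^sub>R) c ` C"
    then obtain x' y' where "x' \<in> C" "y' \<in> C" "x = c *\<^sub>R x'" "y = c *\<^sub>R y'" by blast
    moreover from this have "norm (x' - y') \<le> diameter C"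
      using diameter_bounded_bound[OF assms(2)] by (simp add: dist_norm)
    ultimately show "norm (x - y) \<le> c * diameter C"
      using assms(1) by (simp add: scaleR_diff_right[symmetric] mult_left_mono)
  qed
qed

lemma hausdorff_pre_scaleR_le:
  fixes A :: "'a::real_normed_vector set"
  assumes c: "0 < c"
  shows "hausdorff_pre d (c * \<delta>) ((*\<^sub>R) c ` A) \<le> ennreal (c ^ d) * hausdorff_pre d \<delta> A"
proof -
  let ?w = "\<lambda>C. if C = {} then 0 else ennreal (unit_ball_vol (real d) * (diameter C / 2) ^ d)"
  let ?H = "hausdorff_pre d (c * \<delta>) ((*\<^sub>R) c ` A)"
  have cd: "ennreal (inverse (c ^ d)) * ennreal (c ^ d) = 1" "ennreal (c ^ d) * ennreal (inverse (c ^ d)) = 1"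
    using c by (simp_all flip: ennreal_mult)
  have le: "?H \<le> ennreal (c ^ d) * (\<Sum>i. ?w (C i))"
    if C: "A \<subseteq> (\<Union>i. C i)" "\<And>i. bounded (C i) \<and> diameter (C i) \<le> \<delta>" for C :: "nat \<Rightarrow> 'a set"
  proof -
    let ?C = "\<lambda>i. (*\<^sub>R) c ` C i"
    have "diameter (?C i) \<le> c * \<delta>" for i
      using bounded_diameter_scaleR(2)[of c "C i"] C(2)[of i] c
      by (meson less_imp_le mult_left_mono order_trans)
    moreover have "(*\<^sub>R) c ` A \<subseteq> (\<Union>i. ?C i)"
      using C(1) by blast
    ultimately have "?H \<le> (\<Sum>i. ?w (?C i))"
      unfolding hausdorff_pre_def using C(2) c
      by (intro INF_lower) (auto intro: bounded_diameter_scaleR(1))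
    also have "\<dots> \<le> (\<Sum>i. ennreal (c ^ d) * ?w (C i))"
    proof (intro suminf_le summableI)
      fix i
      have b: "bounded (?C i)" "0 \<le> diameter (?C i)" "diameter (?C i) \<le> c * diameter (C i)"
        using bounded_diameter_scaleR[of c "C i"] C(2)[of i] c diameter_ge_0 by auto
      have "(diameter (?C i) / 2) ^ d \<le> (c * diameter (C i) / 2) ^ d"
        using b by (intro power_mono) auto
      then have "unit_ball_vol (real d) * (diameter (?C i) / 2) ^ d \<le> c ^ d * (unit_ball_vol (real d) * (diameter (C i) / 2) ^ d)"
        using mult_left_mono[of _ _ "unit_ball_vol (real d)"] by (fastforce simp: power_mult_distrib power_divide algebra_simps)
      then show "?w (?C i) \<le> ennreal (c ^ d) * ?w (C i)"
        using c by (auto simp flip: ennreal_mult' intro!: ennreal_leI)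
    qed
    also have "\<dots> = ennreal (c ^ d) * (\<Sum>i. ?w (C i))"
      by (rule ennreal_suminf_cmult)
    finally show ?thesis .
  qed
  \<comment> \<open>The factor is moved to the left so that the infimum over covers stands alone on
    the right; it is moved back afterwards.\<close>
  have "ennreal (inverse (c ^ d)) * ?H \<le> hausdorff_pre d \<delta> A"
    unfolding hausdorff_pre_def[of d \<delta> A]
  proof (rule INF_greatest)
    fix C :: "nat \<Rightarrow> 'a set" assume C: "C \<in> {C. A \<subseteq> (\<Union>i. C i) \<and> (\<forall>i. bounded (C i) \<and> diameter (C i) \<le> \<delta>)}"
    have "ennreal (inverse (c ^ d)) * ?H \<le> ennreal (inverse (c ^ d)) * (ennreal (c ^ d) * (\<Sum>i. ?w (C i)))"
      using C by (intro mult_left_mono le) auto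
    then show "ennreal (inverse (c ^ d)) * ?H \<le> (\<Sum>i. ?w (C i))"
      by (simp add: mult.assoc[symmetric] cd)
  qed
  then have "ennreal (c ^ d) * (ennreal (inverse (c ^ d)) * ?H) \<le> ennreal (c ^ d) * hausdorff_pre d \<delta> A"
    by (rule mult_left_mono) simp
  then show ?thesis
    by (simp add: mult.assoc[symmetric] cd)
qed

lemma hausdorff_outer_scaleR_le:
  fixes A :: "'a::real_normed_vector set"
  assumes c: "0 < c"
  shows "hausdorff_outer d ((*\<^sub>R) c ` A) \<le> ennreal (c ^ d) * hausdorff_outer d A"
  unfolding hausdorff_outer_def[of d "(*\<^sub>R) c ` A"]
proof (rule SUP_least)
  fix \<delta> :: real assume \<delta>: "\<delta> \<in> {0<..}"
  have "hausdorff_pre d \<delta> ((*\<^sub>R) c ` A) \<le> ennreal (c ^ d) * hausdorff_pre d (\<delta> / c) A"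
    using hausdorff_pre_scaleR_le[OF c, of d "\<delta> / c" A] c by simp
  also have "\<dots> \<le> ennreal (c ^ d) * hausdorff_outer d A"
    unfolding hausdorff_outer_def using \<delta> c by (intro mult_left_mono SUP_upper) auto
  finally show "hausdorff_pre d \<delta> ((*\<^sub>R) c ` A) \<le> ennreal (c ^ d) * hausdorff_outer d A" .
qed

lemma hausdorff_outer_scaleR:
  fixes A :: "'a::real_normed_vector set"
  assumes c: "0 < c"
  shows "hausdorff_outer d ((*\<^sub>R) c ` A) = ennreal (c ^ d) * hausdorff_outer d A"
proof (rule antisym[OF hausdorff_outer_scaleR_le[OF c]])
  have "hausdorff_outer d A = hausdorff_outer d ((*\<^sub>R) (inverse c) ` (*\<^sub>R) c ` A)"
    using c by (simp add: image_image)
  also have "\<dots> \<le> ennreal (inverse c ^ d) * hausdorff_outer d ((*\<^sub>R) c ` A)"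
    using c by (intro hausdorff_outer_scaleR_le) simp
  finally have "ennreal (c ^ d) * hausdorff_outer d A \<le>
      ennreal (c ^ d) * (ennreal (inverse c ^ d) * hausdorff_outer d ((*\<^sub>R) c ` A))"
    by (rule mult_left_mono) simp
  also have "\<dots> = hausdorff_outer d ((*\<^sub>R) c ` A)"
    using c by (simp add: mult.assoc[symmetric] ennreal_mult[symmetric] power_mult_distrib[symmetric])
  finally show "ennreal (c ^ d) * hausdorff_outer d A \<le> hausdorff_outer d ((*\<^sub>R) c ` A)" .
qed

lemma sets_hausdorff_measure [simp, measurable_cong]: "sets (hausdorff_measure d) = sets borel"
  unfolding hausdorff_measure_def by (simp add: sets_measure_of_conv sets.sigma_sets_eq[of borel, simplified])

lemma space_hausdorff_measure [simp]: "space (hausdorff_measure d) = UNIV"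
  using sets_eq_imp_space_eq[OF sets_hausdorff_measure] by simp

text \<open>
  The measure is either the outer measure on Borel sets or, should that fail to be countably
  additive, zero; the properties needed below hold in both cases.
\<close>

lemma emeasure_hausdorff_measure_cases:
  obtains "\<And>B. B \<in> sets borel \<Longrightarrow> emeasure (hausdorff_measure d) B = hausdorff_outer d (B :: 'a::metric_space set)"
  | "\<And>B :: 'a set. emeasure (hausdorff_measure d) B = 0"
  unfolding hausdorff_measure_def emeasure_measure_of_conv
  using sets.sigma_sets_eq[of "borel :: 'a measure"] by (cases "measure_space UNIV (sets borel) (hausdorff_outer d :: 'a set \<Rightarrow> ennreal)") auto

lemma image_scaleR_eq_vimage:
  fixes B :: "'a::real_vector set"
  assumes "c \<noteq> 0" shows "(*\<^sub>R) c ` B = (*\<^sub>R) (inverse c) -` B"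
proof (intro equalityI subsetI)
  fix x assume "x \<in> (*\<^sub>R) (inverse c) -` B"
  then show "x \<in> (*\<^sub>R) c ` B"
    using assms by (intro image_eqI[of _ _ "inverse c *\<^sub>R x"]) auto
qed (use assms in auto)

lemma emeasure_hausdorff_measure_scaleR:
  fixes B :: "'a::euclidean_space set"
  assumes c: "0 < c" and B: "B \<in> sets borel"
  shows "emeasure (hausdorff_measure d) ((*\<^sub>R) c ` B) = ennreal (c ^ d) * emeasure (hausdorff_measure d) B"
proof -
  have "(*\<^sub>R) c ` B = (*\<^sub>R) (inverse c) -` B \<inter> space borel"
    using c by (simp add: image_scaleR_eq_vimage)
  also have "\<dots> \<in> sets borel"
    using B by (intro measurable_sets[where A=borel]) auto
  finally have "(*\<^sub>R) c ` B \<in> sets borel" .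
  then show ?thesis
    using B hausdorff_outer_scaleR[OF c] by (cases rule: emeasure_hausdorff_measure_cases[of d, where 'a='a]) auto
qed

text \<open>The preimage of \<open>B\<close> under dilation by \<open>c\<close> is its dilate by
  \<open>inverse c\<close>, so the image measure is a constant multiple of the original one, with
  \<open>inverse c ^ d\<close> as density.\<close>

lemma integral_hausdorff_measure_scaleR:
  fixes F :: "'a::euclidean_space \<Rightarrow> real"
  assumes c: "0 < c" and F: "F \<in> borel_measurable borel"
  shows "(\<integral>x. F (c *\<^sub>R x) \<partial>hausdorff_measure d) = inverse c ^ d * (\<integral>x. F x \<partial>hausdorff_measure d)"
proof -
  let ?\<mu> = "hausdorff_measure d :: 'a measure"
  have meas: "(*\<^sub>R) c \<in> measurable ?\<mu> borel"
    by (simp add: measurable_cong_sets[OF sets_hausdorff_measure refl])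
  have F': "F \<in> borel_measurable ?\<mu>"
    using F by (simp add: measurable_cong_sets[OF sets_hausdorff_measure refl])
  have "distr ?\<mu> borel ((*\<^sub>R) c) = density ?\<mu> (\<lambda>_. ennreal (inverse c ^ d))"
  proof (rule measure_eqI)
    fix B :: "'a set" assume "B \<in> sets (distr ?\<mu> borel ((*\<^sub>R) c))"
    then have B: "B \<in> sets borel" by simp
    have "(*\<^sub>R) c -` B = (*\<^sub>R) (inverse c) ` B"
      using c by (simp add: image_scaleR_eq_vimage)
    then have "emeasure (distr ?\<mu> borel ((*\<^sub>R) c)) B = ennreal (inverse c ^ d) * emeasure ?\<mu> B"
      using emeasure_distr[OF meas B] emeasure_hausdorff_measure_scaleR[of "inverse c" B d] B c by simp
    also have "\<dots> = emeasure (density ?\<mu> (\<lambda>_. ennreal (inverse c ^ d))) B"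
      using B by (simp add: emeasure_density_const)
    finally show "emeasure (distr ?\<mu> borel ((*\<^sub>R) c)) B = emeasure (density ?\<mu> (\<lambda>_. ennreal (inverse c ^ d))) B" .
  qed simp
  moreover have "(\<integral>x. F (c *\<^sub>R x) \<partial>?\<mu>) = (\<integral>x. F x \<partial>distr ?\<mu> borel ((*\<^sub>R) c))"
    by (rule integral_distr[OF meas F, symmetric])
  ultimately show ?thesis
    using c integral_density[OF F', of "\<lambda>_. inverse c ^ d"] by simp
qed

section \<open>Finite Hausdorff measure of compact subsets of a submanifold\<close>

lemma hausdorff_pre_finite_cover:
  assumes I: "finite I" and A: "A \<subseteq> (\<Union>i\<in>I. C i)"
    and C: "\<And>i. i \<in> I \<Longrightarrow> bounded (C i) \<and> diameter (C i) \<le> \<delta>" and \<delta>: "0 \<le> \<delta>" "\<delta> \<le> \<delta>'"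
  shows "hausdorff_pre d \<delta>' A \<le> ennreal (real (card I) * (unit_ball_vol (real d) * (\<delta> / 2) ^ d))"
proof -
  let ?w = "\<lambda>C. if C = {} then 0 else ennreal (unit_ball_vol (real d) * (diameter C / 2) ^ d)"
  let ?b = "unit_ball_vol (real d) * (\<delta> / 2) ^ d"
  obtain h where h: "bij_betw h {0..<card I} I"
    using ex_bij_betw_nat_finite[OF I] by blast
  \<comment> \<open>The finite cover is padded with empty sets to a sequence. They have weight 0 by
    definition, also in dimension 0, and diameter 0.\<close>
  define C' where "C' n = (if n < card I then C (h n) else {})" for n
  have hI: "h n \<in> I" if "n < card I" for n
    using h that by (auto simp: bij_betw_def)
  have "A \<subseteq> (\<Union>n. C' n)"
  proof
    fix x assume "x \<in> A"
    then obtain i where "i \<in> I" "x \<in> C i" using A by blast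
    moreover have "i \<in> h ` {0..<card I}"
      using h \<open>i \<in> I\<close> by (simp add: bij_betw_def)
    then obtain n where "n < card I" "i = h n"
      by auto
    ultimately show "x \<in> (\<Union>n. C' n)"
      by (auto simp: C'_def)
  qed
  moreover have C'_bd: "bounded (C' n) \<and> diameter (C' n) \<le> \<delta>" for n
    using C hI \<delta> by (auto simp: C'_def)
  ultimately have "hausdorff_pre d \<delta>' A \<le> (\<Sum>n. ?w (C' n))"
    unfolding hausdorff_pre_def using \<delta>(2) by (intro INF_lower) (auto intro: order_trans)
  also have "\<dots> = (\<Sum>n<card I. ?w (C' n))"
    by (rule suminf_finite) (auto simp: C'_def)
  also have "\<dots> \<le> (\<Sum>n<card I. ennreal ?b)"
  proof (rule sum_mono)
    fix n
    have "?w (C' n) \<le> ennreal ?b"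
      using C'_bd[of n] diameter_ge_0[of "C' n"]
      by (auto intro!: ennreal_leI mult_left_mono power_mono)
    then show "?w (C' n) \<le> ennreal ?b" .
  qed
  also have "\<dots> = ennreal (real (card I) * ?b)"
    using \<delta>(1) by (simp add: ennreal_mult ennreal_of_nat_eq_real_of_nat)
  finally show ?thesis .
qed

text \<open>A grid of \<open>N ^ d\<close> cells in orthonormal coordinates of \<open>V\<close> has
  images of diameter at most \<open>\<kappa> / N\<close>. In the covering sum the powers of
  \<open>N\<close> cancel, so the bound \<open>?K\<close> is the same for every
  \<open>\<delta>\<close>.\<close>

lemma hausdorff_outer_lipschitz_image_finite:
  fixes f :: "'a::euclidean_space \<Rightarrow> 'b::real_normed_vector"
  assumes V: "subspace V" "dim V = d" and B: "B \<subseteq> V" "bounded B"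
    and L: "0 \<le> L" "\<And>x y. x \<in> B \<Longrightarrow> y \<in> B \<Longrightarrow> norm (f x - f y) \<le> L * norm (x - y)"
  shows "hausdorff_outer d (f ` B) < \<infinity>"
proof -
  obtain R where R: "0 < R" "\<And>x. x \<in> B \<Longrightarrow> norm x < R"
    using B(2) unfolding bounded_pos_less by blast
  let ?E = "onb V"
  have E: "orthonormal_basis_of V ?E" and fin: "finite ?E"
    using orthonormal_basis_of_onb[OF V(1)] orthonormal_basis_of_finite by blast+
  have norm_E: "norm u = 1" if "u \<in> ?E" for u
    using E that by (auto simp: orthonormal_basis_of_def)
  have "independent ?E"
    using E norm_E[of 0] by (intro pairwise_orthogonal_independent) (auto simp: orthonormal_basis_of_def)
  then have card_E: "card ?E = d"
    using E V(2) dim_eq_card_independent[of ?E] dim_span[of ?E] by (simp add: orthonormal_basis_of_def)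
  \<comment> \<open>Two points of one cell differ by at most \<open>2 * R / N\<close> in each of the
    \<open>d\<close> coordinates, hence by \<open>d\<close> times that in norm; \<open>L\<close>
    carries the bound to the image.\<close>
  define \<kappa> where "\<kappa> = L * (real d * (2 * R))"
  have \<kappa>: "0 \<le> \<kappa>" using L(1) R(1) by (simp add: \<kappa>_def)
  let ?K = "unit_ball_vol (real d) * (\<kappa> / 2) ^ d"
  have main: "hausdorff_pre d \<delta> (f ` B) \<le> ennreal ?K" if \<delta>: "0 < \<delta>" for \<delta>
  proof -
    obtain N :: nat where "\<kappa> / \<delta> < real N"
      using reals_Archimedean2 by blast
    moreover have "0 \<le> \<kappa> / \<delta>"
      using \<kappa> \<delta> by simp
    ultimately have N: "0 < real N" "\<kappa> < real N * \<delta>"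
      using \<delta> by (linarith, simp add: pos_divide_less_eq)
    then have N: "0 < real N" "\<kappa> / real N \<le> \<delta>"
      by (simp, subst pos_divide_le_eq) (simp_all add: mult.commute)
    \<comment> \<open>This rescales the coordinates from (-R, R) to [0, 1). The strict bound by
      \<open>R\<close> keeps every index \<open>\<lfloor>\<alpha> w u * N\<rfloor>\<close> below
      \<open>N\<close>, so no boundary cell arises.\<close>
    define \<alpha> where "\<alpha> w u = (w \<bullet> u + R) / (2 * R)" for w u :: 'a
    define cell where "cell j = {w \<in> B. \<forall>u\<in>?E. nat \<lfloor>\<alpha> w u * real N\<rfloor> = j u}" for j
    let ?I = "PiE ?E (\<lambda>_. {..<N})"
    have a: "0 \<le> \<alpha> w u" "\<alpha> w u < 1" if "w \<in> B" "u \<in> ?E" for w u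
    proof -
      have "\<bar>w \<bullet> u\<bar> < R"
        using Cauchy_Schwarz_ineq2[of w u] norm_E[OF that(2)] R(2)[OF that(1)] by simp
      then show "0 \<le> \<alpha> w u" "\<alpha> w u < 1"
        using R(1) by (auto simp: \<alpha>_def field_simps)
    qed
    have cover: "f ` B \<subseteq> (\<Union>j\<in>?I. f ` cell j)"
    proof (intro image_subsetI)
      fix w assume w: "w \<in> B"
      define j where "j = restrict (\<lambda>u. nat \<lfloor>\<alpha> w u * real N\<rfloor>) ?E"
      have "nat \<lfloor>\<alpha> w u * real N\<rfloor> < N" if "u \<in> ?E" for u
      proof -
        have "\<alpha> w u * real N < real N"
          using mult_strict_right_mono[OF a(2)[OF w that] N(1)] by (simp only: mult_1)
        then have "\<lfloor>\<alpha> w u * real N\<rfloor> < int N"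
          by (simp add: floor_less_iff)
        then show ?thesis
          using N(1) by linarith
      qed
      then have "j \<in> ?I" "w \<in> cell j"
        using w by (auto simp: j_def cell_def)
      then show "f w \<in> (\<Union>j\<in>?I. f ` cell j)" by blast
    qed
    have diam: "norm (f x - f y) \<le> \<kappa> / real N" if "x \<in> cell j" "y \<in> cell j" for x y j
    proof -
      have xy: "x \<in> B" "y \<in> B"
        using that by (auto simp: cell_def)
      have coord: "\<bar>(x - y) \<bullet> u\<bar> \<le> 2 * R / real N" if u: "u \<in> ?E" for u
      proof -
        have "nat \<lfloor>\<alpha> x u * real N\<rfloor> = nat \<lfloor>\<alpha> y u * real N\<rfloor>"
          using \<open>x \<in> cell j\<close> \<open>y \<in> cell j\<close> u by (auto simp: cell_def)
        moreover have "0 \<le> \<lfloor>\<alpha> x u * real N\<rfloor>" "0 \<le> \<lfloor>\<alpha> y u * real N\<rfloor>"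
          using a[OF xy(1) u] a[OF xy(2) u] by auto
        ultimately have "\<lfloor>\<alpha> x u * real N\<rfloor> = \<lfloor>\<alpha> y u * real N\<rfloor>"
          by linarith
        then have "\<bar>\<alpha> x u * real N - \<alpha> y u * real N\<bar> \<le> 1"
          by linarith
        also have "\<alpha> x u * real N - \<alpha> y u * real N = ((x - y) \<bullet> u) * (real N / (2 * R))"
          using R(1) by (simp add: \<alpha>_def field_simps inner_diff_left)
        finally have "\<bar>(x - y) \<bullet> u\<bar> * (real N / (2 * R)) \<le> 1"
          using R(1) N(1) by (simp add: abs_mult)
        then show ?thesis
          using R(1) N(1) by (simp add: field_simps)
      qed
      have "x - y \<in> V"
        using xy B(1) V(1) by (auto intro: subspace_diff)
      from orthonormal_basis_of_expand[OF E this]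
      have "norm (x - y) = norm (\<Sum>u\<in>?E. ((x - y) \<bullet> u) *\<^sub>R u)"
        by simp
      also have "\<dots> \<le> (\<Sum>u\<in>?E. 2 * R / real N)"
        using coord norm_E by (intro sum_norm_le) simp
      also have "\<dots> = real d * (2 * R) / real N"
        by (simp add: card_E)
      finally have "L * norm (x - y) \<le> L * (real d * (2 * R) / real N)"
        using L(1) by (rule mult_left_mono)
      then show ?thesis
        using L(2)[OF xy] by (simp add: \<kappa>_def)
    qed
    have "hausdorff_pre d \<delta> (f ` B) \<le>
        ennreal (real (card ?I) * (unit_ball_vol (real d) * (\<kappa> / real N / 2) ^ d))"
    proof (rule hausdorff_pre_finite_cover[OF _ cover _ _ N(2)])
      show "finite ?I"
        using fin by (intro finite_PiE) auto
      show "bounded (f ` cell j) \<and> diameter (f ` cell j) \<le> \<kappa> / real N" for j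
      proof
        show "bounded (f ` cell j)"
          using diam[of _ j] by (auto simp: bounded_two_points dist_norm intro!: exI[of _ "\<kappa> / real N"])
        show "diameter (f ` cell j) \<le> \<kappa> / real N"
          using diam[of _ j] \<kappa> N(1) by (intro diameter_le) auto
      qed
      show "0 \<le> \<kappa> / real N"
        using \<kappa> by simp
    qed
    also have "card ?I = N ^ d"
      using fin by (simp add: card_PiE card_E)
    also have "real (N ^ d) * (unit_ball_vol (real d) * (\<kappa> / real N / 2) ^ d) = ?K"
      using N(1) by (simp add: power_divide)
    finally show ?thesis .
  qed
  have "hausdorff_outer d (f ` B) \<le> ennreal ?K"
    unfolding hausdorff_outer_def by (rule SUP_least) (use main in auto)
  then show ?thesis
    by (rule le_less_trans) simp
qed

text \<open>A closed ball in the chart image is compact, which bounds the derivative of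
  \<open>\<Psi>\<close>, and convex, which turns that bound into a Lipschitz constant.\<close>

lemma C2_submanifold_locally_finite:
  assumes M: "C2_submanifold d M" and p: "p \<in> M"
  shows "\<exists>W. open W \<and> p \<in> W \<and> hausdorff_outer d (M \<inter> W) < \<infinity>"
proof -
  obtain U \<Phi> \<Psi> V where U: "p \<in> U" "chart d M U \<Phi> \<Psi> V"
    using C2_submanifold_chart[OF M p] by metis
  interpret chart d M U \<Phi> \<Psi> V by fact
  obtain \<epsilon> where \<epsilon>: "0 < \<epsilon>" "cball (\<Phi> p) \<epsilon> \<subseteq> \<Phi> ` U"
    using open_image U(1) by (meson imageI open_contains_cball)
  let ?K = "cball (\<Phi> p) \<epsilon>"
  have "compact (d\<Psi> ` ?K)"
    using C1_on_continuous_on[OF C1_d\<Psi>] \<epsilon>(2) by (intro compact_continuous_image) (auto intro: continuous_on_subset)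
  then obtain L where L: "0 < L" "\<And>y. y \<in> ?K \<Longrightarrow> norm (d\<Psi> y) \<le> L"
    using compact_imp_bounded bounded_pos by (metis imageI)
  have lip: "norm (\<Psi> x - \<Psi> y) \<le> L * norm (x - y)" if "x \<in> ?K" "y \<in> ?K" for x y
  proof (rule differentiable_bound[OF convex_cball _ _ that, where f = \<Psi> and f' = "\<lambda>z. blinfun_apply (d\<Psi> z)"])
    show "(\<Psi> has_derivative blinfun_apply (d\<Psi> z)) (at z within ?K)" if "z \<in> ?K" for z
      by (rule has_derivative_at_withinI[OF d\<Psi>]) (rule subsetD[OF \<epsilon>(2) that])
    show "onorm (blinfun_apply (d\<Psi> z)) \<le> L" if "z \<in> ?K" for z
      using L(2)[OF that] by (simp add: norm_blinfun.rep_eq)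
  qed
  have fin: "hausdorff_outer d (\<Psi> ` (V \<inter> ?K)) < \<infinity>"
    by (rule hausdorff_outer_lipschitz_image_finite[OF subspace_V dim_V, of _ L])
       (use L(1) lip in \<open>auto intro: bounded_subset[OF bounded_cball[of "\<Phi> p" \<epsilon>]]\<close>)
  let ?W = "U \<inter> \<Phi> -` ball (\<Phi> p) \<epsilon>"
  have "M \<inter> ?W \<subseteq> \<Psi> ` (V \<inter> ?K)"
  proof
    fix q assume q: "q \<in> M \<inter> ?W"
    then have "q = \<Psi> (\<Phi> q)" "\<Phi> q \<in> V \<inter> ?K"
      using \<Psi>_\<Phi> \<Phi>_in_V by auto
    then show "q \<in> \<Psi> ` (V \<inter> ?K)" by blast
  qed
  then have "hausdorff_outer d (M \<inter> ?W) < \<infinity>"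
    using fin hausdorff_outer_mono le_less_trans by blast
  moreover have "open ?W"
    by (intro continuous_open_preimage C1_on_continuous_on C2_on_imp_C1_on C2_\<Phi> open_U open_ball)
  ultimately show ?thesis
    using U(1) \<epsilon>(1) by (intro exI[of _ ?W]) simp
qed

lemma emeasure_hausdorff_measure_compact:
  assumes M: "C2_submanifold d M" and K: "compact K" "K \<subseteq> M"
  shows "emeasure (hausdorff_measure d) K < \<infinity>"
proof (cases rule: emeasure_hausdorff_measure_cases[of d, where 'a='a])
  case 1
  obtain W where W: "\<And>p. p \<in> K \<Longrightarrow> open (W p) \<and> p \<in> W p \<and> hausdorff_outer d (M \<inter> W p) < \<infinity>"
    using C2_submanifold_locally_finite[OF M] K(2) by (metis subsetD)
  obtain P where P: "P \<subseteq> K" "finite P" "K \<subseteq> (\<Union>p\<in>P. W p)"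
    using compactE_image[OF K(1), of K W] W by blast
  \<comment> \<open>The pieces are cut out of \<open>K\<close> to be Borel, so that measure and
    outer measure agree on them; \<open>M \<inter> W p\<close> enters only through the outer
    measure.\<close>
  have meas: "K \<inter> W p \<in> sets borel" if "p \<in> P" for p
    using W P(1) that by (intro sets.Int borel_compact[OF K(1)] borel_open) auto
  have "emeasure (hausdorff_measure d) K \<le> emeasure (hausdorff_measure d) (\<Union>p\<in>P. K \<inter> W p)"
  proof (rule emeasure_mono)
    show "K \<subseteq> (\<Union>p\<in>P. K \<inter> W p)"
      using P(3) by blast
    show "(\<Union>p\<in>P. K \<inter> W p) \<in> sets (hausdorff_measure d)"
      unfolding sets_hausdorff_measure by (rule sets.finite_UN[OF P(2) meas])
  qed
  also have "\<dots> \<le> (\<Sum>p\<in>P. emeasure (hausdorff_measure d) (K \<inter> W p))"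
    using P meas by (intro emeasure_subadditive_finite) auto
  also have "\<dots> < \<infinity>"
  proof -
    have "emeasure (hausdorff_measure d) (K \<inter> W p) < top" if "p \<in> P" for p
    proof -
      have "emeasure (hausdorff_measure d) (K \<inter> W p) = hausdorff_outer d (K \<inter> W p)"
        using 1 meas[OF that] by simp
      also have "\<dots> \<le> hausdorff_outer d (M \<inter> W p)"
        using K(2) by (intro hausdorff_outer_mono) blast
      also have "\<dots> < top"
        using W P(1) that by auto
      finally show ?thesis .
    qed
    then show ?thesis
      using P(2) by (simp add: ennreal_sum_less_top)
  qed
  finally show ?thesis .
qed simp


section \<open>Radial integration over a cone\<close>

lemma C1_field_continuous_on: "C1_field M X \<Longrightarrow> continuous_on M X"
  by (auto simp: continuous_on_eq_continuous_within
      intro!: differentiable_imp_continuous_within C1_field_differentiable)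

lemma C2_on_real_deriv:
  fixes h :: "real \<Rightarrow> real"
  assumes "C2_on U h" "open U" "t \<in> U"
  shows "(h has_real_derivative deriv h t) (at t)"
    "(deriv h has_real_derivative deriv (deriv h) t) (at t)"
proof -
  obtain h' where h': "\<And>t. t \<in> U \<Longrightarrow> (h has_derivative blinfun_apply (h' t)) (at t)" "C1_on U h'"
    using assms(1) by (rule C2_onE) blast
  have "(h has_real_derivative blinfun_apply (h' t) 1) (at t)" if "t \<in> U" for t
  proof (rule has_derivative_imp_has_field_derivative[OF h'(1)[OF that]])
    show "x * blinfun_apply (h' t) 1 = blinfun_apply (h' t) x" for x
      using blinfun.scaleR_right[of "h' t" x 1] by simp
  qed
  then have 1: "(h has_real_derivative deriv h t) (at t)" and eq: "deriv h t = blinfun_apply (h' t) 1" if "t \<in> U" for t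
    using that DERIV_imp_deriv by metis+
  then show "(h has_real_derivative deriv h t) (at t)"
    using assms(3) by blast
  have "C1_on U (\<lambda>t. blinfun_apply (h' t) 1)"
    by (rule bounded_bilinear.C1_on[OF bounded_bilinear_blinfun_apply h'(2) C1_on_const])
  then obtain D where "((\<lambda>t. blinfun_apply (h' t) 1) has_derivative D) (at t)"
    using C1_on_differentiable[OF _ assms(3)] unfolding differentiable_def by blast
  then have "(deriv h has_derivative D) (at t)"
    by (rule has_derivative_transform_within_open[OF _ assms(2,3)]) (simp add: eq)
  then have "deriv h differentiable (at t)"
    by (rule differentiableI)
  then show "(deriv h has_real_derivative deriv (deriv h) t) (at t)"
    using DERIV_deriv_iff_real_differentiable by blast
qed

section \<open>Gradient and Hessian of radial functions\<close>

lemma has_derivative_radial: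
  fixes x :: "'a::euclidean_space"
  assumes "(g has_real_derivative g') (at (norm x))" "x \<noteq> 0"
  shows "((\<lambda>y. g (norm y)) has_derivative (\<lambda>v. g' * (sgn x \<bullet> v))) (at x)"
proof -
  have "(norm has_derivative (\<lambda>v. v \<bullet> sgn x)) (at x)"
    using assms(2) by (intro has_derivative_norm) auto
  from has_derivative_compose[OF this assms(1)[unfolded has_field_derivative_def]]
  show ?thesis by (simp add: inner_commute)
qed

lemma grad_eqI: "GDERIV f x :> D \<Longrightarrow> grad f x = D"
  unfolding grad_def
proof (rule the_equality)
  fix D' assume "GDERIV f x :> D" "GDERIV f x :> D'"
  then have "(\<lambda>v. v \<bullet> D) = (\<lambda>v. v \<bullet> D')"
    unfolding gderiv_def by (rule has_derivative_unique)
  then show "D' = D"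
    by (metis vector_eq_ldot)
qed

lemma grad_radial:
  fixes x :: "'a::euclidean_space"
  assumes "(g has_real_derivative g') (at (norm x))" "x \<noteq> 0"
  shows "grad (\<lambda>y. g (norm y)) x = g' *\<^sub>R sgn x"
  by (rule grad_eqI)
     (use has_derivative_radial[OF assms] in \<open>simp add: gderiv_def inner_commute\<close>)

text \<open>The derivative in direction \<open>v\<close> at \<open>y\<close> is
  \<open>?q (norm y) * (y \<bullet> v)\<close>. In the product rule the derivative of
  \<open>?q\<close> is multiplied by \<open>x \<bullet> v = 0\<close>, so \<open>g''\<close> does
  not appear.\<close>

lemma hess_radial_orthogonal:
  fixes x :: "'a::euclidean_space"
  assumes g: "\<And>r. 0 < r \<Longrightarrow> (g has_real_derivative g' r) (at r)" and g': "g' differentiable (at (norm x))"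
    and x: "x \<noteq> 0" and v: "x \<bullet> v = 0"
  shows "hess (\<lambda>y. g (norm y)) x v v = g' (norm x) / norm x * (norm v)\<^sup>2"
proof -
  let ?q = "\<lambda>r. g' r / r"
  have fd: "frechet_derivative (\<lambda>y. g (norm y)) (at y) v = ?q (norm y) * (y \<bullet> v)" if "y \<noteq> 0" for y
    unfolding frechet_derivative_at[OF has_derivative_radial[OF g that], symmetric, OF zero_less_norm_iff[THEN iffD2, OF that]]
    by (simp add: sgn_div_norm divide_inverse)
  obtain q' where "(?q has_real_derivative q') (at (norm x))"
  proof -
    have "?q differentiable (at (norm x))"
      using g' x by (intro differentiable_divide) auto
    then show thesis
      using that by (auto simp: real_differentiable_def)
  qed
  from has_derivative_mult[OF has_derivative_radial[OF this x] has_derivative_inner_left[OF has_derivative_ident]]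
  have "((\<lambda>y. ?q (norm y) * (y \<bullet> v)) has_derivative
      (\<lambda>u. ?q (norm x) * (u \<bullet> v) + q' * (sgn x \<bullet> u) * (x \<bullet> v))) (at x)" .
  then have "((\<lambda>y. frechet_derivative (\<lambda>y. g (norm y)) (at y) v) has_derivative
      (\<lambda>u. ?q (norm x) * (u \<bullet> v) + q' * (sgn x \<bullet> u) * (x \<bullet> v))) (at x)"
    by (rule has_derivative_transform_within_open[of _ _ _ _ "- {0}"]) (use x fd in \<open>auto simp: open_Compl\<close>)
  from frechet_derivative_at[OF this]
  have "hess (\<lambda>y. g (norm y)) x v v = ?q (norm x) * (v \<bullet> v) + q' * (sgn x \<bullet> v) * (x \<bullet> v)"
    unfolding hess_def by metis
  then show ?thesis
    using v by (simp add: dot_square_norm)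
qed

section \<open>Integration over the cone of functions supported in a compact set\<close>

locale compact_spherical_submanifold = spherical_submanifold +
  assumes compact_S: "compact S"
begin

lemma cone_borel: "M \<in> sets borel"
proof -
  have eq: "M = (- {0}) \<inter> sgn -` S"
    using M_iff by blast
  have "continuous_on (- {0}) (sgn :: 'a \<Rightarrow> 'a)"
    by (rule C1_on_continuous_on[OF C1_on_sgn]) simp
  then have "closedin (top_of_set (- {0})) M"
    unfolding eq using compact_imp_closed[OF compact_S] by (rule continuous_closedin_preimage)
  then obtain T where "closed T" "M = (- {0}) \<inter> T"
    unfolding closedin_closed by blast
  then show ?thesis
    by (auto intro!: sets.Int borel_open borel_closed open_Compl)
qed

context
  fixes K :: "'a set"
  assumes K: "compact K" "K \<subseteq> M"
begin

lemma measurable_cone: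
  fixes F :: "'a \<Rightarrow> real"
  shows "continuous_on M F \<Longrightarrow> (\<lambda>x. indicator M x *\<^sub>R F x) \<in> borel_measurable borel"
  by (rule borel_measurable_continuous_on_indicator[OF cone_borel])

lemma bounded_cone:
  fixes F :: "'a \<Rightarrow> real"
  assumes "continuous_on M F" "\<And>x. x \<in> M - K \<Longrightarrow> F x = 0"
  obtains C where "0 < C" "\<And>x. x \<in> M \<Longrightarrow> \<bar>F x\<bar> \<le> C"
proof -
  have "compact (F ` K)"
    using K assms(1) by (intro compact_continuous_image) (auto intro: continuous_on_subset)
  then obtain C where C: "0 < C" "\<And>y. y \<in> F ` K \<Longrightarrow> norm y \<le> C"
    using compact_imp_bounded bounded_pos by metis
  show thesis
  proof
    show "\<bar>F x\<bar> \<le> C" if "x \<in> M" for x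
      using C assms(2)[of x] that by (cases "x \<in> K") auto
  qed fact
qed

lemma integrable_cone:
  fixes F :: "'a \<Rightarrow> real"
  assumes F: "continuous_on M F" "\<And>x. x \<in> M - K \<Longrightarrow> F x = 0"
  shows "set_integrable (hausdorff_measure (Suc m)) M F"
  unfolding set_integrable_def
proof -
  obtain C where C: "0 < C" "\<And>x. x \<in> M \<Longrightarrow> \<bar>F x\<bar> \<le> C"
    using bounded_cone[OF F] by metis
  show "integrable (hausdorff_measure (Suc m)) (\<lambda>x. indicator M x *\<^sub>R F x)"
  proof (rule integrableI_bounded_set[where A=K and B=C])
    show "K \<in> sets (hausdorff_measure (Suc m))"
      using borel_compact[OF K(1)] by simp
    show "(\<lambda>x. indicator M x *\<^sub>R F x) \<in> borel_measurable (hausdorff_measure (Suc m))"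
      using measurable_cone[OF F(1)] by (simp add: measurable_cong_sets[OF sets_hausdorff_measure refl])
    show "emeasure (hausdorff_measure (Suc m)) K < \<infinity>"
      by (rule emeasure_hausdorff_measure_compact[OF cone_C2_submanifold K])
    show "AE x in hausdorff_measure (Suc m). x \<in> K \<longrightarrow> norm (indicator M x *\<^sub>R F x) \<le> C"
      using C by (intro AE_I2) (auto simp: indicator_def)
    show "AE x in hausdorff_measure (Suc m). x \<notin> K \<longrightarrow> indicator M x *\<^sub>R F x = 0"
      using F(2) by (intro AE_I2) (auto simp: indicator_def)
  qed
qed

text \<open>
  Integration by parts in the radial direction, obtained by differentiating the scaling relation
  \<open>\<integral> \<phi> (s x) = s\<^sup>-\<^sup>k \<integral> \<phi> x\<close> at \<open>s = 1\<close>; no coarea formula is needed.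
\<close>

lemma radial_integration_by_parts:
  fixes \<phi> \<psi> :: "'a \<Rightarrow> real"
  assumes \<phi>: "continuous_on M \<phi>" "\<And>x. x \<in> M - K \<Longrightarrow> \<phi> x = 0"
    and \<psi>: "continuous_on M \<psi>" "\<And>x. x \<in> M - K \<Longrightarrow> \<psi> x = 0"
    and deriv: "\<And>x. x \<in> M \<Longrightarrow> ((\<lambda>s. \<phi> (s *\<^sub>R x)) has_real_derivative \<psi> x) (at 1)"
  shows "(LINT x:M|hausdorff_measure (Suc m). \<psi> x) = - real (Suc m) * (LINT x:M|hausdorff_measure (Suc m). \<phi> x)"
proof -
  let ?\<mu> = "hausdorff_measure (Suc m) :: 'a measure"
  let ?\<phi> = "\<lambda>x. indicator M x *\<^sub>R \<phi> x" and ?\<psi> = "\<lambda>x. indicator M x *\<^sub>R \<psi> x"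
  \<comment> \<open>The limit of dilations is taken along a sequence, as dominated convergence
    requires; \<open>e n \<le> 1\<close> keeps all factors \<open>1 + e n\<close> in the interval
    from 1 to 2.\<close>
  define e where "e n = inverse (real (Suc n))" for n
  have e: "0 < e n" "e n \<le> 1" for n
    by (auto simp: e_def inverse_le_1_iff)
  have e_lim: "filterlim e (at 0) sequentially"
    unfolding filterlim_at using LIMSEQ_inverse_real_of_nat e(1)
    by (auto simp: e_def[abs_def] intro!: always_eventually)
  define q where "q n x = (?\<phi> ((1 + e n) *\<^sub>R x) - ?\<phi> x) / e n" for n x
  have indM: "indicator M (s *\<^sub>R x) = (indicator M x :: real)" if "0 < s" for s x
    unfolding indicator_def M_iff using that by (simp add: sgn_scaleR)
  \<comment> \<open>The hypothesis gives the derivative at 1 only; applied at the point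
    \<open>s *\<^sub>R x\<close> and rescaled, it gives the derivative at \<open>s\<close>, which
    the mean value theorem needs.\<close>
  have deriv_s: "((\<lambda>s. \<phi> (s *\<^sub>R x)) has_real_derivative \<psi> (s *\<^sub>R x) / s) (at s)" if "x \<in> M" "0 < s" for x s
  proof -
    have "((\<lambda>t. \<phi> (t *\<^sub>R s *\<^sub>R x)) has_real_derivative \<psi> (s *\<^sub>R x)) (at (s / s))"
      using deriv[OF scaleR_M_in_M[OF that]] that(2) by simp
    moreover have "((\<lambda>t. t / s) has_real_derivative 1 / s) (at s)"
      using that by (auto intro!: derivative_eq_intros)
    ultimately have "((\<lambda>t. \<phi> ((t / s) *\<^sub>R s *\<^sub>R x)) has_real_derivative \<psi> (s *\<^sub>R x) * (1 / s)) (at s)"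
      by (rule DERIV_chain2)
    then show ?thesis
      using that by simp
  qed
  obtain C where C: "0 < C" "\<And>x. x \<in> M \<Longrightarrow> \<bar>\<psi> x\<bar> \<le> C"
    using bounded_cone[OF \<psi>] by metis
  \<comment> \<open>The mean value theorem gives \<open>q n x = \<psi> (z *\<^sub>R x) / z\<close>
    with z between 1 and 2. This is nonzero only if \<open>z *\<^sub>R x\<close> lies in
    \<open>K\<close>, that is, if \<open>x\<close> lies in \<open>K'\<close>. So the constant
    \<open>C\<close> on \<open>K'\<close> dominates all quotients at once.\<close>
  define K' where "K' = (\<lambda>(s, z). inverse s *\<^sub>R z) ` ({1..2::real} \<times> K)"
  have K': "compact K'" "K' \<subseteq> M"
  proof -
    have "continuous_on ({1..2::real} \<times> K) (\<lambda>p. inverse (fst p) *\<^sub>R snd p)"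
      by (intro continuous_intros) auto
    then show "compact K'"
      unfolding K'_def case_prod_beta by (intro compact_continuous_image compact_Times K(1)) auto
    show "K' \<subseteq> M"
    proof
      fix y assume "y \<in> K'"
      then obtain s z where "1 \<le> s" "z \<in> K" "y = inverse s *\<^sub>R z"
        unfolding K'_def by auto
      then show "y \<in> M"
        using K(2) scaleR_M_in_M[of z "inverse s"] by fastforce
    qed
  qed
  have bound: "\<bar>q n x\<bar> \<le> indicator K' x * C" for n x
  proof (cases "x \<in> M")
    case True
    have "\<exists>z>1. z < 1 + e n \<and> \<phi> ((1 + e n) *\<^sub>R x) - \<phi> (1 *\<^sub>R x) = (1 + e n - 1) * (\<psi> (z *\<^sub>R x) / z)"
      by (rule MVT2) (use e[of n] deriv_s[OF True] in auto)
    then obtain z where z: "1 < z" "z < 1 + e n" "\<phi> ((1 + e n) *\<^sub>R x) - \<phi> x = e n * (\<psi> (z *\<^sub>R x) / z)"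
      by auto
    have zM: "z *\<^sub>R x \<in> M"
      using z True by (intro scaleR_M_in_M) auto
    have q: "q n x = \<psi> (z *\<^sub>R x) / z"
      using z(3) e(1)[of n] True indM[of "1 + e n" x] by (simp add: q_def)
    show ?thesis
    proof (cases "z *\<^sub>R x \<in> K")
      case True
      have "x = (\<lambda>(s, z). inverse s *\<^sub>R z) (z, z *\<^sub>R x)" "(z, z *\<^sub>R x) \<in> {1..2} \<times> K"
        using z e(2)[of n] True by auto
      then have "x \<in> K'"
        unfolding K'_def by (rule image_eqI)
      moreover have "\<bar>\<psi> (z *\<^sub>R x) / z\<bar> \<le> C / 1"
        unfolding abs_divide using C(2)[OF zM] C(1) z(1) by (intro frac_le) auto
      ultimately show ?thesis
        using q by simp
    next
      case False
      then show ?thesis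
        using q \<psi>(2) zM C(1) by simp
    qed
  next
    case False
    then show ?thesis
      using C(1) e(1)[of n] indM[of "1 + e n" x] by (simp add: q_def)
  qed
  have int_\<phi>: "integrable ?\<mu> ?\<phi>"
    using integrable_cone[OF \<phi>] by (simp add: set_integrable_def)
  have meas_\<phi>: "?\<phi> \<in> borel_measurable borel" "?\<psi> \<in> borel_measurable borel"
    using measurable_cone \<phi>(1) \<psi>(1) by blast+
  have meas_q: "q n \<in> borel_measurable borel" for n
    unfolding q_def[abs_def]
    by (intro borel_measurable_divide borel_measurable_diff measurable_compose[OF _ meas_\<phi>(1)] meas_\<phi>(1)) auto
  have int_w: "integrable ?\<mu> (\<lambda>x. indicator K' x * C)"
    using emeasure_hausdorff_measure_compact[OF cone_C2_submanifold K'] borel_compact[OF K'(1)]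
    by (intro integrable_mult_left integrable_real_indicator) auto
  have pointwise: "(\<lambda>n. q n x) \<longlonglongrightarrow> ?\<psi> x" for x
  proof (cases "x \<in> M")
    case True
    have "((\<lambda>h. (\<phi> ((1 + h) *\<^sub>R x) - \<phi> (1 *\<^sub>R x)) / h) \<longlongrightarrow> \<psi> x) (at 0)"
      using deriv[OF True] by (simp add: DERIV_def)
    from filterlim_compose[OF this e_lim] show ?thesis
      using True indM[of "1 + e n" x for n] e(1) by (simp add: q_def add_pos_pos)
  next
    case False
    have "q n x = 0" for n
      using False indM[of "1 + e n" x] e(1)[of n] by (simp add: q_def)
    then show ?thesis
      using False by simp
  qed
  have lim1: "(\<lambda>n. integral\<^sup>L ?\<mu> (q n)) \<longlonglongrightarrow> integral\<^sup>L ?\<mu> ?\<psi>"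
    and int_q: "\<And>n. integrable ?\<mu> (q n)"
  proof -
    have m: "?\<psi> \<in> borel_measurable ?\<mu>" "\<And>n. q n \<in> borel_measurable ?\<mu>"
      using meas_\<phi>(2) meas_q by (simp_all add: measurable_cong_sets[OF sets_hausdorff_measure refl])
    have b: "\<And>n. AE x in ?\<mu>. norm (q n x) \<le> indicator K' x * C"
      using bound by simp
    have l: "AE x in ?\<mu>. (\<lambda>n. q n x) \<longlonglongrightarrow> ?\<psi> x"
      using pointwise by simp
    show "(\<lambda>n. integral\<^sup>L ?\<mu> (q n)) \<longlonglongrightarrow> integral\<^sup>L ?\<mu> ?\<psi>"
      by (rule integral_dominated_convergence[OF m int_w l b])
    show "\<And>n. integrable ?\<mu> (q n)"
      by (rule integrable_dominated_convergence2[OF m int_w l b])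
  qed
  have int_scaled: "integral\<^sup>L ?\<mu> (q n) = ((inverse (1 + e n)) ^ Suc m - 1) / e n * integral\<^sup>L ?\<mu> ?\<phi>" for n
  proof -
    have pos: "0 < 1 + e n" using e(1)[of n] by simp
    \<comment> \<open>Splitting the integral of \<open>q n\<close> requires the dilated function to
      be integrable; this is recovered from \<open>q n\<close> and \<open>\<phi>\<close>.\<close>
    have int_s: "integrable ?\<mu> (\<lambda>x. ?\<phi> ((1 + e n) *\<^sub>R x))"
    proof -
      have "integrable ?\<mu> (\<lambda>x. e n * q n x + ?\<phi> x)"
        by (intro Bochner_Integration.integrable_add integrable_mult_right int_\<phi> int_q)
      then show ?thesis
        using e(1)[of n] by (simp add: q_def)
    qed
    have "integral\<^sup>L ?\<mu> (q n) = (integral\<^sup>L ?\<mu> (\<lambda>x. ?\<phi> ((1 + e n) *\<^sub>R x)) - integral\<^sup>L ?\<mu> ?\<phi>) / e n"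
      unfolding q_def by (simp only: Bochner_Integration.integral_diff[OF int_s int_\<phi>] integral_divide_zero)
    then show ?thesis
      unfolding integral_hausdorff_measure_scaleR[OF pos meas_\<phi>(1)] by (simp add: field_simps)
  qed
  have "((\<lambda>s::real. (inverse s) ^ Suc m) has_real_derivative - real (Suc m)) (at 1)"
    by (auto intro!: derivative_eq_intros)
  then have "((\<lambda>h::real. ((inverse (1 + h)) ^ Suc m - (inverse 1) ^ Suc m) / h) \<longlongrightarrow> - real (Suc m)) (at 0)"
    by (simp only: DERIV_def)
  from filterlim_compose[OF this e_lim]
  have "(\<lambda>n. ((inverse (1 + e n)) ^ Suc m - 1) / e n * integral\<^sup>L ?\<mu> ?\<phi>) \<longlonglongrightarrow> - real (Suc m) * integral\<^sup>L ?\<mu> ?\<phi>"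
    by (intro tendsto_mult_right) simp
  then have "integral\<^sup>L ?\<mu> ?\<psi> = - real (Suc m) * integral\<^sup>L ?\<mu> ?\<phi>"
    using lim1 unfolding int_scaled by (rule LIMSEQ_unique[rotated])
  then show ?thesis
    by (simp add: set_lebesgue_integral_def)
qed

end

end


section \<open>Stability\<close>

context compact_spherical_submanifold
begin

lemma self_in_tangent_space: "x \<in> M \<Longrightarrow> x \<in> tangent_space M x"
  using subspace_scale[OF subspace_tangent_space[OF cone_C2_submanifold] radial_in_tangent_space, of x "norm x"]
  by (simp only: norm_scaleR_sgn)

text \<open>\<open>onb (tangent_space M x)\<close> need not vary continuously with \<open>x\<close>,
  so the trace is rewritten over the fixed \<open>Basis\<close> with projected arguments, where
  every ingredient is continuous.\<close>

lemma continuous_on_sum_normal_conn: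
  assumes X: "C1_field M X"
  shows "continuous_on M (\<lambda>x. \<Sum>u\<in>onb (tangent_space M x). (norm (normal_conn UNIV M X x u))\<^sup>2)"
proof -
  let ?P = "\<lambda>x. oproj (tangent_space M x)" and ?D = "flat_deriv M X"
  have cont: "continuous_on M (\<lambda>x. ?D x (?P x i) - ?P x (?D x (?P x i)))" for i
  proof -
    have "continuous_on M (\<lambda>x. ?D x (?P x i))"
      by (intro continuous_on_flat_deriv[OF X] continuous_on_oproj_tangent_space[OF cone_C2_submanifold]
          continuous_on_const oproj_in subspace_tangent_space[OF cone_C2_submanifold])
    then show ?thesis
      by (intro continuous_on_diff continuous_on_oproj_tangent_space[OF cone_C2_submanifold])
  qed
  have "continuous_on M (\<lambda>x. \<Sum>i\<in>Basis. (norm (?D x (?P x i) - ?P x (?D x (?P x i))))\<^sup>2)"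
    by (intro continuous_intros cont)
  then show ?thesis
  proof (rule continuous_on_eq)
    fix x assume x: "x \<in> M"
    have T: "subspace (tangent_space M x)"
      by (rule subspace_tangent_space[OF cone_C2_submanifold x])
    have nc: "normal_conn UNIV M X x u = ?D x u - ?P x (?D x u)" for u
      using normal_conn_eq[of UNIV x M X u] oproj_normal_space_UNIV[OF T] by simp
    have "linear (\<lambda>u. ?D x u - ?P x (?D x u))"
      by (intro linear_compose_sub linear_compose[OF _ linear_oproj[OF T], unfolded o_def]
          linear_flat_deriv C1_field_differentiable[OF X x])
    from sum_norm_orthonormal_basis[OF orthonormal_basis_of_onb[OF T] this]
    show "(\<Sum>i\<in>Basis. (norm (?D x (?P x i) - ?P x (?D x (?P x i))))\<^sup>2) =
        (\<Sum>u\<in>onb (tangent_space M x). (norm (normal_conn UNIV M X x u))\<^sup>2)"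
      by (simp add: nc)
  qed
qed

section \<open>Radial derivatives of normal fields\<close>

lemma ray_curve:
  assumes "x \<in> M"
  shows "exp t *\<^sub>R x \<in> M" "sgn (exp t *\<^sub>R x) = sgn x"
    "((\<lambda>t. exp t *\<^sub>R x) has_vector_derivative x) (at (0::real))"
proof -
  show "exp t *\<^sub>R x \<in> M"
    by (rule scaleR_M_in_M[OF assms]) simp
  show "sgn (exp t *\<^sub>R x) = sgn x"
    by (simp add: sgn_scaleR)
  show "((\<lambda>t. exp t *\<^sub>R x) has_vector_derivative x) (at (0::real))"
    using has_vector_derivative_scaleR[OF DERIV_exp has_vector_derivative_const[of x "at 0"]] by simp
qed

text \<open>\<open>ray_curve\<close> runs exponentially and so stays in the cone for every real
  time; substituting \<open>ln s\<close> returns to the dilation parameter of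
  \<open>radial_integration_by_parts\<close>.\<close>

lemma has_vector_derivative_along_ray:
  assumes X: "C1_field M X" and x: "x \<in> M"
  shows "((\<lambda>s. X (s *\<^sub>R x)) has_vector_derivative flat_deriv M X x x) (at 1)"
proof -
  have "((\<lambda>t. X (exp t *\<^sub>R x)) has_vector_derivative flat_deriv M X x x) (at (ln 1))"
    using flat_deriv_curve[OF C1_field_differentiable[OF X x] ray_curve(1)[OF x] _ ray_curve(3)[OF x]] by simp
  moreover have "(ln has_vector_derivative 1) (at (1::real))"
    using DERIV_ln[of "1::real"] by (simp add: has_real_derivative_iff_has_vector_derivative)
  ultimately have "((\<lambda>s. X (exp (ln s) *\<^sub>R x)) has_vector_derivative flat_deriv M X x x) (at 1)"
    using vector_diff_chain_at[of ln 1 1 "\<lambda>t. X (exp t *\<^sub>R x)"] by (simp add: o_def)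
  then show ?thesis
    by (rule has_vector_derivative_transform_within_open[of _ _ _ "{0<..}"]) auto
qed

text \<open>Along a ray \<open>X\<close> takes values in one fixed subspace, because
  \<open>normal_space_cone\<close> depends on \<open>sgn x\<close> only; difference quotients and
  their limit remain there.\<close>

lemma radial_deriv_normal:
  assumes X: "normal_field UNIV M X" and x: "x \<in> M"
  shows "flat_deriv M X x x \<in> normal_space UNIV M x"
proof -
  have N: "subspace (normal_space UNIV M x)"
    by (rule subspace_normal_space) simp
  have XN: "X (exp t *\<^sub>R x) \<in> normal_space UNIV M x" for t
    using X ray_curve(1,2)[OF x] normal_space_cone[OF x] normal_space_cone[OF ray_curve(1)[OF x]]
    unfolding normal_field_def by metis
  have "((\<lambda>t. X (exp t *\<^sub>R x)) has_vector_derivative flat_deriv M X x x) (at 0)"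
    using flat_deriv_curve[OF C1_field_differentiable ray_curve(1)[OF x] _ ray_curve(3)[OF x]] X x
    by (simp add: normal_field_def)
  from has_vector_derivative_quotient[OF this] show ?thesis
    by (rule Lim_in_closed_set[OF closed_subspace[OF N], rotated 2])
       (auto intro!: always_eventually subspace_scale[OF N] subspace_diff[OF N] XN XN[of 0, simplified])
qed

text \<open>The full trace dominates its value at the unit vector \<open>sgn x\<close>. There the
  normal projection changes nothing, and passing from \<open>x\<close> to \<open>sgn x\<close>
  accounts for the division by \<open>(norm x)\<^sup>2\<close>.\<close>

lemma radial_deriv_le_sum_normal_conn:
  assumes X: "normal_field UNIV M X" and x: "x \<in> M"
  shows "(norm (flat_deriv M X x x))\<^sup>2 / (norm x)\<^sup>2 \<le>
    (\<Sum>u\<in>onb (tangent_space M x). (norm (normal_conn UNIV M X x u))\<^sup>2)"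
proof -
  have T: "subspace (tangent_space M x)" and N: "subspace (normal_space UNIV M x)"
    by (rule subspace_tangent_space[OF cone_C2_submanifold x], rule subspace_normal_space) simp
  have x0: "x \<noteq> 0" using x by auto
  have D: "linear (flat_deriv M X x)"
    using X x by (intro linear_flat_deriv C1_field_differentiable) (auto simp: normal_field_def)
  have nc: "normal_conn UNIV M X x u = oproj (normal_space UNIV M x) (flat_deriv M X x u)" for u
    by (rule normal_conn_eq) simp
  have lin: "linear (normal_conn UNIV M X x)"
    unfolding nc[abs_def] by (rule linear_compose[OF D linear_oproj[OF N], unfolded o_def])
  have "normal_conn UNIV M X x (sgn x) = inverse (norm x) *\<^sub>R normal_conn UNIV M X x x"
    unfolding sgn_div_norm by (rule linear_cmul[OF lin])
  also have "normal_conn UNIV M X x x = flat_deriv M X x x"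
    unfolding nc by (rule oproj_ident[OF N radial_deriv_normal[OF X x]])
  finally have "(norm (normal_conn UNIV M X x (sgn x)))\<^sup>2 = (norm (flat_deriv M X x x))\<^sup>2 / (norm x)\<^sup>2"
    by (simp add: power_mult_distrib power_divide field_simps)
  moreover have "norm (sgn x) = 1"
    using x0 by (simp add: norm_sgn)
  ultimately show ?thesis
    using norm_linear_le_sum_orthonormal_basis[OF orthonormal_basis_of_onb[OF T] lin radial_in_tangent_space[OF x]]
    by simp
qed

lemma flat_deriv_outside_support:
  assumes "closed K" "\<And>x. x \<in> M - K \<Longrightarrow> X x = 0" "x \<in> M - K" "u \<in> tangent_space M x"
  shows "flat_deriv M X x u = 0"
  by (rule flat_deriv_extension(2)[of "- K" x M "\<lambda>_. 0" "\<lambda>_. 0"]) (use assms in auto)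

text \<open>Both sides of the Euler-Lagrange equation vanish: the mean curvature by minimality of
  \<open>S\<close>, the normal part of the gradient because a radial vector is tangent to the
  cone.\<close>

lemma f_stationary_cone:
  assumes g: "\<And>r. 0 < r \<Longrightarrow> (g has_real_derivative g' r) (at r)"
    and minimal: "minimal_in (sphere 0 1) S"
  shows "f_stationary (Suc m) (\<lambda>x. g (norm x)) M"
  unfolding f_stationary_def
proof (intro conjI ballI cone_C2_submanifold)
  fix p assume p: "p \<in> M"
  then have "p \<noteq> 0" "sgn p \<in> S"
    using M_iff by auto
  then have "mean_curv UNIV M p = 0"
    using mean_curv_cone[OF p] minimal by (simp add: minimal_in_def)
  moreover have "grad (\<lambda>x. g (norm x)) p = g' (norm p) *\<^sub>R sgn p"
    using g \<open>p \<noteq> 0\<close> by (intro grad_radial) auto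
  moreover have "oproj (normal_space UNIV M p) (g' (norm p) *\<^sub>R sgn p) = 0"
    using radial_in_tangent_space[OF p]
    by (intro oproj_eq_0 subspace_normal_space) (auto simp: normal_space_def inner_commute)
  ultimately show "g (norm p) *\<^sub>R mean_curv UNIV M p =
      oproj (normal_space UNIV M p) (grad (\<lambda>x. g (norm x)) p)"
    by simp
qed

end

text \<open>
  Pointwise form of the weighted Hardy inequality: completing the square with \<open>D + \<alpha> X\<close>, where
  \<open>\<alpha> = (k - 2 + b) / 2\<close>; the bracket multiplied by \<open>\<alpha>\<close> integrates to zero along the cone.
\<close>

lemma hardy_pointwise:
  fixes X D :: "'a::real_inner"
  assumes F: "0 < F" and r: "0 < r" and T: "(norm D)\<^sup>2 / r\<^sup>2 \<le> T" and H: "b \<le> H"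
    and \<alpha>: "0 < \<alpha>" "2 * \<alpha> = k - 2 + b"
  shows "F * (\<alpha>\<^sup>2 + b) * (norm X)\<^sup>2 / r\<^sup>2
      - \<alpha> * ((F * (norm X)\<^sup>2 / r\<^sup>2 * (H - 2) + 2 * F * (X \<bullet> D) / r\<^sup>2) + k * (F * (norm X)\<^sup>2 / r\<^sup>2))
    \<le> F * T + F * H / r\<^sup>2 * (norm X)\<^sup>2"
proof -
  let ?x = "(norm X)\<^sup>2" and ?d = "(norm D)\<^sup>2"
  have "(norm (D + \<alpha> *\<^sub>R X))\<^sup>2 = ?d + 2 * \<alpha> * (X \<bullet> D) + \<alpha>\<^sup>2 * ?x"
    unfolding power2_norm_eq_inner
    by (simp add: inner_add_left inner_add_right inner_commute[of D X] power2_eq_square algebra_simps)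
  \<comment> \<open>\<open>H\<close> occurs once in the Hessian term and \<alpha> times in the
    integrated bracket, whence the factor \<open>1 + \<alpha>\<close>; its positivity makes
    \<open>b \<le> H\<close> usable.\<close>
  moreover have "0 \<le> (norm (D + \<alpha> *\<^sub>R X))\<^sup>2" "0 \<le> (H - b) * (1 + \<alpha>) * ?x"
    using H \<alpha> by simp_all
  ultimately have "0 \<le> (?d + 2 * \<alpha> * (X \<bullet> D) + \<alpha>\<^sup>2 * ?x) + (H - b) * (1 + \<alpha>) * ?x"
    by simp
  also have "\<dots> = ?d + H * ?x - (\<alpha>\<^sup>2 + b) * ?x + \<alpha> * ((H - 2 + k) * ?x + 2 * (X \<bullet> D))"
  proof -
    have k: "k = 2 * \<alpha> + 2 - b" using \<alpha> by simp
    show ?thesis unfolding k by (simp add: algebra_simps power2_eq_square)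
  qed
  finally have "0 \<le> F / r\<^sup>2 * (?d + H * ?x - (\<alpha>\<^sup>2 + b) * ?x + \<alpha> * ((H - 2 + k) * ?x + 2 * (X \<bullet> D)))"
    using F by simp
  moreover have "F * (?d / r\<^sup>2) \<le> F * T"
    using T F by (intro mult_left_mono) auto
  moreover have "F / r\<^sup>2 * (?d + H * ?x - (\<alpha>\<^sup>2 + b) * ?x + \<alpha> * ((H - 2 + k) * ?x + 2 * (X \<bullet> D))) =
      F * (?d / r\<^sup>2) + F * H / r\<^sup>2 * ?x - F * (\<alpha>\<^sup>2 + b) * ?x / r\<^sup>2
      + \<alpha> * ((F * ?x / r\<^sup>2 * (H - 2) + 2 * F * (X \<bullet> D) / r\<^sup>2) + k * (F * ?x / r\<^sup>2))"
    using r by (simp add: field_simps)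
  ultimately show ?thesis
    by linarith
qed

text \<open>The integrals are compared in three steps: \<open>L\<close> is bounded by
  \<open>P\<close> through the curvature bound; \<open>P\<close> and
  \<open>P - \<alpha> * (\<psi> + k * \<phi>)\<close> have the same integral by radial integration
  by parts; the latter is at most \<open>R\<close> by \<open>hardy_pointwise\<close>.\<close>

lemma (in compact_spherical_submanifold) f_stable_cone:
  assumes h: "C2_on {0<..} h" and b: "\<And>t. 0 < t \<Longrightarrow> b \<le> t * deriv h t" and b2: "2 - real (Suc m) < b"
    and minimal: "minimal_in (sphere 0 1) S"
    and A: "\<And>p. p \<in> S \<Longrightarrow> second_ff_normsq (sphere 0 1) S p \<le> (real (Suc m) - 2 + b)\<^sup>2 / 4 + b"
  shows "f_stable (Suc m) (\<lambda>x. exp (h (norm x))) M"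
  unfolding f_stable_def
proof (intro conjI allI impI)
  have h1: "(h has_real_derivative deriv h t) (at t)" and h2: "(deriv h has_real_derivative deriv (deriv h) t) (at t)"
    if "0 < t" for t
    using C2_on_real_deriv[OF h] that by auto
  have g: "((\<lambda>t. exp (h t)) has_real_derivative exp (h t) * deriv h t) (at t)" if "0 < t" for t
    using h1[OF that] by (auto intro!: derivative_eq_intros)
  show "f_stationary (Suc m) (\<lambda>x. exp (h (norm x))) M"
    using f_stationary_cone[OF g minimal] by simp
  fix X assume "normal_field UNIV M X \<and> (\<exists>K. compact K \<and> K \<subseteq> M \<and> (\<forall>x\<in>M - K. X x = 0))"
  then obtain K where X: "normal_field UNIV M X" and K: "compact K" "K \<subseteq> M" and X0: "\<And>x. x \<in> M - K \<Longrightarrow> X x = 0"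
    by blast
  have X1: "C1_field M X" and XN: "\<And>x. x \<in> M \<Longrightarrow> X x \<in> normal_space UNIV M x"
    using X by (auto simp: normal_field_def)
  have ortho: "x \<bullet> X x = 0" if "x \<in> M" for x
    using XN[OF that] self_in_tangent_space[OF that] by (auto simp: normal_space_def inner_commute)
  let ?\<mu> = "hausdorff_measure (Suc m) :: 'a measure"
  define f where "f x = exp (h (norm x))" for x :: 'a
  define k where "k = real (Suc m)"
  define \<alpha> where "\<alpha> = (k - 2 + b) / 2"
  define D where "D x = flat_deriv M X x x" for x
  define T where "T x = (\<Sum>u\<in>onb (tangent_space M x). (norm (normal_conn UNIV M X x u))\<^sup>2)" for x
  define \<phi> where "\<phi> x = f x * (norm (X x))\<^sup>2 / (norm x)\<^sup>2" for x
  \<comment> \<open>This is the derivative of \<open>\<phi> (s *\<^sub>R x)\<close> at s = 1: the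
    weight contributes r h', the factor \<open>1 / r^2\<close> contributes -2, and the square of
    \<open>X\<close> gives the term with \<open>D\<close>.\<close>
  define \<psi> where "\<psi> x = \<phi> x * (norm x * deriv h (norm x) - 2) + 2 * f x * (X x \<bullet> D x) / (norm x)\<^sup>2" for x
  define P where "P x = f x * (\<alpha>\<^sup>2 + b) * (norm (X x))\<^sup>2 / (norm x)\<^sup>2" for x
  define L where "L x = f x * ((\<Sum>u\<in>onb (tangent_space M x). \<Sum>v\<in>onb (tangent_space M x).
      (second_ff UNIV M x u v \<bullet> X x)\<^sup>2) + (mean_curv UNIV M x \<bullet> X x)\<^sup>2)" for x
  define R where "R x = f x * T x + hess (\<lambda>x. exp (h (norm x))) x (X x) (X x)" for x
  have \<alpha>: "0 < \<alpha>" "2 * \<alpha> = k - 2 + b" and C: "(k - 2 + b)\<^sup>2 / 4 + b = \<alpha>\<^sup>2 + b"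
    using b2 by (auto simp: \<alpha>_def k_def power_divide)
  have norm_pos: "0 < norm x" if "x \<in> M" for x
    using that by auto
  have D0: "D x = 0" and T0: "T x = 0" if "x \<in> M - K" for x
  proof -
    have fd: "flat_deriv M X x u = 0" if "u \<in> tangent_space M x" for u
      by (rule flat_deriv_outside_support[OF compact_imp_closed[OF K(1)] _ \<open>x \<in> M - K\<close> that]) (rule X0)
    then show "D x = 0"
      using self_in_tangent_space \<open>x \<in> M - K\<close> by (simp add: D_def)
    have "onb (tangent_space M x) \<subseteq> tangent_space M x"
      using orthonormal_basis_of_onb[OF subspace_tangent_space[OF cone_C2_submanifold]] \<open>x \<in> M - K\<close>
      by (auto simp: orthonormal_basis_of_def)
    then show "T x = 0"
      unfolding T_def
    proof (intro sum.neutral ballI)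
      fix u assume "u \<in> onb (tangent_space M x)"
      then have "flat_deriv M X x u = 0"
        using fd \<open>onb (tangent_space M x) \<subseteq> tangent_space M x\<close> by blast
      then have "normal_conn UNIV M X x u = 0"
        using normal_conn_eq[of UNIV x M X u] oproj_eq_0[OF subspace_normal_space[of UNIV x M], of 0] by simp
      then show "(norm (normal_conn UNIV M X x u))\<^sup>2 = 0" by simp
    qed
  qed
  have cont_norm: "continuous_on M (\<lambda>x. g (norm x))" if "\<And>t. 0 < t \<Longrightarrow> isCont g t" for g :: "real \<Rightarrow> real"
  proof -
    have "continuous_on {0<..} g"
      using that by (simp add: continuous_at_imp_continuous_on)
    then show ?thesis
      by (rule continuous_on_compose2) (auto intro!: continuous_intros)
  qed
  have cont_X: "continuous_on M X"
    by (rule C1_field_continuous_on[OF X1])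
  have cont_D: "continuous_on M D"
    unfolding D_def[abs_def] by (intro continuous_on_flat_deriv[OF X1] continuous_on_id self_in_tangent_space)
  have cont_T: "continuous_on M T"
    unfolding T_def[abs_def] by (rule continuous_on_sum_normal_conn[OF X1])
  have cont_f: "continuous_on M f"
    unfolding f_def[abs_def] by (intro cont_norm[of "\<lambda>t. exp (h t)"] DERIV_isCont[OF g])
  have cont_h': "continuous_on M (\<lambda>x. deriv h (norm x))"
    by (intro cont_norm DERIV_isCont[OF h2])
  have cont_\<phi>: "continuous_on M \<phi>" and cont_P: "continuous_on M P"
    unfolding \<phi>_def[abs_def] P_def[abs_def]
    by (intro continuous_intros cont_f cont_X; simp)+
  have cont_\<psi>: "continuous_on M \<psi>"
    unfolding \<psi>_def[abs_def] by (intro continuous_intros cont_\<phi> cont_h' cont_f cont_X cont_D; simp)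
  \<comment> \<open>\<open>X x\<close> is orthogonal to \<open>x\<close>, so
    \<open>hess_radial_orthogonal\<close> applies. The quotient h'/r is written as r h' / r^2 to
    match the parameter \<open>H\<close> of \<open>hardy_pointwise\<close>.\<close>
  have R_eq: "R x = f x * T x + f x * (norm x * deriv h (norm x)) / (norm x)\<^sup>2 * (norm (X x))\<^sup>2" if x: "x \<in> M" for x
  proof -
    have "(\<lambda>t. exp (h t) * deriv h t) differentiable (at (norm x))"
      using real_differentiable_def[THEN iffD2, OF exI, OF g[OF norm_pos[OF x]]]
        real_differentiable_def[THEN iffD2, OF exI, OF h2[OF norm_pos[OF x]]]
      by (rule differentiable_mult)
    from hess_radial_orthogonal[OF g this _ ortho[OF x]] norm_pos[OF x]
    have "hess (\<lambda>x. exp (h (norm x))) x (X x) (X x) = f x * deriv h (norm x) / norm x * (norm (X x))\<^sup>2"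
      by (simp add: f_def)
    then show ?thesis
      using norm_pos[OF x] by (simp add: R_def power2_eq_square)
  qed
  have cont_R: "continuous_on M R"
  proof -
    have "continuous_on M (\<lambda>x. f x * T x + f x * (norm x * deriv h (norm x)) / (norm x)\<^sup>2 * (norm (X x))\<^sup>2)"
      by (intro continuous_intros cont_T cont_h' cont_f cont_X; simp)
    then show ?thesis
      by (rule continuous_on_eq) (simp only: R_eq)
  qed
  note int = integrable_cone[OF K]
  have int_\<phi>: "set_integrable ?\<mu> M \<phi>" and int_P: "set_integrable ?\<mu> M P"
    by (rule int[OF cont_\<phi>], simp add: \<phi>_def X0, rule int[OF cont_P], simp add: P_def X0)
  have int_\<psi>: "set_integrable ?\<mu> M \<psi>"
    by (rule int[OF cont_\<psi>]) (simp add: \<psi>_def \<phi>_def X0)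
  have int_R: "set_integrable ?\<mu> M R"
    by (rule int[OF cont_R]) (simp add: R_eq X0 T0)
  have deriv_\<phi>: "((\<lambda>s. \<phi> (s *\<^sub>R x)) has_real_derivative \<psi> x) (at 1)" if x: "x \<in> M" for x
  proof -
    let ?r = "norm x"
    \<comment> \<open>The norm of \<open>s *\<^sub>R x\<close> is replaced by
      \<open>s * norm x\<close>, which is plainly differentiable in s; the two agree for s > 0, the
      neighbourhood used in the final transfer to \<open>\<phi>\<close>.\<close>
    have "((\<lambda>s. s * ?r) has_real_derivative ?r) (at 1)"
      by (auto intro!: derivative_eq_intros)
    from DERIV_chain2[of "\<lambda>t. exp (h t)" _ "\<lambda>s. s * ?r" 1, OF _ this] g[OF norm_pos[OF x]]
    have E: "((\<lambda>s. exp (h (s * ?r))) has_real_derivative f x * deriv h ?r * ?r) (at 1)"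
      by (simp add: f_def)
    note ray = has_vector_derivative_along_ray[OF X1 x, folded D_def]
    have n: "((\<lambda>s. X (s *\<^sub>R x) \<bullet> X (s *\<^sub>R x)) has_real_derivative 2 * (X x \<bullet> D x)) (at 1)"
      using bounded_bilinear.has_vector_derivative[OF bounded_bilinear_inner ray ray]
      by (simp add: has_real_derivative_iff_has_vector_derivative inner_commute)
    have i: "((\<lambda>s. (inverse s)\<^sup>2) has_real_derivative - 2) (at (1::real))"
      by (auto intro!: derivative_eq_intros)
    have "((\<lambda>s. exp (h (s * ?r)) * (X (s *\<^sub>R x) \<bullet> X (s *\<^sub>R x)) * (inverse s)\<^sup>2 / ?r\<^sup>2) has_real_derivative \<psi> x) (at 1)"
      by (rule DERIV_cong[OF DERIV_cdivide[OF DERIV_mult[OF DERIV_mult[OF E n] i]]])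
         (use norm_pos[OF x] in \<open>simp add: \<psi>_def \<phi>_def f_def power2_norm_eq_inner field_simps\<close>)
    then show ?thesis
    proof (rule has_field_derivative_transform_within_open[of _ _ _ "{0<..}"])
      show "exp (h (s * ?r)) * (X (s *\<^sub>R x) \<bullet> X (s *\<^sub>R x)) * (inverse s)\<^sup>2 / ?r\<^sup>2 = \<phi> (s *\<^sub>R x)"
        if "s \<in> {0<..}" for s
        using that by (simp add: \<phi>_def f_def power2_norm_eq_inner[symmetric] power_mult_distrib divide_inverse power_inverse)
    qed auto
  qed
  have parts: "(LINT x:M|?\<mu>. \<psi> x) = - k * (LINT x:M|?\<mu>. \<phi> x)"
    unfolding k_def
    by (rule radial_integration_by_parts[OF K cont_\<phi> _ cont_\<psi> _ deriv_\<phi>]) (simp_all add: \<psi>_def \<phi>_def X0)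
  have L_le: "L x \<le> P x" and P_nonneg: "0 \<le> P x" if x: "x \<in> M" for x
  proof -
    have S: "sgn x \<in> S" using x M_iff by auto
    have f: "0 < f x" by (simp add: f_def)
    have A': "second_ff_normsq (sphere 0 1) S (sgn x) \<le> \<alpha>\<^sup>2 + b"
      using A[OF S] C by (simp add: k_def)
    \<comment> \<open>That \<open>\<alpha>\<^sup>2 + b\<close> is nonnegative follows from the
      curvature bound itself, since it dominates a sum of squares; \<open>b\<close> alone may be
      negative.\<close>
    have "0 \<le> second_ff_normsq (sphere 0 1) S (sgn x)"
      unfolding second_ff_normsq_def by (intro sum_nonneg) simp
    then have "0 \<le> \<alpha>\<^sup>2 + b"
      using A' by simp
    then show "0 \<le> P x"
      using f by (simp add: P_def)
    have "mean_curv UNIV M x = 0"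
      using mean_curv_cone[OF x] minimal S by (simp add: minimal_in_def)
    then have "L x = f x * (\<Sum>u\<in>onb (tangent_space M x). \<Sum>v\<in>onb (tangent_space M x). (second_ff UNIV M x u v \<bullet> X x)\<^sup>2)"
      by (simp add: L_def)
    also have "\<dots> \<le> f x * (second_ff_normsq (sphere 0 1) S (sgn x) * (norm (X x))\<^sup>2 / (norm x)\<^sup>2)"
      using f by (intro mult_left_mono sum_second_ff_cone_le[OF x]) simp
    also have "\<dots> \<le> f x * ((\<alpha>\<^sup>2 + b) * (norm (X x))\<^sup>2 / (norm x)\<^sup>2)"
      using f A' by (intro mult_left_mono divide_right_mono mult_right_mono) auto
    finally show "L x \<le> P x"
      by (simp add: P_def mult.assoc)
  qed
  have "(LINT x:M|?\<mu>. L x) \<le> (LINT x:M|?\<mu>. P x)"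
  \<comment> \<open>Integrability of \<open>L\<close>, which involves chosen bases and extensions,
    is avoided by this case split: the integral of a non-integrable function is 0 by convention, and
    \<open>P\<close> is nonnegative.\<close>
  proof (cases "set_integrable ?\<mu> M L")
    case True
    then show ?thesis
      using int_P L_le by (rule set_integral_mono)
  next
    case False
    then have "(LINT x:M|?\<mu>. L x) = 0"
      unfolding set_lebesgue_integral_def set_integrable_def by (rule not_integrable_integral_eq)
    also have "0 \<le> (LINT x:M|?\<mu>. P x)"
      unfolding set_lebesgue_integral_def
      using P_nonneg by (intro Bochner_Integration.integral_nonneg) (simp add: indicator_def)
    finally show ?thesis .
  qed
  \<comment> \<open>By \<open>parts\<close> the subtracted bracket has integral zero; inserting it
    makes a pointwise comparison with \<open>R\<close> possible, which \<open>P\<close> alone need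
    not satisfy.\<close>
  also have "\<dots> = (LINT x:M|?\<mu>. P x - \<alpha> * (\<psi> x + k * \<phi> x))"
  proof -
    have i: "set_integrable ?\<mu> M (\<lambda>x. k * \<phi> x)"
      using int_\<phi> by (simp add: set_integrable_mult_right)
    have j: "set_integrable ?\<mu> M (\<lambda>x. \<alpha> * (\<psi> x + k * \<phi> x))"
      using set_integral_add(1)[OF int_\<psi> i] by (simp add: set_integrable_mult_right)
    show ?thesis
      using parts set_integral_diff(2)[OF int_P j] set_integral_add(2)[OF int_\<psi> i] by simp
  qed
  also have "\<dots> \<le> (LINT x:M|?\<mu>. R x)"
  proof (rule set_integral_mono)
    show "set_integrable ?\<mu> M (\<lambda>x. P x - \<alpha> * (\<psi> x + k * \<phi> x))"
      by (intro set_integral_diff(1) set_integral_add(1) set_integrable_mult_right int_P int_\<psi> int_\<phi>)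
    show "set_integrable ?\<mu> M R" by fact
    show "P x - \<alpha> * (\<psi> x + k * \<phi> x) \<le> R x" if x: "x \<in> M" for x
      unfolding R_eq[OF x] P_def \<psi>_def \<phi>_def
      by (rule hardy_pointwise[OF _ norm_pos[OF x] _ b[OF norm_pos[OF x]] \<alpha>])
         (use radial_deriv_le_sum_normal_conn[OF X x] in \<open>simp_all add: f_def T_def D_def\<close>)
  qed
  finally show "(LINT x:M|?\<mu>. exp (h (norm x)) * ((\<Sum>u\<in>onb (tangent_space M x). \<Sum>v\<in>onb (tangent_space M x).
        (second_ff UNIV M x u v \<bullet> X x)\<^sup>2) + (mean_curv UNIV M x \<bullet> X x)\<^sup>2)) \<le>
      (LINT x:M|?\<mu>. exp (h (norm x)) * (\<Sum>u\<in>onb (tangent_space M x). (norm (normal_conn UNIV M X x u))\<^sup>2)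
        + hess (\<lambda>x. exp (h (norm x))) x (X x) (X x))"
    unfolding L_def R_def T_def f_def .
qed

theorem theorem1p6:
  fixes h :: "real \<Rightarrow> real" and a b :: real and k :: nat and S :: "(real ^ 'n) set"
  assumes "1 \<le> k"
    and "C2_on {0<..} h"
    and "((\<lambda>t. exp (h t) * t ^ k) \<longlongrightarrow> a) (at_right 0)"
    and "bdd_below ((\<lambda>t. t * deriv h t) ` {0<..})"
    and "(INF t\<in>{0<..}. t * deriv h t) = b"
    and "b > 2 - real k"
    and "C2_submanifold (k - 1) S" and "compact S" and "S \<subseteq> sphere 0 1"
    and "minimal_in (sphere 0 1) S"
    and "globally_flat_normal_bundle (sphere 0 1) S"
    and "\<forall>p\<in>S. second_ff_normsq (sphere 0 1) S p \<le> (real k - 2 + b)\<^sup>2 / 4 + b"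
  shows "f_stable k (\<lambda>x. exp (h (norm x))) (cone_over S - {0})"
proof -
  interpret compact_spherical_submanifold "k - 1" S
    by unfold_locales (use assms in auto)
  have k: "Suc (k - 1) = k"
    using \<open>1 \<le> k\<close> by simp
  \<comment> \<open>Boundedness from below is what makes \<open>INF\<close> over the reals an actual
    lower bound.\<close>
  have "b \<le> t * deriv h t" if "0 < t" for t
    using cINF_lower[OF assms(4), of t] assms(5) that by simp
  then show ?thesis
    using f_stable_cone[unfolded k, OF assms(2) _ assms(6,10)] assms(12) by blast
qed

end
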